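(* Let $X$ be a separable complex Banach space, $T$ a bounded linear operator on $X$, $\Omega\subset\mathbb{C}$ a bounded open set containing $\sigma(T)$, and $f\colon\Omega\to\mathbb{C}$ an analytic function that is not constant on any connected component of $\Omega$. (1) If the root spaces of $T$ form an unconditional basis, then the root spaces of $f(T)$ form an unconditional basis. (2) Suppose $f'\ne 0$ on $\sigma(T)$. If $f(T)$ is a good discrete operator, then $T$ is a good discrete operator; in particular, its root spaces form an unconditional basis.
   Context: $f(T)$ is defined by the Riesz--Dunford functional calculus. For a bounded operator $A$ on $X$, $\sigma_p(A)$ is its point spectrum, and the root space of $A$ at $\lambda\in\mathbb{C}$ is $R_A(\lambda)=\operatorname{clos}\bigcup_{j\ge1}\ker(A-\lambda)^j$; the root spaces of $A$ are the spaces $R_A(\lambda)$, $\lambda\in\sigma_p(A)$. A countable family $\{X_\alpha\}_{\alpha\in I}$ of linearly independent subspaces of $X$ is an unconditional basis in $X$ if it is complete in $X$ (its linear span is dense in $X$) and there is a constant $C>0$ such that $\big\|\sum_{\alpha\in F_1}x_\alpha\big\|\le C\big\|\sum_{\alpha\in F_2}x_\alpha\big\|$ for all finite subsets $F_1\subset F_2$ of $I$ and all $x_\alpha\in X_\alpha$. Saying that the root spaces of an operator form an unconditional basis includes the requirement that its point spectrum is countable. If the root spaces of $A$ form an unconditional basis in $X$, let $S$ be the unique bounded operator on $X$ such that $Sx=\lambda x$ for all $\lambda\in\sigma_p(A)$ and $x\in R_A(\lambda)$, and put $N=A-S$. The operator $A$ is called a good discrete operator if its point spectrum is countable, its root spaces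 form an unconditional basis in $X$, and the corresponding operator $N$ is quasinilpotent. *)

theory Defs
  imports "HOL-Complex_Analysis.Complex_Analysis"
begin

section \<open>Complex Banach spaces and their bounded operators\<close>

class complex_banach = banach +
  fixes scaleC :: "complex \<Rightarrow> 'a \<Rightarrow> 'a"  (infixr \<open>*\<^sub>C\<close> 75)
  assumes scaleC_add_right: "c *\<^sub>C (x + y) = c *\<^sub>C x + c *\<^sub>C y"
    and scaleC_add_left: "(c + d) *\<^sub>C x = c *\<^sub>C x + d *\<^sub>C x"
    and scaleC_scaleC: "c *\<^sub>C (d *\<^sub>C x) = (c * d) *\<^sub>C x"
    and scaleC_of_real: "complex_of_real r *\<^sub>C x = r *\<^sub>R x"
    and norm_scaleC: "norm (c *\<^sub>C x) = cmod c * norm x"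

lemma scaleC_one: "1 *\<^sub>C x = (x :: 'a::complex_banach)"
  using scaleC_of_real[of 1 x] by simp

global_interpretation complex_vector: vector_space "scaleC :: complex \<Rightarrow> 'a \<Rightarrow> 'a::complex_banach"
  by unfold_locales (simp_all add: scaleC_add_right scaleC_add_left scaleC_scaleC scaleC_one)

instantiation complex :: complex_banach
begin
definition scaleC_complex :: "complex \<Rightarrow> complex \<Rightarrow> complex" where
  "scaleC_complex c x = c * x"
instance
  by standard (simp_all add: scaleC_complex_def algebra_simps scaleR_conv_of_real norm_mult)
end

text \<open>The type \<open>'a \<Rightarrow>\<^sub>L 'a\<close> consists of the bounded \<^emph>\<open>real\<close>-linear operators. A bounded operator
  on a complex Banach space is an element of this type that satisfies the following predicate.\<close>

definition complex_linear :: "('a::complex_banach \<Rightarrow>\<^sub>L 'a) \<Rightarrow> bool" where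
  "complex_linear A \<longleftrightarrow> (\<forall>c x. A (c *\<^sub>C x) = c *\<^sub>C A x)"

definition scalar_op :: "complex \<Rightarrow> 'a::complex_banach \<Rightarrow>\<^sub>L 'a" where
  "scalar_op c = Blinfun (\<lambda>x. c *\<^sub>C x)"

lemma scalar_op_apply [simp]: "blinfun_apply (scalar_op c) x = c *\<^sub>C x"
proof -
  have "bounded_linear (\<lambda>x :: 'a. c *\<^sub>C x)"
  proof (rule bounded_linear_intro[where K = "cmod c"])
    fix r :: real and y :: 'a
    show "c *\<^sub>C r *\<^sub>R y = r *\<^sub>R c *\<^sub>C y"
      by (simp add: scaleC_of_real[symmetric] scaleC_scaleC mult.commute)
  qed (simp_all add: scaleC_add_right norm_scaleC mult.commute)
  then show ?thesis
    unfolding scalar_op_def by (simp add: bounded_linear_Blinfun_apply)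
qed

section \<open>Spectrum, resolvent and the Riesz--Dunford functional calculus\<close>

text \<open>The inverse of a complex-linear operator is itself complex-linear, so that it is harmless to
  ask for an inverse in \<open>'a \<Rightarrow>\<^sub>L 'a\<close>.\<close>

definition is_inverse_op :: "('a::complex_banach \<Rightarrow>\<^sub>L 'a) \<Rightarrow> ('a \<Rightarrow>\<^sub>L 'a) \<Rightarrow> bool" where
  "is_inverse_op A B \<longleftrightarrow> A o\<^sub>L B = id_blinfun \<and> B o\<^sub>L A = id_blinfun"

definition spectrum :: "('a::complex_banach \<Rightarrow>\<^sub>L 'a) \<Rightarrow> complex set" where
  "spectrum A = {z. \<not> (\<exists>B. is_inverse_op (scalar_op z - A) B)}"

definition resolvent :: "('a::complex_banach \<Rightarrow>\<^sub>L 'a) \<Rightarrow> complex \<Rightarrow> 'a \<Rightarrow>\<^sub>L 'a" where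
  "resolvent A z = (THE B. is_inverse_op (scalar_op z - A) B)"

text \<open>A finite list of closed piecewise continuously differentiable curves in \<open>\<Omega> - K\<close> which
  winds once around every point of \<open>K\<close> and zero times around every point outside \<open>\<Omega>\<close>. Such lists
  exist whenever \<open>K\<close> is compact and \<open>\<Omega>\<close> is an open set containing \<open>K\<close>.\<close>

definition surrounding_contour ::
  "complex set \<Rightarrow> complex set \<Rightarrow> (real \<Rightarrow> complex) list \<Rightarrow> bool" where
  "surrounding_contour K \<Omega> \<Gamma> \<longleftrightarrow>
     (\<forall>\<gamma>\<in>set \<Gamma>. valid_path \<gamma> \<and> pathfinish \<gamma> = pathstart \<gamma> \<and> path_image \<gamma> \<subseteq> \<Omega> - K) \<and>
     (\<forall>z\<in>K. (\<Sum>\<gamma>\<leftarrow>\<Gamma>. winding_number \<gamma> z) = 1) \<and>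
     (\<forall>z. z \<notin> \<Omega> \<longrightarrow> (\<Sum>\<gamma>\<leftarrow>\<Gamma>. winding_number \<gamma> z) = 0)"

text \<open>The integral of \<open>F(z) dz\<close> along a curve for an operator-valued \<open>F\<close>. The integral on the
  right is taken in the Banach space \<open>'a \<Rightarrow>\<^sub>L 'a\<close> with the operator norm; composition with
  \<open>scalar_op\<close> is multiplication of an operator by a complex number.\<close>

definition op_contour_integral ::
  "(real \<Rightarrow> complex) \<Rightarrow> (complex \<Rightarrow> 'a::complex_banach \<Rightarrow>\<^sub>L 'a) \<Rightarrow> 'a \<Rightarrow>\<^sub>L 'a" where
  "op_contour_integral \<gamma> F =
     integral {0..1} (\<lambda>t. scalar_op (vector_derivative \<gamma> (at t within {0..1})) o\<^sub>L F (\<gamma> t))"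

text \<open>The operator \<open>f(T) = 1/(2\<pi>i) \<integral>\<^sub>\<Gamma> f(z) (z - T)\<^sup>-\<^sup>1 dz\<close>. For \<open>f\<close> analytic on \<open>\<Omega>\<close> it does not
  depend on the choice of the contour, by Cauchy's theorem.\<close>

definition riesz_dunford ::
  "complex set \<Rightarrow> (complex \<Rightarrow> complex) \<Rightarrow> ('a::complex_banach \<Rightarrow>\<^sub>L 'a) \<Rightarrow> 'a \<Rightarrow>\<^sub>L 'a" where
  "riesz_dunford \<Omega> f T =
     (let \<Gamma> = (SOME \<Gamma>. surrounding_contour (spectrum T) \<Omega> \<Gamma>) in
      scalar_op (1 / (2 * of_real pi * \<i>)) o\<^sub>L
        (\<Sum>\<gamma>\<leftarrow>\<Gamma>. op_contour_integral \<gamma> (\<lambda>z. scalar_op (f z) o\<^sub>L resolvent T z)))"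

section \<open>Root spaces, unconditional bases and good discrete operators\<close>

definition point_spectrum :: "('a::complex_banach \<Rightarrow>\<^sub>L 'a) \<Rightarrow> complex set" where
  "point_spectrum A = {\<mu>. \<exists>x. x \<noteq> 0 \<and> A x = \<mu> *\<^sub>C x}"

definition root_space :: "('a::complex_banach \<Rightarrow>\<^sub>L 'a) \<Rightarrow> complex \<Rightarrow> 'a set" where
  "root_space A \<mu> = closure (\<Union>j\<in>{1..}. {x. (blinfun_apply (A - scalar_op \<mu>) ^^ j) x = 0})"

definition independent_subspaces :: "'i set \<Rightarrow> ('i \<Rightarrow> 'a::complex_banach set) \<Rightarrow> bool" where
  "independent_subspaces I X \<longleftrightarrow>
     (\<forall>\<alpha>\<in>I. complex_vector.subspace (X \<alpha>)) \<and>
     (\<forall>F x. finite F \<and> F \<subseteq> I \<and> (\<forall>\<alpha>\<in>F. x \<alpha> \<in> X \<alpha>) \<and> (\<Sum>\<alpha>\<in>F. x \<alpha>) = 0 \<longrightarrow> (\<forall>\<alpha>\<in>F. x \<alpha> = 0))"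

definition unconditional_basis :: "'i set \<Rightarrow> ('i \<Rightarrow> 'a::complex_banach set) \<Rightarrow> bool" where
  "unconditional_basis I X \<longleftrightarrow>
     countable I \<and> independent_subspaces I X \<and>
     closure (complex_vector.span (\<Union>\<alpha>\<in>I. X \<alpha>)) = UNIV \<and>
     (\<exists>C>0. \<forall>F1 F2 x. finite F2 \<and> F1 \<subseteq> F2 \<and> F2 \<subseteq> I \<and> (\<forall>\<alpha>\<in>F2. x \<alpha> \<in> X \<alpha>) \<longrightarrow>
        norm (\<Sum>\<alpha>\<in>F1. x \<alpha>) \<le> C * norm (\<Sum>\<alpha>\<in>F2. x \<alpha>))"

definition root_spaces_basis :: "('a::complex_banach \<Rightarrow>\<^sub>L 'a) \<Rightarrow> bool" where
  "root_spaces_basis A \<longleftrightarrow> unconditional_basis (point_spectrum A) (root_space A)"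

text \<open>The operator \<open>S\<close> that acts on each root space as multiplication by its eigenvalue. It exists
  and is unique if the root spaces form an unconditional basis.\<close>

definition scalar_part :: "('a::complex_banach \<Rightarrow>\<^sub>L 'a) \<Rightarrow> 'a \<Rightarrow>\<^sub>L 'a" where
  "scalar_part A =
     (THE S. complex_linear S \<and> (\<forall>\<mu>\<in>point_spectrum A. \<forall>x\<in>root_space A \<mu>. S x = \<mu> *\<^sub>C x))"

text \<open>Inclusion instead of equality, since on the zero space every operator has empty spectrum.\<close>

definition quasinilpotent :: "('a::complex_banach \<Rightarrow>\<^sub>L 'a) \<Rightarrow> bool" where
  "quasinilpotent N \<longleftrightarrow> spectrum N \<subseteq> {0}"

definition good_discrete :: "('a::complex_banach \<Rightarrow>\<^sub>L 'a) \<Rightarrow> bool" where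
  "good_discrete A \<longleftrightarrow>
     countable (point_spectrum A) \<and> root_spaces_basis A \<and> quasinilpotent (A - scalar_part A)"

end

theory Submission
  imports Defs
begin

text \<open>
Let \<open>A = f(T)\<close>. For (1), the algebraic root space of \<open>A\<close> at \<open>\<mu>\<close> (the union of the kernels of
\<open>(A - \<mu>)\<^sup>j\<close>) is the sum of those of \<open>T\<close> at the finitely many \<open>\<zeta> \<in> \<sigma>(T)\<close> with \<open>f(\<zeta>) = \<mu>\<close>: dividing
the zeros out of \<open>(f - \<mu>)\<^sup>j\<close> leaves a function \<open>g\<close> without zeros on \<open>\<sigma>(T)\<close>, \<open>g(T)\<close> is invertible, and
kernels of powers of \<open>T - \<zeta>\<close> for different \<open>\<zeta>\<close> split off one at a time
(\<open>fcalc_kernel_decomposition\<close>). Hence the root spaces of \<open>A\<close> arise from those of \<open>T\<close> by grouping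
them into finite blocks, and grouping preserves unconditionality; closures are harmless, because
the inequality of an unconditional basis passes to limits.

For (2) the blocks have to be broken up again, with uniform bounds. This is a local matter on the
compact set \<open>\<sigma>(T)\<close>, since the unconditional inequality for subsets of two sets \<open>U\<close>, \<open>V\<close> gives the one for
subsets of \<open>U \<union> V\<close>. Fix \<open>\<zeta> \<in> \<sigma>(T)\<close>. As \<open>f'(\<zeta>) \<noteq> 0\<close>, \<open>f\<close> is injective near \<open>\<zeta>\<close>, so that \<open>f\<close> omits a
neighbourhood of \<open>f(\<zeta>)\<close> on the part of \<open>\<sigma>(T)\<close> in a small annulus around \<open>\<zeta>\<close>. Let \<open>V\<close> be a small disc
around \<open>f(\<zeta>)\<close> and \<open>P\<close> the projection onto the root spaces of \<open>A\<close> with eigenvalue in \<open>V\<close>, which is bounded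
because the root spaces of \<open>A\<close> form an unconditional basis. Because \<open>A\<close> is a good discrete operator, it
has no spectrum outside the closure of \<open>V\<close> on the range of \<open>P\<close>, and so \<open>T\<close> has no spectrum in the
annulus there (\<open>resolvent_factor_on_spectral_subset\<close>). A Riesz projection now cuts out the part of the
range of \<open>P\<close> that belongs to the inner disc. The resulting bounded operator \<open>E\<close> is the identity on the
root spaces of \<open>T\<close> with eigenvalue in a neighbourhood \<open>U\<close> of \<open>\<zeta>\<close> and zero on the other ones
(\<open>local_spectral_projection\<close>). Inside \<open>U\<close> the function \<open>f\<close> is injective, so different root spaces of \<open>T\<close>
lie in different root spaces of \<open>A\<close> and inherit their unconditional inequality. If moreover \<open>U\<close> lies
within \<open>e\<close> of \<open>\<zeta>\<close>, then \<open>T - \<zeta>\<close> and \<open>S - \<zeta>\<close>, with \<open>S\<close> the scalar part of \<open>T\<close>, have powers of size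
\<open>O(e\<^sup>n)\<close> on the range of \<open>E\<close>, whence \<open>(T - S)\<^sup>n = O((2e)\<^sup>n)\<close> for every \<open>e > 0\<close>, and \<open>T - S\<close> is
quasinilpotent.

The functional calculus is built from two ingredients. Bounded functionals separate points by the
Hahn--Banach theorem, which reduces identities between operator-valued integrals to Cauchy's theorem
for scalar functions. As \<open>\<Omega>\<close> may be disconnected and multiply connected, Cauchy's theorem is needed for
cycles, i.e. lists of closed curves; it is deduced from a contour made of the sides of small squares,
which also shows that contours surrounding a compact set exist.
\<close>

section \<open>Cycles\<close>

definition cycle_in :: "complex set \<Rightarrow> (real \<Rightarrow> complex) list \<Rightarrow> bool" where
  "cycle_in S \<Gamma> \<longleftrightarrow>
     (\<forall>\<gamma>\<in>set \<Gamma>. valid_path \<gamma> \<and> pathfinish \<gamma> = pathstart \<gamma> \<and> path_image \<gamma> \<subseteq> S)"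

definition cycle_integral :: "(real \<Rightarrow> complex) list \<Rightarrow> (complex \<Rightarrow> complex) \<Rightarrow> complex" where
  "cycle_integral \<Gamma> f = (\<Sum>\<gamma>\<leftarrow>\<Gamma>. contour_integral \<gamma> f)"

definition cycle_winding :: "(real \<Rightarrow> complex) list \<Rightarrow> complex \<Rightarrow> complex" where
  "cycle_winding \<Gamma> z = (\<Sum>\<gamma>\<leftarrow>\<Gamma>. winding_number \<gamma> z)"

lemma cycle_integral_simps [simp]:
  "cycle_integral [] f = 0"
  "cycle_integral (\<gamma> # \<Gamma>) f = contour_integral \<gamma> f + cycle_integral \<Gamma> f"
  "cycle_integral (\<Gamma> @ \<Delta>) f = cycle_integral \<Gamma> f + cycle_integral \<Delta> f"
  by (simp_all add: cycle_integral_def)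

lemma cycle_in_simps [simp]:
  "cycle_in S []"
  "cycle_in S (\<gamma> # \<Gamma>) \<longleftrightarrow>
     valid_path \<gamma> \<and> pathfinish \<gamma> = pathstart \<gamma> \<and> path_image \<gamma> \<subseteq> S \<and> cycle_in S \<Gamma>"
  "cycle_in S (\<Gamma> @ \<Delta>) \<longleftrightarrow> cycle_in S \<Gamma> \<and> cycle_in S \<Delta>"
  by (auto simp: cycle_in_def)

lemma cycle_in_mono: "cycle_in S \<Gamma> \<Longrightarrow> S \<subseteq> S' \<Longrightarrow> cycle_in S' \<Gamma>"
  by (auto simp: cycle_in_def)

lemma surrounding_contour_iff:
  "surrounding_contour K \<Omega> \<Gamma> \<longleftrightarrow> cycle_in (\<Omega> - K) \<Gamma> \<and>
     (\<forall>z\<in>K. cycle_winding \<Gamma> z = 1) \<and> (\<forall>z. z \<notin> \<Omega> \<longrightarrow> cycle_winding \<Gamma> z = 0)"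
  by (simp add: surrounding_contour_def cycle_in_def cycle_winding_def)

lemma cycle_winding_conv:
  assumes "cycle_in S \<Gamma>" "z \<notin> S"
  shows "2 * pi * \<i> * cycle_winding \<Gamma> z = cycle_integral \<Gamma> (\<lambda>w. 1 / (w - z))"
  using assms
proof (induction \<Gamma>)
  case (Cons \<gamma> \<Gamma>)
  then have "winding_number \<gamma> z = 1/(2*pi*\<i>) * contour_integral \<gamma> (\<lambda>w. 1/(w - z))"
    by (intro winding_number_valid_path) auto
  then show ?case using Cons by (simp add: cycle_winding_def distrib_left)
qed (simp add: cycle_winding_def)

lemma cycle_integrable:
  assumes "cycle_in S \<Gamma>" "open S" "f holomorphic_on S" "\<gamma> \<in> set \<Gamma>"
  shows "f contour_integrable_on \<gamma>"
  using assms by (auto simp: cycle_in_def intro: contour_integrable_holomorphic_simple)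

lemma cycle_integral_add:
  assumes "cycle_in S \<Gamma>" "open S" "f holomorphic_on S" "g holomorphic_on S"
  shows "cycle_integral \<Gamma> (\<lambda>z. f z + g z) = cycle_integral \<Gamma> f + cycle_integral \<Gamma> g"
  using assms
proof (induction \<Gamma>)
  case (Cons \<gamma> \<Gamma>)
  then have "f contour_integrable_on \<gamma>" "g contour_integrable_on \<gamma>"
    by (auto intro: cycle_integrable[of S "\<gamma> # \<Gamma>"])
  with Cons show ?case by (simp add: contour_integral_add)
qed simp

lemma cycle_integral_diff:
  assumes "cycle_in S \<Gamma>" "open S" "f holomorphic_on S" "g holomorphic_on S"
  shows "cycle_integral \<Gamma> (\<lambda>z. f z - g z) = cycle_integral \<Gamma> f - cycle_integral \<Gamma> g"
  using assms
proof (induction \<Gamma>)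
  case (Cons \<gamma> \<Gamma>)
  then have "f contour_integrable_on \<gamma>" "g contour_integrable_on \<gamma>"
    by (auto intro: cycle_integrable[of S "\<gamma> # \<Gamma>"])
  with Cons show ?case by (simp add: contour_integral_diff)
qed simp

lemma cycle_integral_lmul:
  assumes "cycle_in S \<Gamma>" "open S" "f holomorphic_on S"
  shows "cycle_integral \<Gamma> (\<lambda>z. c * f z) = c * cycle_integral \<Gamma> f"
  using assms
proof (induction \<Gamma>)
  case (Cons \<gamma> \<Gamma>)
  then have "f contour_integrable_on \<gamma>"
    by (auto intro: cycle_integrable[of S "\<gamma> # \<Gamma>"])
  with Cons show ?case by (simp add: contour_integral_lmul distrib_left)
qed simp

lemma cycle_integral_cong:
  assumes "cycle_in S \<Gamma>" "\<And>z. z \<in> S \<Longrightarrow> f z = g z"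
  shows "cycle_integral \<Gamma> f = cycle_integral \<Gamma> g"
  using assms
proof (induction \<Gamma>)
  case (Cons \<gamma> \<Gamma>)
  then show ?case by (auto intro!: contour_integral_cong)
qed simp

text \<open>A family of paths in which every point is as often a starting point as an end point can be glued to
closed curves: as long as some path is not closed, another one starts at its end, and joining the
two leaves a shorter balanced family.\<close>

lemma balanced_paths_regroup:
  assumes "\<And>\<gamma>. \<gamma> \<in> set E \<Longrightarrow> valid_path \<gamma> \<and> path_image \<gamma> \<subseteq> S"
    and "image_mset pathstart (mset E) = image_mset pathfinish (mset E)"
  shows "\<exists>\<Gamma>. cycle_in S \<Gamma> \<and>
    (\<forall>F. (\<forall>\<gamma>\<in>set E. F contour_integrable_on \<gamma>) \<longrightarrow> cycle_integral \<Gamma> F = cycle_integral E F)"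
  using assms
proof (induction "length E" arbitrary: E rule: less_induct)
  case less
  show ?case
  proof (cases E)
    case Nil
    then show ?thesis by (intro exI[of _ "[]"]) simp
  next
    case (Cons p E')
    show ?thesis
    proof (cases "pathfinish p = pathstart p")
      case True
      with less(1)[of E'] less(2,3) Cons obtain \<Gamma> where "cycle_in S \<Gamma>"
        "\<forall>F. (\<forall>\<gamma>\<in>set E'. F contour_integrable_on \<gamma>) \<longrightarrow> cycle_integral \<Gamma> F = cycle_integral E' F"
        by auto
      with True less(2) Cons show ?thesis by (intro exI[of _ "p # \<Gamma>"]) auto
    next
      case False
      have "pathfinish p \<in># image_mset pathstart (mset E)"
        unfolding less(3) using Cons by simp
      with False Cons obtain q where q: "q \<in> set E'" "pathstart q = pathfinish p"
        by auto
      obtain R where mE': "mset E' = add_mset q (mset R)"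
        using q(1) by (metis ex_mset insert_DiffM set_mset_mset)
      define E'' where "E'' = (p +++ q) # R"
      have sE': "set E' = insert q (set R)"
        by (metis mE' set_mset_add_mset_insert set_mset_mset)
      have "length E'' < length E"
        using arg_cong[OF mE', of size] Cons by (simp add: E''_def)
      moreover have "valid_path \<gamma> \<and> path_image \<gamma> \<subseteq> S" if "\<gamma> \<in> set E''" for \<gamma>
        using that less(2)[of \<gamma>] less(2)[of p] less(2)[of q] q Cons sE'
        by (auto simp: E''_def valid_path_join path_image_join)
      moreover have "image_mset pathstart (mset E'') = image_mset pathfinish (mset E'')"
        using less(3) Cons mE' q by (simp add: E''_def)
      ultimately obtain \<Gamma> where \<Gamma>: "cycle_in S \<Gamma>"
        "\<forall>F. (\<forall>\<gamma>\<in>set E''. F contour_integrable_on \<gamma>) \<longrightarrow> cycle_integral \<Gamma> F = cycle_integral E'' F"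
        using less(1)[of E''] by blast
      have "cycle_integral \<Gamma> F = cycle_integral E F" if F: "\<forall>\<gamma>\<in>set E. F contour_integrable_on \<gamma>" for F
      proof -
        have pq: "valid_path p" "valid_path q" "F contour_integrable_on p" "F contour_integrable_on q"
          using less(2) q Cons F by auto
        have "\<forall>\<gamma>\<in>set E''. F contour_integrable_on \<gamma>"
          using F pq q Cons sE' by (auto simp: E''_def intro!: contour_integrable_joinI)
        then have "cycle_integral \<Gamma> F = cycle_integral E'' F" using \<Gamma> by blast
        also have "\<dots> = contour_integral p F + (contour_integral q F + cycle_integral R F)"
          using pq q by (simp add: E''_def contour_integral_join)
        also have "contour_integral q F + cycle_integral R F = cycle_integral E' F"
          using arg_cong[OF mE', of "\<lambda>M. sum_mset (image_mset (\<lambda>\<gamma>. contour_integral \<gamma> F) M)"]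
          by (simp add: cycle_integral_def sum_mset_sum_list[symmetric])
        finally show ?thesis using Cons by simp
      qed
      with \<Gamma>(1) show ?thesis by blast
    qed
  qed
qed

section \<open>Surrounding a compact set by the sides of squares\<close>

definition grid_point :: "real \<Rightarrow> int \<Rightarrow> int \<Rightarrow> complex" where
  "grid_point d m n = Complex (d * m) (d * n)"

definition grid_cell :: "real \<Rightarrow> int \<times> int \<Rightarrow> complex set" where
  "grid_cell d = (\<lambda>(m, n). cbox (grid_point d m n) (grid_point d (m + 1) (n + 1)))"

definition cell_edges :: "real \<Rightarrow> int \<times> int \<Rightarrow> (complex \<times> complex) list" where
  "cell_edges d = (\<lambda>(m, n).
     [(grid_point d m n, grid_point d (m + 1) n),
      (grid_point d (m + 1) n, grid_point d (m + 1) (n + 1)),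
      (grid_point d (m + 1) (n + 1), grid_point d m (n + 1)),
      (grid_point d m (n + 1), grid_point d m n)])"

text \<open>The sides of the given cells that they do not share with another of these cells, oriented
counterclockwise as in \<open>cell_edges\<close>.\<close>

definition boundary_edges :: "real \<Rightarrow> (int \<times> int) list \<Rightarrow> (complex \<times> complex) list" where
  "boundary_edges d xs =
     map (\<lambda>s. cell_edges d s ! 0) (filter (\<lambda>(m, n). (m, n - 1) \<notin> set xs) xs) @
     map (\<lambda>s. cell_edges d s ! 1) (filter (\<lambda>(m, n). (m + 1, n) \<notin> set xs) xs) @
     map (\<lambda>s. cell_edges d s ! 2) (filter (\<lambda>(m, n). (m, n + 1) \<notin> set xs) xs) @
     map (\<lambda>s. cell_edges d s ! 3) (filter (\<lambda>(m, n). (m - 1, n) \<notin> set xs) xs)"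

lemma sum_filter_split:
  fixes F :: "'i \<Rightarrow> 'b::ab_group_add"
  assumes "distinct xs"
  shows "(\<Sum>s\<in>set xs. F s) = sum_list (map F (filter P xs)) + (\<Sum>s | s \<in> set xs \<and> \<not> P s. F s)"
proof -
  have "sum_list (map F (filter P xs)) = (\<Sum>s | s \<in> set xs \<and> P s. F s)"
    using assms by (subst sum_list_distinct_conv_sum_set) auto
  moreover have "(\<Sum>s\<in>set xs. F s) = (\<Sum>s | s \<in> set xs \<and> P s. F s) + (\<Sum>s | s \<in> set xs \<and> \<not> P s. F s)"
    by (subst sum.union_disjoint[symmetric]) (auto intro!: sum.cong)
  ultimately show ?thesis by simp
qed

text \<open>A side shared by two of the cells occurs once in each direction and cancels. The lemma is stated
for an arbitrary antisymmetric function of oriented segments, because it serves both for contour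
integrals and for counting how often a point starts and ends an edge.\<close>

lemma sum_boundary_edges:
  fixes I :: "complex \<times> complex \<Rightarrow> 'b::ab_group_add"
  assumes anti: "\<And>a b. I (b, a) = - I (a, b)" and xs: "distinct xs"
  shows "sum_list (map I (boundary_edges d xs)) = (\<Sum>s\<in>set xs. sum_list (map I (cell_edges d s)))"
proof -
  define e where "e = (\<lambda>k s. I (cell_edges d s ! k))"
  let ?S = "set xs"
  have four: "sum_list (map I (cell_edges d s)) = e 0 s + e 1 s + e 2 s + e 3 s" for s
    by (auto simp: e_def cell_edges_def eval_nat_numeral split: prod.splits)
  have H: "(\<Sum>s | s \<in> ?S \<and> \<not> (case s of (m, n) \<Rightarrow> (m, n - 1) \<notin> ?S). e 0 s) =
           - (\<Sum>s | s \<in> ?S \<and> \<not> (case s of (m, n) \<Rightarrow> (m, n + 1) \<notin> ?S). e 2 s)"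
    unfolding sum_negf[symmetric]
    by (rule sum.reindex_bij_witness[of _ "\<lambda>(m, n). (m, n + 1)" "\<lambda>(m, n). (m, n - 1)"])
       (auto simp: e_def cell_edges_def eval_nat_numeral, metis anti)
  have V: "(\<Sum>s | s \<in> ?S \<and> \<not> (case s of (m, n) \<Rightarrow> (m + 1, n) \<notin> ?S). e 1 s) =
           - (\<Sum>s | s \<in> ?S \<and> \<not> (case s of (m, n) \<Rightarrow> (m - 1, n) \<notin> ?S). e 3 s)"
    unfolding sum_negf[symmetric]
    by (rule sum.reindex_bij_witness[of _ "\<lambda>(m, n). (m - 1, n)" "\<lambda>(m, n). (m + 1, n)"])
       (auto simp: e_def cell_edges_def eval_nat_numeral, metis anti)
  have "(\<Sum>s\<in>?S. sum_list (map I (cell_edges d s))) =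
        (\<Sum>s\<in>?S. e 0 s) + (\<Sum>s\<in>?S. e 1 s) + (\<Sum>s\<in>?S. e 2 s) + (\<Sum>s\<in>?S. e 3 s)"
    by (simp add: four sum.distrib)
  also have "\<dots> = sum_list (map I (boundary_edges d xs))"
    unfolding sum_filter_split[OF xs, of "e 0" "\<lambda>(m, n). (m, n - 1) \<notin> ?S"]
      sum_filter_split[OF xs, of "e 1" "\<lambda>(m, n). (m + 1, n) \<notin> ?S"]
      sum_filter_split[OF xs, of "e 2" "\<lambda>(m, n). (m, n + 1) \<notin> ?S"]
      sum_filter_split[OF xs, of "e 3" "\<lambda>(m, n). (m - 1, n) \<notin> ?S"] H V
    by (simp add: boundary_edges_def e_def o_def algebra_simps)
  finally show ?thesis by simp
qed

text \<open>This holds for every \<open>F\<close>, integrable or not, as is needed to apply \<open>sum_boundary_edges\<close>.\<close>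

lemma contour_integral_linepath_swap:
  "contour_integral (linepath b a) F = - contour_integral (linepath a b) F"
proof (cases "F contour_integrable_on linepath a b")
  case True
  then have "(F has_contour_integral - contour_integral (linepath a b) F) (linepath b a)"
    by (intro has_contour_integral_reverse_linepath has_contour_integral_integral)
  then show ?thesis by (rule contour_integral_unique)
next
  case False
  then have "\<not> F contour_integrable_on linepath b a"
    by (meson contour_integrable_on_def has_contour_integral_reverse_linepath)
  with False show ?thesis by (simp add: not_integrable_contour_integral)
qed

lemma cell_edges_rectpath:
  assumes "continuous_on (path_image (rectpath (grid_point d m n) (grid_point d (m + 1) (n + 1)))) F"
  shows "(\<Sum>(a, b)\<leftarrow>cell_edges d (m, n). contour_integral (linepath a b) F) =
         contour_integral (rectpath (grid_point d m n) (grid_point d (m + 1) (n + 1))) F"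
proof -
  have "continuous_on (closed_segment a b) F" if "(a, b) \<in> set (cell_edges d (m, n))" for a b
    using that by (intro continuous_on_subset[OF assms])
      (auto simp: cell_edges_def rectpath_def Let_def path_image_join grid_point_def)
  then have i: "F contour_integrable_on linepath a b" if "(a, b) \<in> set (cell_edges d (m, n))" for a b
    using that by (blast intro: contour_integrable_continuous_linepath)
  note i' = i[unfolded cell_edges_def grid_point_def, simplified]
  show ?thesis
    using i' by (simp add: cell_edges_def rectpath_def Let_def grid_point_def
        contour_integral_join contour_integrable_joinI add.assoc)
qed

lemma cycle_winding_locally_constant:
  assumes "cycle_in S \<Gamma>" "ball z r \<inter> (\<Union>\<gamma>\<in>set \<Gamma>. path_image \<gamma>) = {}" "z' \<in> ball z r"
  shows "cycle_winding \<Gamma> z' = cycle_winding \<Gamma> z"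
proof -
  have "winding_number \<gamma> z' = winding_number \<gamma> z" if "\<gamma> \<in> set \<Gamma>" for \<gamma>
  proof -
    have "winding_number \<gamma> constant_on ball z r"
      using that assms by (intro winding_number_constant) (auto simp: cycle_in_def valid_path_imp_path)
    moreover have "z \<in> ball z r" using assms(3) by (simp add: le_less_trans[OF zero_le_dist])
    ultimately show ?thesis using assms(3) unfolding constant_on_def by metis
  qed
  then show ?thesis unfolding cycle_winding_def by (metis (no_types, lifting) map_cong)
qed

lemma mem_grid_cell:
  "z \<in> grid_cell d (m, n) \<longleftrightarrow>
     d * m \<le> Re z \<and> Re z \<le> d * (m + 1) \<and> d * n \<le> Im z \<and> Im z \<le> d * (n + 1)"
  by (auto simp: grid_cell_def grid_point_def in_cbox_complex_iff)

lemma convex_grid_cell [simp]: "convex (grid_cell d s)"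
  by (cases s) (simp add: grid_cell_def)

lemma cell_edge_subset:
  assumes "d > 0"
  shows "\<And>a b. (a, b) \<in> set (cell_edges d s) \<Longrightarrow> closed_segment a b \<subseteq> grid_cell d s"
    and "\<And>a b. cell_edges d (m, n) ! 0 = (a, b) \<Longrightarrow> closed_segment a b \<subseteq> grid_cell d (m, n - 1)"
    and "\<And>a b. cell_edges d (m, n) ! 1 = (a, b) \<Longrightarrow> closed_segment a b \<subseteq> grid_cell d (m + 1, n)"
    and "\<And>a b. cell_edges d (m, n) ! 2 = (a, b) \<Longrightarrow> closed_segment a b \<subseteq> grid_cell d (m, n + 1)"
    and "\<And>a b. cell_edges d (m, n) ! 3 = (a, b) \<Longrightarrow> closed_segment a b \<subseteq> grid_cell d (m - 1, n)"
  using assms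
  by (cases s; intro closed_segment_subset;
      auto simp: cell_edges_def mem_grid_cell grid_point_def eval_nat_numeral algebra_simps)+

text \<open>A boundary edge lies in a cell of the family and in a cell outside of it. If the family consists
of all cells that meet a compact set, the edge therefore misses that set.\<close>

lemma boundary_edge_cells:
  assumes "d > 0" "(a, b) \<in> set (boundary_edges d xs)"
  obtains s t where "s \<in> set xs" "t \<notin> set xs" "(a, b) \<in> set (cell_edges d s)"
    "closed_segment a b \<subseteq> grid_cell d s" "closed_segment a b \<subseteq> grid_cell d t"
proof -
  have len: "k < 4 \<Longrightarrow> cell_edges d s ! k \<in> set (cell_edges d s)" for k s
    by (rule nth_mem) (auto simp: cell_edges_def split: prod.splits)
  note * = that[OF _ _ _ cell_edge_subset(1)[OF assms(1)]]
  from assms(2) consider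
      (bottom) m n where "(m, n) \<in> set xs" "(m, n - 1) \<notin> set xs" "cell_edges d (m, n) ! 0 = (a, b)"
    | (right) m n where "(m, n) \<in> set xs" "(m + 1, n) \<notin> set xs" "cell_edges d (m, n) ! 1 = (a, b)"
    | (top) m n where "(m, n) \<in> set xs" "(m, n + 1) \<notin> set xs" "cell_edges d (m, n) ! 2 = (a, b)"
    | (left) m n where "(m, n) \<in> set xs" "(m - 1, n) \<notin> set xs" "cell_edges d (m, n) ! 3 = (a, b)"
    unfolding boundary_edges_def by fastforce
  then show ?thesis
  proof cases
    case bottom
    then show ?thesis using *[OF bottom(1,2)] len[of 0, simplified] cell_edge_subset(2)[OF assms(1)] by metis
  next
    case right
    then show ?thesis using *[OF right(1,2)] len[of 1, simplified] cell_edge_subset(3)[OF assms(1)]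
      by (metis One_nat_def)
  next
    case top
    then show ?thesis using *[OF top(1,2)] len[of 2, simplified] cell_edge_subset(4)[OF assms(1)]
      by metis
  next
    case left
    then show ?thesis using *[OF left(1,2)] len[of 3, simplified] cell_edge_subset(5)[OF assms(1)]
      by metis
  qed
qed

lemma count_image_mset_sum_list:
  "int (count (image_mset f (mset xs)) v) = (\<Sum>x\<leftarrow>xs. if f x = v then 1 else 0)"
  by (induction xs) auto

text \<open>Going around a single cell is balanced, and by \<open>sum_boundary_edges\<close> so is the boundary of a family
of cells.\<close>

lemma boundary_edges_balanced:
  assumes "distinct xs"
  shows "image_mset fst (mset (boundary_edges d xs)) = image_mset snd (mset (boundary_edges d xs))"
proof (rule multiset_eqI)
  fix v
  define I :: "complex \<times> complex \<Rightarrow> int"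
    where "I = (\<lambda>p. (if fst p = v then 1 else 0) - (if snd p = v then 1 else 0))"
  have "sum_list (map I (boundary_edges d xs)) = (\<Sum>s\<in>set xs. sum_list (map I (cell_edges d s)))"
    by (rule sum_boundary_edges[OF _ assms]) (simp add: I_def)
  also have "\<dots> = 0"
    by (intro sum.neutral) (auto simp: I_def cell_edges_def)
  finally have "int (count (image_mset fst (mset (boundary_edges d xs))) v) =
      int (count (image_mset snd (mset (boundary_edges d xs))) v)"
    unfolding count_image_mset_sum_list by (simp add: I_def sum_list_subtractf)
  then show "count (image_mset fst (mset (boundary_edges d xs))) v =
      count (image_mset snd (mset (boundary_edges d xs))) v" by simp
qed

lemma finite_cells_meeting:
  assumes "bounded K" "d > 0"
  shows "finite {s. grid_cell d s \<inter> K \<noteq> {}}"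
proof -
  obtain B where B: "\<And>x. x \<in> K \<Longrightarrow> cmod x \<le> B"
    using assms(1) by (auto simp: bounded_iff)
  define N where "N = \<lceil>B / d\<rceil> + 1"
  have *: "m \<in> {- N..N}" if "d * m \<le> r" "r \<le> d * (m + 1)" "\<bar>r\<bar> \<le> B" for m :: int and r
  proof -
    have "d * m \<le> B" "- B \<le> d * (m + 1)" using that by auto
    then have "m \<le> B / d" "- (B / d) \<le> m + 1"
      using assms(2) by (simp_all add: field_simps)
    then show ?thesis unfolding N_def by (simp; linarith)
  qed
  have "{s. grid_cell d s \<inter> K \<noteq> {}} \<subseteq> {- N..N} \<times> {- N..N}"
  proof
    fix s assume "s \<in> {s. grid_cell d s \<inter> K \<noteq> {}}"
    then obtain m n x where s: "s = (m, n)" and x: "x \<in> grid_cell d (m, n)" "x \<in> K"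
      by (cases s) auto
    have "\<bar>Re x\<bar> \<le> B" "\<bar>Im x\<bar> \<le> B"
      using B[OF x(2)] abs_Re_le_cmod[of x] abs_Im_le_cmod[of x] by linarith+
    with x(1) *[of m "Re x"] *[of n "Im x"] show "s \<in> {- N..N} \<times> {- N..N}"
      by (simp add: s mem_grid_cell)
  qed
  then show ?thesis by (rule finite_subset) simp
qed

text \<open>Take all cells of a fine grid that meet \<open>K\<close>; they lie in \<open>\<Omega>\<close>. The sum of the integrals along their
boundaries is the integral along the cycle formed by the outer edges. Each summand vanishes for a
function that is holomorphic on \<open>\<Omega>\<close>, which yields the second assertion and the winding numbers outside
\<open>\<Omega>\<close>. For \<open>1/(w - z)\<close> with \<open>z\<close> in the interior of a cell exactly one summand is \<open>2\<pi>i\<close>. Points of \<open>K\<close> on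
the grid lines are reached by the local constancy of winding numbers.\<close>

lemma ex_surrounding_grid_cycle:
  assumes K: "compact K" and \<Omega>: "open \<Omega>" "K \<subseteq> \<Omega>"
  shows "\<exists>\<Gamma>. surrounding_contour K \<Omega> \<Gamma> \<and> (\<forall>f. f holomorphic_on \<Omega> \<longrightarrow> cycle_integral \<Gamma> f = 0)"
proof -
  obtain e where e: "e > 0" "(\<Union>x\<in>K. ball x e) \<subseteq> \<Omega>"
    using compact_subset_open_imp_ball_epsilon_subset[OF K \<Omega>] by blast
  \<comment> \<open>cells of side \<open>e / 3\<close> have diameter less than \<open>e\<close>\<close>
  define d where "d = e / 3"
  have d: "d > 0" using e by (simp add: d_def)
  define S where "S = {s. grid_cell d s \<inter> K \<noteq> {}}"
  have "finite S" unfolding S_def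
    using finite_cells_meeting[OF compact_imp_bounded[OF K] d] .
  then obtain xs where xs: "set xs = S" "distinct xs"
    using finite_distinct_list by blast
  have cell_sub: "grid_cell d s \<subseteq> \<Omega>" if "s \<in> S" for s
  proof
    fix y assume y: "y \<in> grid_cell d s"
    obtain m n where s: "s = (m, n)" by (cases s)
    obtain x where x: "x \<in> K" "x \<in> grid_cell d s" using \<open>s \<in> S\<close> by (auto simp: S_def)
    have "cmod (x - y) \<le> \<bar>Re (x - y)\<bar> + \<bar>Im (x - y)\<bar>" by (rule cmod_le)
    also have "\<dots> \<le> d + d"
      using x(2) y unfolding s mem_grid_cell of_int_add distrib_left minus_complex.simps of_int_1 mult_1_right by linarith
    also have "\<dots> < e" using e by (simp add: d_def)
    finally have "y \<in> ball x e" by (simp add: dist_norm)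
    with x(1) e(2) show "y \<in> \<Omega>" by blast
  qed
  define bs where "bs = boundary_edges d xs"
  define E where "E = map (\<lambda>(a, b). linepath a b) bs"
  have edge: "closed_segment a b \<subseteq> \<Omega> - K" if ab: "(a, b) \<in> set bs" for a b
  proof -
    obtain s t where "s \<in> S" "t \<notin> S" "closed_segment a b \<subseteq> grid_cell d s" "closed_segment a b \<subseteq> grid_cell d t"
      using boundary_edge_cells[OF d ab[unfolded bs_def]] unfolding xs(1) by metis
    with cell_sub[of s] show ?thesis unfolding S_def by blast
  qed
  have "image_mset pathstart (mset E) = image_mset pathfinish (mset E)"
    using boundary_edges_balanced[OF xs(2), of d]
    by (simp add: E_def bs_def image_mset.compositionality o_def case_prod_unfold flip: mset_map)
  moreover have "valid_path \<gamma> \<and> path_image \<gamma> \<subseteq> \<Omega> - K" if gE: "\<gamma> \<in> set E" for \<gamma>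
  proof -
    obtain a b where "(a, b) \<in> set bs" "\<gamma> = linepath a b"
      using gE by (auto simp: E_def)
    with edge[of a b] show ?thesis by simp
  qed
  ultimately obtain \<Gamma> where \<Gamma>: "cycle_in (\<Omega> - K) \<Gamma>"
    and \<Gamma>': "\<And>F. (\<forall>\<gamma>\<in>set E. F contour_integrable_on \<gamma>) \<Longrightarrow> cycle_integral \<Gamma> F = cycle_integral E F"
    using balanced_paths_regroup[of E "\<Omega> - K"] by blast
  have \<Gamma>E: "cycle_integral \<Gamma> F = cycle_integral E F"
    if "\<And>a b. (a, b) \<in> set bs \<Longrightarrow> F contour_integrable_on linepath a b" for F
    using that by (intro \<Gamma>') (auto simp: E_def)
  have sumE: "cycle_integral E F =
      (\<Sum>s\<in>S. \<Sum>(a, b)\<leftarrow>cell_edges d s. contour_integral (linepath a b) F)" for F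
  proof -
    have "(\<Sum>p\<leftarrow>bs. contour_integral (linepath (fst p) (snd p)) F) =
        (\<Sum>s\<in>set xs. \<Sum>p\<leftarrow>cell_edges d s. contour_integral (linepath (fst p) (snd p)) F)"
      unfolding bs_def
      by (rule sum_boundary_edges[OF _ xs(2)]) (simp, rule contour_integral_linepath_swap)
    then show ?thesis
      by (simp add: cycle_integral_def E_def o_def case_prod_unfold xs(1))
  qed
  have rect: "path_image (rectpath (grid_point d m n) (grid_point d (m + 1) (n + 1))) \<subseteq> grid_cell d (m, n)" for m n
    using d unfolding grid_cell_def by (auto simp: grid_point_def intro!: path_image_rectpath_subset_cbox[THEN subsetD])
  have cell0: "(\<Sum>(a, b)\<leftarrow>cell_edges d s. contour_integral (linepath a b) F) = 0"
    if "F holomorphic_on grid_cell d s" for F s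
  proof -
    obtain m n where s: "s = (m, n)" by (cases s)
    have "(F has_contour_integral 0) (rectpath (grid_point d m n) (grid_point d (m + 1) (n + 1)))"
      using that rect by (intro Cauchy_theorem_convex_simple[of _ "grid_cell d s"]) (auto simp: s)
    then show ?thesis unfolding s
      using cell_edges_rectpath[of d m n F] rect
      by (metis (no_types, lifting) contour_integral_unique continuous_on_subset
          holomorphic_on_imp_continuous_on s that)
  qed
  have hol0: "cycle_integral \<Gamma> F = 0" if "F holomorphic_on \<Omega>" for F
  proof -
    have "F contour_integrable_on linepath a b" if "(a, b) \<in> set bs" for a b
      using edge[OF that] \<open>F holomorphic_on \<Omega>\<close>
      by (intro contour_integrable_continuous_linepath)
        (meson Diff_subset continuous_on_subset holomorphic_on_imp_continuous_on subset_trans)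
    then have "cycle_integral \<Gamma> F = (\<Sum>s\<in>S. \<Sum>(a, b)\<leftarrow>cell_edges d s. contour_integral (linepath a b) F)"
      using \<Gamma>E sumE by simp
    also have "\<dots> = 0"
      using cell_sub that by (intro sum.neutral ballI cell0) (auto intro: holomorphic_on_subset)
    finally show ?thesis .
  qed
  have out: "cycle_winding \<Gamma> z = 0" if "z \<notin> \<Omega>" for z
  proof -
    have "cycle_integral \<Gamma> (\<lambda>w. 1 / (w - z)) = 0"
      using that by (intro hol0) (auto intro!: holomorphic_intros)
    with cycle_winding_conv[OF \<Gamma>, of z] that show ?thesis by simp
  qed
  have inn: "cycle_winding \<Gamma> z = 1" if "z \<in> K" for z
  proof -
    define m n where "m = \<lfloor>Re z / d\<rfloor>" and "n = \<lfloor>Im z / d\<rfloor>"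
    let ?c = "grid_point d m n" and ?c' = "grid_point d (m + 1) (n + 1)"
    have zc: "z \<in> grid_cell d (m, n)"
      using floor_divide_lower[OF d, of "Re z"] floor_divide_upper[OF d, of "Re z"]
        floor_divide_lower[OF d, of "Im z"] floor_divide_upper[OF d, of "Im z"]
      by (simp add: mem_grid_cell m_def n_def mult.commute)
    then have mn: "(m, n) \<in> S" using that by (auto simp: S_def)
    have "closed (\<Union>\<gamma>\<in>set \<Gamma>. path_image \<gamma>)"
      using \<Gamma> by (intro closed_UN) (auto simp: cycle_in_def intro: closed_valid_path_image)
    moreover have "z \<notin> (\<Union>\<gamma>\<in>set \<Gamma>. path_image \<gamma>)"
      using \<Gamma> that by (auto simp: cycle_in_def)
    ultimately obtain r where r: "r > 0" "ball z r \<subseteq> - (\<Union>\<gamma>\<in>set \<Gamma>. path_image \<gamma>)"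
      by (meson ComplI open_Compl openE)
    \<comment> \<open>move \<open>z\<close> slightly into the interior of its cell without crossing the cycle\<close>
    have "box ?c ?c' \<noteq> {}" using d by (auto simp: box_ne_empty Basis_complex_def grid_point_def)
    then have "z \<in> closure (box ?c ?c')" using zc by (simp add: closure_box grid_cell_def)
    then obtain z' where z'0: "z' \<in> box ?c ?c'" "dist z' z < r"
      using r(1) unfolding closure_approachable by blast
    then have z': "z' \<in> box ?c ?c'" "z' \<in> ball z r" by (simp_all add: dist_commute)
    have z'1: "d * m < Re z'" "Re z' < d * (m + 1)" "d * n < Im z'" "Im z' < d * (n + 1)"
      using z'(1) by (auto simp: in_box_complex_iff grid_point_def)
    have other: "z' \<notin> grid_cell d s" if "s \<noteq> (m, n)" for s
    proof
      assume a: "z' \<in> grid_cell d s"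
      obtain m' n' where s: "s = (m', n')" by (cases s)
      have "d * m < d * (m' + 1)" "d * m' < d * (m + 1)" "d * n < d * (n' + 1)" "d * n' < d * (n + 1)"
        using a z'1 unfolding s mem_grid_cell by linarith+
      then have "m < m' + 1" "m' < m + 1" "n < n' + 1" "n' < n + 1"
        using d by (simp_all only: mult_less_cancel_left_pos of_int_less_iff)
      with that s show False by auto
    qed
    have off: "z' \<notin> path_image (rectpath ?c ?c')"
      using z'(1) d by (subst path_image_rectpath_cbox_minus_box) (auto simp: grid_point_def)
    have nedge: "z' \<notin> closed_segment a b" if ab: "(a, b) \<in> set bs" for a b
    proof -
      obtain s t where st: "s \<in> S" "t \<notin> S" "closed_segment a b \<subseteq> grid_cell d t"
        using boundary_edge_cells[OF d ab[unfolded bs_def]] unfolding xs(1) by metis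
      with mn other[of t] show ?thesis by blast
    qed
    let ?F = "\<lambda>w. 1 / (w - z')"
    have cont: "continuous_on (- {z'}) ?F" by (intro continuous_intros) auto
    have "cycle_integral \<Gamma> ?F = cycle_integral E ?F"
      using nedge
      by (intro \<Gamma>E contour_integrable_continuous_linepath continuous_on_subset[OF cont]) blast
    also have "\<dots> = (\<Sum>s\<in>S. \<Sum>(a, b)\<leftarrow>cell_edges d s. contour_integral (linepath a b) ?F)"
      by (rule sumE)
    also have "\<dots> = (\<Sum>(a, b)\<leftarrow>cell_edges d (m, n). contour_integral (linepath a b) ?F) +
        (\<Sum>s\<in>S - {(m, n)}. \<Sum>(a, b)\<leftarrow>cell_edges d s. contour_integral (linepath a b) ?F)"
      using mn \<open>finite S\<close> by (simp add: sum.remove)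
    also have "(\<Sum>s\<in>S - {(m, n)}. \<Sum>(a, b)\<leftarrow>cell_edges d s. contour_integral (linepath a b) ?F) = 0"
      using other by (intro sum.neutral ballI cell0) (auto intro!: holomorphic_intros)
    also have "(\<Sum>(a, b)\<leftarrow>cell_edges d (m, n). contour_integral (linepath a b) ?F) =
        contour_integral (rectpath ?c ?c') ?F"
      using off by (intro cell_edges_rectpath continuous_on_subset[OF cont]) blast
    also have "\<dots> = 2 * pi * \<i> * winding_number (rectpath ?c ?c') z'"
      using off by (simp add: winding_number_valid_path)
    also have "winding_number (rectpath ?c ?c') z' = 1"
      using z'(1) by (rule winding_number_rectpath)
    finally have "cycle_integral \<Gamma> ?F = 2 * pi * \<i>" by simp
    moreover have "z' \<notin> (\<Union>\<gamma>\<in>set \<Gamma>. path_image \<gamma>)" using z'(2) r(2) by blast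
    then have "cycle_in (- {z'}) \<Gamma>" using \<Gamma> by (auto simp: cycle_in_def)
    then have "2 * pi * \<i> * cycle_winding \<Gamma> z' = cycle_integral \<Gamma> ?F"
      by (rule cycle_winding_conv) simp
    ultimately have "cycle_winding \<Gamma> z' = 1" by simp
    moreover have "cycle_winding \<Gamma> z' = cycle_winding \<Gamma> z"
      using r(2) by (intro cycle_winding_locally_constant[OF \<Gamma> _ z'(2)]) blast
    ultimately show ?thesis by simp
  qed
  show ?thesis
    using \<Gamma> out inn hol0 unfolding surrounding_contour_iff by blast
qed

section \<open>Cauchy's theorem for cycles\<close>

text \<open>Continuity of the derivative on the whole interval is what Fubini's theorem for contour integrals
asks for; a valid path need not even have a bounded derivative.\<close>

definition C1_cycle :: "(real \<Rightarrow> complex) list \<Rightarrow> bool" where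
  "C1_cycle \<Gamma> \<longleftrightarrow> (\<forall>\<gamma>\<in>set \<Gamma>. continuous_on {0..1} (\<lambda>t. vector_derivative \<gamma> (at t)))"

text \<open>Each curve is replaced by a polynomial one so close to it that the integrals of functions
holomorphic on the open set \<open>S\<close> do not change.\<close>

lemma ex_C1_cycle:
  assumes "cycle_in S \<Gamma>" "open S"
  shows "\<exists>\<Delta>. cycle_in S \<Delta> \<and> C1_cycle \<Delta> \<and> (\<forall>f. f holomorphic_on S \<longrightarrow> cycle_integral \<Delta> f = cycle_integral \<Gamma> f)"
  using assms(1)
proof (induction \<Gamma>)
  case Nil
  then show ?case by (intro exI[of _ "[]"]) (simp add: C1_cycle_def)
next
  case (Cons \<gamma> \<Gamma>)
  then obtain \<Delta> where \<Delta>: "cycle_in S \<Delta>" "C1_cycle \<Delta>"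
    "\<And>f. f holomorphic_on S \<Longrightarrow> cycle_integral \<Delta> f = cycle_integral \<Gamma> f" by auto
  have g: "valid_path \<gamma>" "path_image \<gamma> \<subseteq> S" "pathfinish \<gamma> = pathstart \<gamma>" using Cons.prems by auto
  obtain d where d: "d > 0" and near: "\<forall>g h. valid_path g \<and> valid_path h \<and>
        (\<forall>t\<in>{0..1}. cmod (g t - \<gamma> t) < d \<and> cmod (h t - \<gamma> t) < d) \<and>
        pathstart h = pathstart g \<and> pathfinish h = pathfinish g \<longrightarrow>
        path_image g \<subseteq> S \<and> path_image h \<subseteq> S \<and>
        (\<forall>f. f holomorphic_on S \<longrightarrow> contour_integral h f = contour_integral g f)"
    using contour_integral_nearby_ends[OF assms(2) valid_path_imp_path[OF g(1)] g(2)] by blast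
  obtain p where p: "polynomial_function p" "pathstart p = pathstart \<gamma>" "pathfinish p = pathfinish \<gamma>"
    "\<And>t. t \<in> {0..1} \<Longrightarrow> cmod (p t - \<gamma> t) < d"
    using path_approx_polynomial_function[OF valid_path_imp_path[OF g(1)] d] by blast
  have vp: "valid_path p" using p(1) by (rule valid_path_polynomial_function)
  have "path_image p \<subseteq> S \<and> (\<forall>f. f holomorphic_on S \<longrightarrow> contour_integral p f = contour_integral \<gamma> f)"
    using near[rule_format, of \<gamma> p] g(1) vp p d by simp
  moreover obtain p' where p': "polynomial_function p'" "\<And>x. (p has_vector_derivative p' x) (at x)"
    using has_vector_derivative_polynomial_function[OF p(1)] by blast
  have "(\<lambda>t. vector_derivative p (at t)) = p'"
    using p'(2) by (auto simp: vector_derivative_at)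
  then have "continuous_on {0..1} (\<lambda>t. vector_derivative p (at t))"
    using p'(1) by (simp add: continuous_on_polymonial_function)
  ultimately show ?case
    using \<Delta> vp p(2,3) g(3) by (intro exI[of _ "p # \<Delta>"]) (auto simp: C1_cycle_def)
qed

lemma contour_integrable_C1:
  assumes "valid_path g" "continuous_on {0..1} (\<lambda>t. vector_derivative g (at t))"
    and "continuous_on (path_image g) f"
  shows "f contour_integrable_on g"
proof -
  have "continuous_on {0..1} g"
    using assms(1) by (simp add: valid_path_def piecewise_C1_differentiable_on_def)
  then have "continuous_on {0..1} (\<lambda>t. f (g t) * vector_derivative g (at t))"
    using assms(2) by (intro continuous_on_mult continuous_on_compose2[OF assms(3)])
      (simp_all add: path_image_def)
  then show ?thesis
    unfolding contour_integrable_on by (rule integrable_continuous_real)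
qed

lemma continuous_on_contour_integral_param:
  assumes "valid_path g" "continuous_on {0..1} (\<lambda>t. vector_derivative g (at t))"
    and F: "continuous_on (A \<times> path_image g) (\<lambda>(w, z). F w z)"
  shows "continuous_on A (\<lambda>w. contour_integral g (F w))"
proof -
  have g: "continuous_on {0..1} g"
    using assms(1) by (simp add: valid_path_def piecewise_C1_differentiable_on_def)
  have "continuous_on (A \<times> cbox 0 1) (\<lambda>x. (fst x, g (snd x)))"
    by (intro continuous_on_Pair continuous_on_fst continuous_on_id
        continuous_on_compose2[OF g continuous_on_snd[OF continuous_on_id]]) auto
  then have "continuous_on (A \<times> cbox 0 1) (\<lambda>x. (\<lambda>(w, z). F w z) (fst x, g (snd x)))"
    by (rule continuous_on_compose2[OF F]) (auto simp: path_image_def)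
  moreover have "continuous_on (A \<times> cbox 0 1) (\<lambda>x. vector_derivative g (at (snd x)))"
    by (intro continuous_on_compose2[OF assms(2) continuous_on_snd[OF continuous_on_id]]) auto
  ultimately have "continuous_on (A \<times> cbox 0 1) (\<lambda>(w, t). F w (g t) * vector_derivative g (at t))"
    unfolding case_prod_unfold by (simp add: continuous_on_mult)
  then have "continuous_on A (\<lambda>w. integral (cbox 0 1) (\<lambda>t. F w (g t) * vector_derivative g (at t)))"
    by (rule integral_continuous_on_param)
  then show ?thesis by (simp add: contour_integral_integral)
qed

lemma cycle_integral_swap:
  assumes "C1_cycle \<Gamma>" "C1_cycle \<Delta>" "cycle_in S \<Gamma>" "cycle_in S' \<Delta>"
    and F: "continuous_on (S \<times> S') (\<lambda>(w, z). F w z)"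
  shows "cycle_integral \<Gamma> (\<lambda>w. cycle_integral \<Delta> (F w)) = cycle_integral \<Delta> (\<lambda>z. cycle_integral \<Gamma> (\<lambda>w. F w z))"
  using assms(1,3)
proof (induction \<Gamma>)
  case Nil
  then show ?case by (simp add: cycle_integral_def)
next
  case (Cons \<gamma> \<Gamma>)
  have g: "valid_path \<gamma>" "continuous_on {0..1} (\<lambda>t. vector_derivative \<gamma> (at t))" "path_image \<gamma> \<subseteq> S"
    and \<Gamma>: "C1_cycle \<Gamma>" "cycle_in S \<Gamma>"
    using Cons.prems by (auto simp: C1_cycle_def)
  have F': "continuous_on (A \<times> B) (\<lambda>(w, z). F w z)" "continuous_on (B \<times> A) (\<lambda>(z, w). F w z)"
    if "A \<subseteq> S" "B \<subseteq> S'" for A B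
  proof -
    show "continuous_on (A \<times> B) (\<lambda>(w, z). F w z)"
      using that by (intro continuous_on_subset[OF F]) auto
    then have "continuous_on (B \<times> A) (\<lambda>x. (\<lambda>(w, z). F w z) (snd x, fst x))"
      by (rule continuous_on_compose2)
        (auto intro!: continuous_on_Pair continuous_on_fst continuous_on_snd continuous_on_id)
    then show "continuous_on (B \<times> A) (\<lambda>(z, w). F w z)" by (simp add: case_prod_unfold)
  qed
  have cG: "continuous_on S' (\<lambda>z. cycle_integral \<Gamma> (\<lambda>w. F w z))"
    using \<Gamma>
  proof (induction \<Gamma>)
    case (Cons \<delta> \<Delta>)
    then show ?case unfolding cycle_integral_simps
      by (intro continuous_on_add continuous_on_contour_integral_param[of _ _ "\<lambda>z w. F w z"] F')
        (auto simp: C1_cycle_def)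
  qed simp
  have cg: "continuous_on S' (\<lambda>z. contour_integral \<gamma> (\<lambda>w. F w z))"
    using g by (intro continuous_on_contour_integral_param[of _ _ "\<lambda>z w. F w z"] F') auto
  have "contour_integral \<gamma> (\<lambda>w. cycle_integral \<Delta> (F w)) + cycle_integral \<Delta> (\<lambda>z. cycle_integral \<Gamma> (\<lambda>w. F w z)) =
      cycle_integral \<Delta> (\<lambda>z. contour_integral \<gamma> (\<lambda>w. F w z) + cycle_integral \<Gamma> (\<lambda>w. F w z)) \<and>
      (\<lambda>w. cycle_integral \<Delta> (F w)) contour_integrable_on \<gamma>"
    using assms(2,4)
  proof (induction \<Delta>)
    case Nil
    then show ?case
      using contour_integrable_C1[OF g(1,2) continuous_on_const, of 0] by (simp add: cycle_integral_def)
  next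
    case (Cons \<delta> \<Delta>)
    have d: "valid_path \<delta>" "continuous_on {0..1} (\<lambda>t. vector_derivative \<delta> (at t))" "path_image \<delta> \<subseteq> S'"
      using Cons.prems by (auto simp: C1_cycle_def)
    have IH: "contour_integral \<gamma> (\<lambda>w. cycle_integral \<Delta> (F w)) + cycle_integral \<Delta> (\<lambda>z. cycle_integral \<Gamma> (\<lambda>w. F w z)) =
      cycle_integral \<Delta> (\<lambda>z. contour_integral \<gamma> (\<lambda>w. F w z) + cycle_integral \<Gamma> (\<lambda>w. F w z))"
      "(\<lambda>w. cycle_integral \<Delta> (F w)) contour_integrable_on \<gamma>"
      using Cons by (auto simp: C1_cycle_def)
    have "(\<lambda>w. contour_integral \<delta> (F w)) contour_integrable_on \<gamma>"
      using g d by (intro contour_integrable_C1 continuous_on_contour_integral_param F') auto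
    moreover have "(\<lambda>z. contour_integral \<gamma> (\<lambda>w. F w z)) contour_integrable_on \<delta>"
      "(\<lambda>z. cycle_integral \<Gamma> (\<lambda>w. F w z)) contour_integrable_on \<delta>"
      using d cG cg by (auto intro!: contour_integrable_C1 intro: continuous_on_subset)
    moreover have "contour_integral \<gamma> (\<lambda>w. contour_integral \<delta> (F w)) =
        contour_integral \<delta> (\<lambda>z. contour_integral \<gamma> (\<lambda>w. F w z))"
      using g d by (intro contour_integral_swap F') auto
    ultimately show ?case
      using IH by (simp add: contour_integral_add contour_integrable_add algebra_simps)
  qed
  with Cons.IH[OF \<Gamma>] show ?case by simp
qed

lemma cycle_image_compact: "cycle_in S \<Gamma> \<Longrightarrow> compact (\<Union>\<gamma>\<in>set \<Gamma>. path_image \<gamma>)"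
  by (intro compact_UN) (auto simp: cycle_in_def compact_valid_path_image)

lemma cycle_in_images: "cycle_in S \<Gamma> \<Longrightarrow> cycle_in (\<Union>\<gamma>\<in>set \<Gamma>. path_image \<gamma>) \<Gamma>"
  by (auto simp: cycle_in_def)

lemma cycle_winding_zero_at_infinity:
  assumes "cycle_in S \<Gamma>"
  shows "\<exists>B. \<forall>z. B \<le> norm z \<longrightarrow> cycle_winding \<Gamma> z = 0"
  using assms
proof (induction \<Gamma>)
  case (Cons \<gamma> \<Gamma>)
  then obtain B where B: "\<And>z. B \<le> norm z \<Longrightarrow> cycle_winding \<Gamma> z = 0" by auto
  obtain B' where B': "\<And>z. B' \<le> norm z \<Longrightarrow> winding_number \<gamma> z = 0"
    using winding_number_zero_at_infinity[of \<gamma>] Cons.prems by (auto simp: valid_path_imp_path)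
  show ?case
    using B B' by (intro exI[of _ "max B B'"]) (auto simp: cycle_winding_def)
qed (simp add: cycle_winding_def)

text \<open>The cycle together with the points that it winds around. A second cycle that surrounds this set lies
where the winding number of the first one is zero.\<close>

definition cycle_hull :: "(real \<Rightarrow> complex) list \<Rightarrow> complex set" where
  "cycle_hull \<Gamma> = (\<Union>\<gamma>\<in>set \<Gamma>. path_image \<gamma>) \<union> {z. cycle_winding \<Gamma> z \<noteq> 0}"

lemma open_cycle_winding_level:
  assumes "cycle_in S \<Gamma>"
  shows "open {z. z \<notin> (\<Union>\<gamma>\<in>set \<Gamma>. path_image \<gamma>) \<and> cycle_winding \<Gamma> z = c}"
proof (rule openI)
  let ?I = "\<Union>\<gamma>\<in>set \<Gamma>. path_image \<gamma>"
  fix z assume z: "z \<in> {z. z \<notin> ?I \<and> cycle_winding \<Gamma> z = c}"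
  have "open (- ?I)" using cycle_image_compact[OF assms] by (simp only: open_Compl compact_imp_closed)
  then obtain r where r: "r > 0" "ball z r \<subseteq> - ?I" using z unfolding open_contains_ball by blast
  then have "ball z r \<subseteq> {z. z \<notin> ?I \<and> cycle_winding \<Gamma> z = c}"
    using cycle_winding_locally_constant[OF assms, of z r] z by blast
  then show "\<exists>e>0. ball z e \<subseteq> {z. z \<notin> ?I \<and> cycle_winding \<Gamma> z = c}" using r by blast
qed

lemma compact_cycle_hull:
  assumes "cycle_in S \<Gamma>"
  shows "compact (cycle_hull \<Gamma>)"
proof -
  have "- cycle_hull \<Gamma> = {z. z \<notin> (\<Union>\<gamma>\<in>set \<Gamma>. path_image \<gamma>) \<and> cycle_winding \<Gamma> z = 0}"
    by (auto simp: cycle_hull_def)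
  then have "closed (cycle_hull \<Gamma>)"
    using open_cycle_winding_level[OF assms, of 0] by (simp only: closed_def)
  moreover obtain B where B: "\<And>z. B \<le> norm z \<Longrightarrow> cycle_winding \<Gamma> z = 0"
    using cycle_winding_zero_at_infinity[OF assms] by blast
  have "{z. cycle_winding \<Gamma> z \<noteq> 0} \<subseteq> cball 0 B"
    using B by (force simp: not_le)
  then have "bounded (cycle_hull \<Gamma>)"
    unfolding cycle_hull_def
    using cycle_image_compact[OF assms] bounded_subset[OF bounded_cball] compact_imp_bounded by auto
  ultimately show ?thesis by (simp add: compact_eq_bounded_closed)
qed

text \<open>Surround the hull of \<open>\<Gamma>\<close> in \<open>\<Omega>\<close> by a grid cycle \<open>\<Delta>\<close>. For the latter, Cauchy's integral formula holds by
construction, since the difference quotient of \<open>f\<close> has integral zero. Insert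
\<open>2\<pi>i f(w) = \<integral>\<^sub>\<Delta> f(z)/(z - w) dz\<close> into the integral of \<open>f\<close> along \<open>\<Gamma>\<close> and exchange the integrals: the inner
one becomes \<open>- 2\<pi>i f(z)\<close> times the winding number of \<open>\<Gamma>\<close> around the point \<open>z\<close> of \<open>\<Delta>\<close>, which is zero because \<open>z\<close> is not in
the hull.\<close>

theorem Cauchy_theorem_cycle:
  assumes \<Gamma>: "cycle_in \<Omega> \<Gamma>" and \<Omega>: "open \<Omega>" and f: "f holomorphic_on \<Omega>"
    and out: "\<And>z. z \<notin> \<Omega> \<Longrightarrow> cycle_winding \<Gamma> z = 0"
  shows "cycle_integral \<Gamma> f = 0"
proof -
  obtain \<Gamma>' where \<Gamma>': "cycle_in \<Omega> \<Gamma>'" "C1_cycle \<Gamma>'"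
    "\<And>f. f holomorphic_on \<Omega> \<Longrightarrow> cycle_integral \<Gamma>' f = cycle_integral \<Gamma> f"
    using ex_C1_cycle[OF \<Gamma> \<Omega>] by blast
  have out': "cycle_winding \<Gamma>' z = 0" if "z \<notin> \<Omega>" for z
  proof -
    have "cycle_integral \<Gamma>' (\<lambda>w. 1 / (w - z)) = cycle_integral \<Gamma> (\<lambda>w. 1 / (w - z))"
      using that by (intro \<Gamma>'(3)) (auto intro!: holomorphic_intros)
    then have "2 * pi * \<i> * cycle_winding \<Gamma>' z = 2 * pi * \<i> * cycle_winding \<Gamma> z"
      using cycle_winding_conv[OF \<Gamma> that] cycle_winding_conv[OF \<Gamma>'(1) that] by simp
    then show ?thesis using out[OF that] by simp
  qed
  let ?H = "cycle_hull \<Gamma>'" and ?I = "\<Union>\<gamma>\<in>set \<Gamma>'. path_image \<gamma>"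
  have H: "compact ?H" "?H \<subseteq> \<Omega>" "?I \<subseteq> ?H"
    using compact_cycle_hull[OF \<Gamma>'(1)] \<Gamma>'(1) out' by (auto simp: cycle_hull_def cycle_in_def)
  obtain \<Delta> where \<Delta>: "surrounding_contour ?H \<Omega> \<Delta>" "\<And>f. f holomorphic_on \<Omega> \<Longrightarrow> cycle_integral \<Delta> f = 0"
    using ex_surrounding_grid_cycle[OF H(1) \<Omega> H(2)] by blast
  have \<Delta>c: "cycle_in (\<Omega> - ?H) \<Delta>" using \<Delta>(1) by (simp add: surrounding_contour_iff)
  have opn: "open (\<Omega> - ?H)" using \<Omega> H(1) by (intro open_Diff compact_imp_closed)
  obtain \<Delta>' where \<Delta>': "cycle_in (\<Omega> - ?H) \<Delta>'" "C1_cycle \<Delta>'"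
    "\<And>f. f holomorphic_on \<Omega> - ?H \<Longrightarrow> cycle_integral \<Delta>' f = cycle_integral \<Delta> f"
    using ex_C1_cycle[OF \<Delta>c opn] by blast
  have repr: "cycle_integral \<Delta>' (\<lambda>z. f z / (z - w)) = 2 * pi * \<i> * f w" if w: "w \<in> ?H" for w
  proof -
    define g where "g = (\<lambda>z. if z = w then deriv f w else (f z - f w) / (z - w))"
    have g: "g holomorphic_on \<Omega>" unfolding g_def using f \<Omega> by (rule pole_lemma_open)
    have "cycle_integral \<Delta>' (\<lambda>z. f z / (z - w)) = cycle_integral \<Delta> (\<lambda>z. f z / (z - w))"
      using w by (intro \<Delta>'(3)) (auto intro!: holomorphic_intros holomorphic_on_subset[OF f])
    also have "\<dots> = cycle_integral \<Delta> (\<lambda>z. g z + f w * (1 / (z - w)))"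
      using w by (intro cycle_integral_cong[OF \<Delta>c]) (auto simp: g_def diff_divide_distrib)
    also have "\<dots> = cycle_integral \<Delta> g + f w * cycle_integral \<Delta> (\<lambda>z. 1 / (z - w))"
    proof -
      have "(\<lambda>z. 1 / (z - w)) holomorphic_on \<Omega> - ?H" using w by (intro holomorphic_intros) auto
      then show ?thesis
        using cycle_integral_add[OF \<Delta>c opn holomorphic_on_subset[OF g Diff_subset] holomorphic_on_mult[OF holomorphic_on_const]]
          cycle_integral_lmul[OF \<Delta>c opn] by metis
    qed
    also have "cycle_integral \<Delta> (\<lambda>z. 1 / (z - w)) = 2 * pi * \<i> * cycle_winding \<Delta> w"
      using cycle_winding_conv[OF \<Delta>c, of w] w by simp
    also have "cycle_winding \<Delta> w = 1" using \<Delta>(1) w by (simp add: surrounding_contour_iff)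
    finally show ?thesis using \<Delta>(2)[OF g] by simp
  qed
  have "2 * pi * \<i> * cycle_integral \<Gamma>' f = cycle_integral \<Gamma>' (\<lambda>w. 2 * pi * \<i> * f w)"
    by (rule cycle_integral_lmul[OF \<Gamma>'(1) \<Omega> f, symmetric])
  also have "\<dots> = cycle_integral \<Gamma>' (\<lambda>w. cycle_integral \<Delta>' (\<lambda>z. f z / (z - w)))"
    using repr H(3) by (intro cycle_integral_cong[OF cycle_in_images[OF \<Gamma>'(1)]]) auto
  also have "\<dots> = cycle_integral \<Delta>' (\<lambda>z. cycle_integral \<Gamma>' (\<lambda>w. f z / (z - w)))"
  proof (rule cycle_integral_swap[OF \<Gamma>'(2) \<Delta>'(2) cycle_in_images[OF \<Gamma>'(1)] \<Delta>'(1)])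
    have "continuous_on (?I \<times> (\<Omega> - ?H)) (\<lambda>x. f (snd x))"
      by (intro continuous_on_compose2[OF holomorphic_on_imp_continuous_on[OF f]])
        (auto intro!: continuous_intros)
    then show "continuous_on (?I \<times> (\<Omega> - ?H)) (\<lambda>(w, z). f z / (z - w))"
      using H(3) unfolding case_prod_unfold by (intro continuous_intros) auto
  qed
  also have "\<dots> = cycle_integral \<Delta>' (\<lambda>z. 0)"
  proof (rule cycle_integral_cong[OF \<Delta>'(1)])
    fix z assume z: "z \<in> \<Omega> - ?H"
    have c: "cycle_in (- {z}) \<Gamma>'" using \<Gamma>'(1) z by (auto simp: cycle_hull_def cycle_in_def)
    have "cycle_integral \<Gamma>' (\<lambda>w. f z / (z - w)) = cycle_integral \<Gamma>' (\<lambda>w. - f z * (1 / (w - z)))"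
      by (intro cycle_integral_cong[OF c]) (auto simp: field_simps)
    also have "\<dots> = - f z * cycle_integral \<Gamma>' (\<lambda>w. 1 / (w - z))"
      by (rule cycle_integral_lmul[OF c]) (auto intro!: holomorphic_intros)
    also have "cycle_integral \<Gamma>' (\<lambda>w. 1 / (w - z)) = 0"
      using cycle_winding_conv[OF c, of z] z by (simp add: cycle_hull_def)
    finally show "cycle_integral \<Gamma>' (\<lambda>w. f z / (z - w)) = 0" by simp
  qed
  also have "\<dots> = 0" using cycle_integral_lmul[OF \<Delta>'(1) opn holomorphic_on_const, of 0 0] by simp
  finally show ?thesis using \<Gamma>'(3)[OF f] by simp
qed

lemma cycle_reverse:
  assumes "cycle_in S \<Gamma>"
  shows "cycle_in S (map reversepath \<Gamma>)"
    and "open S \<Longrightarrow> f holomorphic_on S \<Longrightarrow> cycle_integral (map reversepath \<Gamma>) f = - cycle_integral \<Gamma> f"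
    and "z \<notin> S \<Longrightarrow> cycle_winding (map reversepath \<Gamma>) z = - cycle_winding \<Gamma> z"
  using assms
proof (induction \<Gamma>)
  case (Cons \<gamma> \<Gamma>)
  { case 1 then show ?case using Cons by auto }
  { case 2 then show ?case using Cons
      by (auto simp: contour_integral_reversepath intro: contour_integrable_holomorphic_simple) }
  { case 3
    then have "winding_number (reversepath \<gamma>) z = - winding_number \<gamma> z"
      by (intro winding_number_reversepath) (auto intro: valid_path_imp_path)
    then show ?case using Cons 3 by (simp add: cycle_winding_def) }
qed (simp_all add: cycle_winding_def)

text \<open>The difference of the two cycles winds around no point of \<open>K\<close> and no point outside \<open>\<Omega>\<close>, so that
Cauchy's theorem applies to it in \<open>\<Omega> - K\<close>.\<close>

lemma surrounding_contour_integral_eq: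
  assumes "surrounding_contour K \<Omega> \<Gamma>" "surrounding_contour K \<Omega> \<Delta>" "open \<Omega>" "closed K"
    and F: "F holomorphic_on \<Omega> - K"
  shows "cycle_integral \<Gamma> F = cycle_integral \<Delta> F"
proof -
  have c: "cycle_in (\<Omega> - K) \<Gamma>" "cycle_in (\<Omega> - K) \<Delta>" and o: "open (\<Omega> - K)"
    using assms by (auto simp: surrounding_contour_iff)
  have "cycle_integral (\<Gamma> @ map reversepath \<Delta>) F = 0"
  proof (rule Cauchy_theorem_cycle[OF _ o F])
    fix z assume z: "z \<notin> \<Omega> - K"
    have "cycle_winding \<Gamma> z = cycle_winding \<Delta> z"
      using assms(1,2) z by (cases "z \<in> K") (auto simp: surrounding_contour_iff)
    then show "cycle_winding (\<Gamma> @ map reversepath \<Delta>) z = 0"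
      using cycle_reverse(3)[OF c(2) z] by (simp add: cycle_winding_def)
  qed (use c cycle_reverse(1) in auto)
  then show ?thesis using cycle_reverse(2)[OF c(2) o F] by simp
qed

lemma Cauchy_formula_cycle:
  assumes \<Gamma>: "cycle_in (\<Omega> - {z}) \<Gamma>" and \<Omega>: "open \<Omega>" "z \<in> \<Omega>" and f: "f holomorphic_on \<Omega>"
    and out: "\<And>z. z \<notin> \<Omega> \<Longrightarrow> cycle_winding \<Gamma> z = 0"
  shows "cycle_integral \<Gamma> (\<lambda>w. f w / (w - z)) = 2 * pi * \<i> * cycle_winding \<Gamma> z * f z"
proof -
  define g where "g = (\<lambda>w. if w = z then deriv f z else (f w - f z) / (w - z))"
  have g: "g holomorphic_on \<Omega>" unfolding g_def using f \<Omega>(1) by (rule pole_lemma_open)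
  have o: "open (\<Omega> - {z})" using \<Omega>(1) by auto
  have "cycle_integral \<Gamma> (\<lambda>w. f w / (w - z)) = cycle_integral \<Gamma> (\<lambda>w. g w + f z * (1 / (w - z)))"
    by (intro cycle_integral_cong[OF \<Gamma>]) (auto simp: g_def diff_divide_distrib)
  also have "\<dots> = cycle_integral \<Gamma> g + cycle_integral \<Gamma> (\<lambda>w. f z * (1 / (w - z)))"
    by (intro cycle_integral_add[OF \<Gamma> o] holomorphic_intros holomorphic_on_subset[OF g]) auto
  also have "cycle_integral \<Gamma> (\<lambda>w. f z * (1 / (w - z))) = f z * cycle_integral \<Gamma> (\<lambda>w. 1 / (w - z))"
    by (intro cycle_integral_lmul[OF \<Gamma> o] holomorphic_intros) auto
  also have "cycle_integral \<Gamma> g = 0"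
    by (rule Cauchy_theorem_cycle[OF cycle_in_mono[OF \<Gamma>] \<Omega>(1) g out]) auto
  finally show ?thesis using cycle_winding_conv[OF \<Gamma>, of z] by simp
qed

lemma ex_C1_surrounding_contour:
  assumes "compact K" "open \<Omega>" "K \<subseteq> \<Omega>"
  shows "\<exists>\<Gamma>. surrounding_contour K \<Omega> \<Gamma> \<and> C1_cycle \<Gamma>"
proof -
  obtain \<Gamma> where \<Gamma>: "surrounding_contour K \<Omega> \<Gamma>"
    using ex_surrounding_grid_cycle[OF assms] by blast
  then have c: "cycle_in (\<Omega> - K) \<Gamma>" by (simp add: surrounding_contour_iff)
  have o: "open (\<Omega> - K)" using assms by (intro open_Diff compact_imp_closed)
  obtain \<Gamma>' where \<Gamma>': "cycle_in (\<Omega> - K) \<Gamma>'" "C1_cycle \<Gamma>'"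
    "\<And>f. f holomorphic_on \<Omega> - K \<Longrightarrow> cycle_integral \<Gamma>' f = cycle_integral \<Gamma> f"
    using ex_C1_cycle[OF c o] by blast
  have "cycle_winding \<Gamma>' z = cycle_winding \<Gamma> z" if "z \<notin> \<Omega> - K" for z
  proof -
    have "cycle_integral \<Gamma>' (\<lambda>w. 1 / (w - z)) = cycle_integral \<Gamma> (\<lambda>w. 1 / (w - z))"
      using that by (intro \<Gamma>'(3)) (auto intro!: holomorphic_intros)
    then have "2 * pi * \<i> * cycle_winding \<Gamma>' z = 2 * pi * \<i> * cycle_winding \<Gamma> z"
      using cycle_winding_conv[OF c that] cycle_winding_conv[OF \<Gamma>'(1) that] by simp
    then show ?thesis by simp
  qed
  then have "surrounding_contour K \<Omega> \<Gamma>'"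
    using \<Gamma> \<Gamma>'(1) by (auto simp: surrounding_contour_iff)
  with \<Gamma>'(2) show ?thesis by blast
qed

section \<open>Bounded functionals separate points\<close>

text \<open>Partial linear functionals that are dominated by the norm are represented by their graphs: a linear
subspace of \<open>'a \<times> real\<close> in which \<open>r \<le> norm x\<close> holds for all pairs \<open>(x, r)\<close> is automatically a graph. With
inclusion as the order, Zorn's lemma applies directly.\<close>

lemma dominated_graph_maximal:
  fixes x0 :: "'a::real_normed_vector"
  shows "\<exists>M :: ('a \<times> real) set. subspace M \<and> (x0, norm x0) \<in> M \<and> (\<forall>(x, r)\<in>M. r \<le> norm x) \<and>
     (\<forall>M'. subspace M' \<and> (\<forall>(x, r)\<in>M'. r \<le> norm x) \<and> M \<subseteq> M' \<longrightarrow> M' = M)"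
proof -
  define \<A> where "\<A> = {M :: ('a \<times> real) set. subspace M \<and> (x0, norm x0) \<in> M \<and> (\<forall>(x, r)\<in>M. r \<le> norm x)}"
  have ne: "span {(x0, norm x0)} \<in> \<A>"
  proof -
    have "r \<le> norm x" if "(x, r) \<in> span {(x0, norm x0)}" for x r
    proof -
      obtain k where "x = k *\<^sub>R x0" "r = k * norm x0"
        using \<open>(x, r) \<in> _\<close> by (auto simp: span_singleton)
      then show ?thesis by (simp add: abs_mult mult_right_mono)
    qed
    then show ?thesis by (auto simp: \<A>_def span_base)
  qed
  have "\<exists>M\<in>\<A>. \<forall>X\<in>\<A>. M \<subseteq> X \<longrightarrow> X = M"
  proof (rule subset_Zorn_nonempty)
    show "\<A> \<noteq> {}" using ne by auto
  next
    fix \<C> assume ch: "\<C> \<noteq> {}" "subset.chain \<A> \<C>"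
    have sub: "\<C> \<subseteq> \<A>" and lin: "\<And>A B. A \<in> \<C> \<Longrightarrow> B \<in> \<C> \<Longrightarrow> A \<subseteq> B \<or> B \<subseteq> A"
      using ch(2) by (auto simp: subset_chain_def)
    have "subspace (\<Union>\<C>)"
    proof (rule subspaceI)
      show "0 \<in> \<Union>\<C>" using ch(1) sub by (auto simp: \<A>_def dest: subspace_0)
    next
      fix x y assume "x \<in> \<Union>\<C>" "y \<in> \<Union>\<C>"
      then obtain A B where "A \<in> \<C>" "B \<in> \<C>" "x \<in> A" "y \<in> B" by auto
      then obtain D where "D \<in> \<C>" "x \<in> D" "y \<in> D" using lin by blast
      then show "x + y \<in> \<Union>\<C>" using sub by (auto simp: \<A>_def intro!: subspace_add)
    next
      fix c x assume "x \<in> \<Union>\<C>"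
      then show "c *\<^sub>R x \<in> \<Union>\<C>" using sub by (auto simp: \<A>_def intro: subspace_scale)
    qed
    then show "\<Union>\<C> \<in> \<A>" using ch(1) sub by (fastforce simp: \<A>_def)
  qed
  then obtain M where "M \<in> \<A>" "\<And>X. X \<in> \<A> \<Longrightarrow> M \<subseteq> X \<Longrightarrow> X = M" by blast
  then show ?thesis unfolding \<A>_def by blast
qed

text \<open>The value \<open>c\<close> at the new vector must satisfy \<open>r - norm (x - x1) \<le> c \<le> norm (y + x1) - s\<close> for all pairs
\<open>(x, r)\<close> and \<open>(y, s)\<close> of the graph. The triangle inequality makes these conditions compatible, and the
supremum of the lower bounds is a possible choice.\<close>

lemma dominated_graph_extend:
  fixes M :: "('a::real_normed_vector \<times> real) set"
  assumes M: "subspace M" "\<And>x r. (x, r) \<in> M \<Longrightarrow> r \<le> norm x"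
  obtains c M' where "subspace M'" "M \<subseteq> M'" "(x1, c) \<in> M'" "\<And>x r. (x, r) \<in> M' \<Longrightarrow> r \<le> norm x"
proof -
  define c where "c = (SUP p\<in>M. snd p - norm (fst p - x1))"
  have key: "r - norm (x - x1) \<le> norm (y + x1) - s" if "(x, r) \<in> M" "(y, s) \<in> M" for x r y s
  proof -
    have "r + s \<le> norm (x + y)" using M(2)[of "x + y" "r + s"] subspace_add[OF M(1) that] by simp
    also have "\<dots> \<le> norm (x - x1) + norm (y + x1)"
      using norm_triangle_ineq[of "x - x1" "y + x1"] by simp
    finally show ?thesis by simp
  qed
  have z: "(0, 0) \<in> M" using subspace_0[OF M(1)] by (simp add: zero_prod_def)
  have bdd: "bdd_above ((\<lambda>p. snd p - norm (fst p - x1)) ` M)"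
    using key[OF _ z] by (intro bdd_aboveI[of _ "norm x1"]) auto
  have lower: "r - norm (x - x1) \<le> c" if "(x, r) \<in> M" for x r
    using cSUP_upper[OF that bdd] by (simp add: c_def)
  have upper: "c \<le> norm (y + x1) - s" if "(y, s) \<in> M" for y s
    unfolding c_def using z key that by (intro cSUP_least) auto
  define M' where "M' = span (insert (x1, c) M)"
  have dom: "r \<le> norm x" if xr: "(x, r) \<in> M'" for x r
  proof -
    obtain k where "(x, r) - k *\<^sub>R (x1, c) \<in> M"
      using xr unfolding M'_def span_breakdown_eq using span_eq_iff[THEN iffD2, OF M(1)] by auto
    then have k: "(x - k *\<^sub>R x1, r - k * c) \<in> M" by simp
    consider "k = 0" | "k > 0" | "k < 0" by linarith
    then show ?thesis
    proof cases
      case 1 then show ?thesis using k M(2) by simp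
    next
      case 2
      have "((x - k *\<^sub>R x1) /\<^sub>R k, (r - k * c) / k) \<in> M"
        using subspace_scale[OF M(1) k, of "inverse k"] by (simp add: divide_inverse mult.commute)
      then have "c \<le> norm ((x - k *\<^sub>R x1) /\<^sub>R k + x1) - (r - k * c) / k" by (rule upper)
      also have "(x - k *\<^sub>R x1) /\<^sub>R k + x1 = x /\<^sub>R k" using 2 by (simp add: algebra_simps)
      finally show ?thesis using 2 by (simp add: field_simps)
    next
      case 3
      have "((x - k *\<^sub>R x1) /\<^sub>R (- k), (r - k * c) / (- k)) \<in> M"
        using subspace_scale[OF M(1) k, of "inverse (- k)"] by (simp add: divide_inverse mult.commute)
      then have "(r - k * c) / (- k) - norm ((x - k *\<^sub>R x1) /\<^sub>R (- k) - x1) \<le> c" by (rule lower)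
      also have "(x - k *\<^sub>R x1) /\<^sub>R (- k) - x1 = x /\<^sub>R (- k)" using 3 by (simp add: algebra_simps)
      finally show ?thesis using 3 by (simp add: field_simps)
    qed
  qed
  show ?thesis
  proof (rule that[of M' c])
    show "subspace M'" "M \<subseteq> M'" "(x1, c) \<in> M'" by (auto simp: M'_def span_base)
  qed (rule dom)
qed

theorem Hahn_Banach_norming:
  fixes x0 :: "'a::real_normed_vector"
  shows "\<exists>\<phi> :: 'a \<Rightarrow> real. bounded_linear \<phi> \<and> \<phi> x0 = norm x0"
proof -
  obtain M :: "('a \<times> real) set" where M: "subspace M" "(x0, norm x0) \<in> M"
    "\<And>x r. (x, r) \<in> M \<Longrightarrow> r \<le> norm x"
    and mx: "\<And>M'. subspace M' \<Longrightarrow> (\<forall>(x, r)\<in>M'. r \<le> norm x) \<Longrightarrow> M \<subseteq> M' \<Longrightarrow> M' = M"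
  proof -
    from dominated_graph_maximal[of x0] obtain M where
      "subspace M \<and> (x0, norm x0) \<in> M \<and> (\<forall>(x, r)\<in>M. r \<le> norm x) \<and>
       (\<forall>M'. subspace M' \<and> (\<forall>(x, r)\<in>M'. r \<le> norm x) \<and> M \<subseteq> M' \<longrightarrow> M' = M)" ..
    then show thesis by (intro that[of M]) auto
  qed
  have tot: "\<exists>c. (x, c) \<in> M" for x
  proof -
    obtain c M' where "subspace M'" "M \<subseteq> M'" "(x, c) \<in> M'" "\<And>x r. (x, r) \<in> M' \<Longrightarrow> r \<le> norm x"
      using dominated_graph_extend[OF M(1) M(3), of x] by metis
    with mx[of M'] show ?thesis by fastforce
  qed
  have abs: "\<bar>r\<bar> \<le> norm x" if "(x, r) \<in> M" for x r
    using M(3)[OF that] M(3)[of "- x" "- r"] subspace_neg[OF M(1) that] by simp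
  have uniq: "r = s" if "(x, r) \<in> M" "(x, s) \<in> M" for x r s
    using abs[of 0 "r - s"] subspace_diff[OF M(1) that] by simp
  define \<phi> where "\<phi> x = (THE c. (x, c) \<in> M)" for x
  have phi: "\<phi> x = c \<longleftrightarrow> (x, c) \<in> M" for x c
  proof -
    have "\<exists>!c. (x, c) \<in> M" using tot uniq by blast
    then show ?thesis unfolding \<phi>_def by (metis theI)
  qed
  then have mem: "(x, \<phi> x) \<in> M" for x by blast
  have "bounded_linear \<phi>"
  proof (rule bounded_linear_intro[where K = 1])
    show "\<phi> (x + y) = \<phi> x + \<phi> y" for x y
      unfolding phi using subspace_add[OF M(1) mem mem, of x y] by simp
    show "\<phi> (c *\<^sub>R x) = c *\<^sub>R \<phi> x" for c x
      unfolding phi using subspace_scale[OF M(1) mem, of c x] by simp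
    show "norm (\<phi> x) \<le> norm x * 1" for x using abs[OF mem] by simp
  qed
  with M(2) show ?thesis using phi by blast
qed

definition complex_functional :: "('a::complex_banach \<Rightarrow> complex) \<Rightarrow> bool" where
  "complex_functional \<phi> \<longleftrightarrow> bounded_linear \<phi> \<and> (\<forall>c x. \<phi> (c *\<^sub>C x) = c * \<phi> x)"

lemma bounded_linear_scaleC: "bounded_linear (\<lambda>x :: 'a::complex_banach. c *\<^sub>C x)"
  using blinfun.bounded_linear_right[of "scalar_op c :: 'a \<Rightarrow>\<^sub>L 'a"] by simp

text \<open>A real functional \<open>\<psi>\<close> that does not vanish at \<open>x - y\<close> is the real part of the complex functional
\<open>\<psi>(v) - i \<psi>(i v)\<close>.\<close>

lemma complex_functionals_separate:
  fixes x y :: "'a::complex_banach"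
  assumes "\<And>\<phi>. complex_functional \<phi> \<Longrightarrow> \<phi> x = \<phi> y"
  shows "x = y"
proof -
  obtain \<psi> :: "'a \<Rightarrow> real" where psi: "bounded_linear \<psi>" "\<psi> (x - y) = norm (x - y)"
    using Hahn_Banach_norming by blast
  interpret psi: bounded_linear \<psi> by fact
  define \<phi> where "\<phi> v = complex_of_real (\<psi> v) - \<i> * complex_of_real (\<psi> (\<i> *\<^sub>C v))" for v
  have bl: "bounded_linear \<phi>"
    unfolding \<phi>_def
    by (intro bounded_linear_sub bounded_linear_const_mult bounded_linear_compose[OF bounded_linear_of_real]
        bounded_linear_compose[OF psi(1) bounded_linear_scaleC] psi(1))
  interpret phi: bounded_linear \<phi> by fact
  have i: "\<phi> (\<i> *\<^sub>C v) = \<i> * \<phi> v" for v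
  proof -
    have "\<i> *\<^sub>C \<i> *\<^sub>C v = - v"
      using scaleC_of_real[of "-1" v] by (simp add: scaleC_scaleC)
    then show ?thesis by (simp add: \<phi>_def psi.neg algebra_simps)
  qed
  have "\<phi> (c *\<^sub>C v) = c * \<phi> v" for c v
  proof -
    have "c *\<^sub>C v = Re c *\<^sub>R v + Im c *\<^sub>R (\<i> *\<^sub>C v)"
      by (simp add: scaleC_of_real[symmetric] scaleC_scaleC scaleC_add_left[symmetric] complex_eq[of c, symmetric] mult.commute)
    then have "\<phi> (c *\<^sub>C v) = of_real (Re c) * \<phi> v + of_real (Im c) * (\<i> * \<phi> v)"
      by (simp add: phi.add phi.scaleR i scaleR_conv_of_real)
    also have "\<dots> = c * \<phi> v" by (subst (3) complex_eq[of c]) (simp add: algebra_simps)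
    finally show ?thesis .
  qed
  with bl have "\<phi> x = \<phi> y" using assms[of \<phi>] by (simp add: complex_functional_def)
  then have "Re (\<phi> (x - y)) = 0" by (simp add: phi.diff)
  then have "\<psi> (x - y) = 0" by (simp add: \<phi>_def)
  then show ?thesis using psi(2) by simp
qed

section \<open>Contour integrals with values in a Banach space\<close>

lemma scaleR_scaleC_left: "(r *\<^sub>R c) *\<^sub>C x = r *\<^sub>R c *\<^sub>C (x :: 'a::complex_banach)"
  by (metis scaleR_conv_of_real scaleC_scaleC scaleC_of_real)

lemma bounded_linear_scaleC_left: "bounded_linear (\<lambda>c. c *\<^sub>C (x :: 'a::complex_banach))"
proof (rule bounded_linear_intro[where K = "norm x"])
  show "(r *\<^sub>R c) *\<^sub>C x = r *\<^sub>R c *\<^sub>C x" for r :: real and c :: complex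
    by (rule scaleR_scaleC_left)
qed (simp_all add: scaleC_add_left norm_scaleC)

lemma bounded_bilinear_scaleC: "bounded_bilinear (\<lambda>c (x :: 'a::complex_banach). c *\<^sub>C x)"
proof
  show "(r *\<^sub>R c) *\<^sub>C x = r *\<^sub>R c *\<^sub>C x" for r :: real and c :: complex and x :: 'a
    by (rule scaleR_scaleC_left)
  show "c *\<^sub>C r *\<^sub>R x = r *\<^sub>R c *\<^sub>C x" for r :: real and c :: complex and x :: 'a
    by (metis scaleC_of_real scaleC_scaleC mult.commute)
  show "\<exists>K. \<forall>c x :: 'a. norm (c *\<^sub>C x) \<le> norm c * norm x * K"
    by (intro exI[of _ 1]) (simp add: norm_scaleC)
qed (simp_all add: scaleC_add_left scaleC_add_right)

lemmas continuous_on_scaleC [continuous_intros] =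
  bounded_bilinear.continuous_on[OF bounded_bilinear_scaleC]
lemmas tendsto_scaleC [tendsto_intros] = bounded_bilinear.tendsto[OF bounded_bilinear_scaleC]

text \<open>The notion of holomorphy that interacts best with functionals. Continuity is included, so that
integrals along segments exist.\<close>

definition weakly_holomorphic :: "(complex \<Rightarrow> 'a::complex_banach) \<Rightarrow> complex set \<Rightarrow> bool" where
  "weakly_holomorphic F S \<longleftrightarrow> continuous_on S F \<and>
     (\<forall>\<phi>. complex_functional \<phi> \<longrightarrow> (\<lambda>z. \<phi> (F z)) holomorphic_on S)"

lemma weakly_holomorphic_subset: "weakly_holomorphic F S \<Longrightarrow> T \<subseteq> S \<Longrightarrow> weakly_holomorphic F T"
  by (auto simp: weakly_holomorphic_def intro: continuous_on_subset holomorphic_on_subset)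

definition banach_contour_integral :: "(real \<Rightarrow> complex) \<Rightarrow> (complex \<Rightarrow> 'a::complex_banach) \<Rightarrow> 'a" where
  "banach_contour_integral \<gamma> F =
     integral {0..1} (\<lambda>t. vector_derivative \<gamma> (at t within {0..1}) *\<^sub>C F (\<gamma> t))"

text \<open>The integral over the segment from the centre is a primitive. Additivity along triangles is checked
by applying functionals, which reduces it to scalar functions; the estimate of the difference quotient
then uses the continuity of \<open>F\<close> only.\<close>

lemma weakly_holomorphic_primitive:
  fixes F :: "complex \<Rightarrow> 'a::complex_banach"
  assumes F: "weakly_holomorphic F (ball a r)"
  obtains G where "\<And>z. z \<in> ball a r \<Longrightarrow> (G has_derivative (\<lambda>h. h *\<^sub>C F z)) (at z)"
proof -
  have cF: "continuous_on (ball a r) F" using F by (simp add: weakly_holomorphic_def)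
  define I where "I p q = integral {0..1} (\<lambda>t. (q - p) *\<^sub>C F (linepath p q t))" for p q
  have seg: "linepath p q t \<in> ball a r" if "p \<in> ball a r" "q \<in> ball a r" "t \<in> {0..1}" for p q t
    using that convex_contains_segment[of "ball a r"] linepath_in_path[of t p q] by (metis convex_ball subsetD)
  have cont: "continuous_on {0..1} (\<lambda>t. F (linepath p q t))" if "p \<in> ball a r" "q \<in> ball a r" for p q
    using seg[OF that] by (intro continuous_on_compose2[OF cF]) auto
  have int: "(\<lambda>t. c *\<^sub>C F (linepath p q t)) integrable_on {0..1}" if "p \<in> ball a r" "q \<in> ball a r" for p q c
    by (intro integrable_continuous_real continuous_intros cont that)
  have phiI: "\<phi> (I p q) = contour_integral (linepath p q) (\<lambda>z. \<phi> (F z))"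
    if "complex_functional \<phi>" "p \<in> ball a r" "q \<in> ball a r" for \<phi> p q
  proof -
    have "\<phi> (I p q) = integral {0..1} (\<phi> \<circ> (\<lambda>t. (q - p) *\<^sub>C F (linepath p q t)))"
      unfolding I_def using that by (intro integral_linear[symmetric] int) (auto simp: complex_functional_def)
    also have "\<dots> = contour_integral (linepath p q) (\<lambda>z. \<phi> (F z))"
      using that(1) by (simp add: contour_integral_integral complex_functional_def o_def mult.commute)
    finally show ?thesis .
  qed
  have split: "I a q - I a p = I p q" if "p \<in> ball a r" "q \<in> ball a r" for p q
  proof (rule complex_functionals_separate)
    fix \<phi> :: "'a \<Rightarrow> complex" assume phi: "complex_functional \<phi>"
    then interpret bounded_linear \<phi> by (simp add: complex_functional_def)
    have a: "a \<in> ball a r" using that(1) by (simp add: le_less_trans[OF zero_le_dist])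
    have "(\<lambda>z. \<phi> (F z)) holomorphic_on ball a r" using F phi by (simp add: weakly_holomorphic_def)
    then obtain g where g: "\<And>z. z \<in> ball a r \<Longrightarrow> (g has_field_derivative \<phi> (F z)) (at z within ball a r)"
      using holomorphic_convex_primitive'[of "ball a r" "\<lambda>z. \<phi> (F z)"] by auto
    have "contour_integral (linepath u v) (\<lambda>z. \<phi> (F z)) = g v - g u" if "u \<in> ball a r" "v \<in> ball a r" for u v
      using contour_integral_primitive[OF g, of "linepath u v"] that convex_contains_segment[of "ball a r"]
      by (simp add: contour_integral_unique)
    then show "\<phi> (I a q - I a p) = \<phi> (I p q)"
      using phi a that by (simp add: diff phiI)
  qed
  have "(I a has_derivative (\<lambda>h. h *\<^sub>C F z)) (at z)" if z: "z \<in> ball a r" for z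
    unfolding has_derivative_at_alt
  proof (intro conjI allI impI)
    fix e :: real assume e: "e > 0"
    have "isCont F z" using cF z by (simp add: continuous_on_eq_continuous_at)
    then obtain d where d: "d > 0" "\<And>w. dist w z < d \<Longrightarrow> dist (F w) (F z) < e"
      using e unfolding continuous_at_eps_delta by blast
    obtain d' where d': "d' > 0" "ball z d' \<subseteq> ball a r" using z openE[of "ball a r" z] by auto
    have "norm (I a w - I a z - (w - z) *\<^sub>C F z) \<le> e * norm (w - z)" if w: "norm (w - z) < min d d'" for w
    proof -
      have "w \<in> ball z d'" using w by (simp add: dist_norm norm_minus_commute)
      then have wr: "w \<in> ball a r" using d'(2) by blast
      have "I a w - I a z - (w - z) *\<^sub>C F z = integral {0..1} (\<lambda>t. (w - z) *\<^sub>C F (linepath z w t)) - integral {0..1} (\<lambda>t::real. (w - z) *\<^sub>C F z)"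
        using split[OF z wr] by (simp add: I_def)
      also have "\<dots> = integral {0..1} (\<lambda>t. (w - z) *\<^sub>C F (linepath z w t) - (w - z) *\<^sub>C F z)"
        using int[OF z wr] by (intro integral_diff[symmetric]) auto
      also have "norm \<dots> \<le> (e * norm (w - z)) * (1 - 0)"
      proof (rule integral_bound)
        show "continuous_on {0..1} (\<lambda>t. (w - z) *\<^sub>C F (linepath z w t) - (w - z) *\<^sub>C F z)"
          by (intro continuous_intros cont z wr)
        fix t :: real assume t: "t \<in> {0..1}"
        have "linepath z w t - z = t *\<^sub>R (w - z)" by (simp add: linepath_def algebra_simps)
        then have "dist (linepath z w t) z \<le> norm (w - z)"
          using t by (simp add: dist_norm mult_left_le_one_le)
        then have "dist (F (linepath z w t)) (F z) < e" using w by (intro d(2)) simp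
        then show "norm ((w - z) *\<^sub>C F (linepath z w t) - (w - z) *\<^sub>C F z) \<le> e * norm (w - z)"
          by (simp add: complex_vector.scale_right_diff_distrib[symmetric] norm_scaleC dist_norm mult.commute[of e] mult_left_mono)
      qed simp
      finally show ?thesis by simp
    qed
    then show "\<exists>d>0. \<forall>w. norm (w - z) < d \<longrightarrow> norm (I a w - I a z - (w - z) *\<^sub>C F z) \<le> e * norm (w - z)"
      using d(1) d'(1) by (intro exI[of _ "min d d'"]) auto
  qed (rule bounded_linear_scaleC_left)
  then show ?thesis by (rule that)
qed

text \<open>Since the derivative of a valid path may be unbounded near the finitely many exceptional points, the
integral exists only in the sense of Henstock and Kurzweil. It is obtained from the fundamental theorem of
calculus for a local primitive along short pieces of the path.\<close>

lemma weakly_holomorphic_contour_integrable: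
  fixes F :: "complex \<Rightarrow> 'a::complex_banach"
  assumes \<gamma>: "valid_path \<gamma>" "path_image \<gamma> \<subseteq> S" and S: "open S" and F: "weakly_holomorphic F S"
  shows "(\<lambda>t. vector_derivative \<gamma> (at t within {0..1}) *\<^sub>C F (\<gamma> t)) integrable_on {0..1}"
proof -
  obtain K where K: "finite K" "\<gamma> C1_differentiable_on ({0..1} - K)" and cg: "continuous_on {0..1} \<gamma>"
    using \<gamma>(1) by (auto simp: valid_path_def piecewise_C1_differentiable_on_def)
  let ?f = "\<lambda>t. vector_derivative \<gamma> (at t) *\<^sub>C F (\<gamma> t)"
  have loc: "\<exists>d>0. \<forall>u v. x \<in> {u..v} \<and> {u..v} \<subseteq> ball x d \<and> {u..v} \<subseteq> {0..1} \<longrightarrow> ?f integrable_on {u..v}"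
    if x: "x \<in> {0..1}" for x
  proof -
    have "\<gamma> x \<in> S" using \<gamma>(2) x by (auto simp: path_image_def)
    then obtain r where r: "r > 0" "ball (\<gamma> x) r \<subseteq> S" using S openE by blast
    obtain G where G: "\<And>z. z \<in> ball (\<gamma> x) r \<Longrightarrow> (G has_derivative (\<lambda>h. h *\<^sub>C F z)) (at z)"
      using weakly_holomorphic_primitive[OF weakly_holomorphic_subset[OF F r(2)]] by blast
    obtain d where d: "d > 0" "\<And>t. t \<in> {0..1} \<Longrightarrow> dist t x < d \<Longrightarrow> dist (\<gamma> t) (\<gamma> x) < r"
      using cg x r(1) unfolding continuous_on_iff by blast
    have "?f integrable_on {u..v}" if uv: "x \<in> {u..v}" "{u..v} \<subseteq> ball x d" "{u..v} \<subseteq> {0..1}" for u v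
    proof -
      have in_ball: "\<gamma> t \<in> ball (\<gamma> x) r" if "t \<in> {u..v}" for t
        using that uv d(2)[of t] by (auto simp: dist_commute subset_iff)
      have "(?f has_integral ((G \<circ> \<gamma>) v - (G \<circ> \<gamma>) u)) {u..v}"
      proof (rule fundamental_theorem_of_calculus_interior_strong[OF K(1)])
        show "u \<le> v" using uv(1) by simp
        have "continuous_on (ball (\<gamma> x) r) G"
          using has_derivative_continuous[OF G] by (intro continuous_at_imp_continuous_on) blast
        then show "continuous_on {u..v} (G \<circ> \<gamma>)"
          using in_ball by (intro continuous_on_compose continuous_on_subset[OF cg uv(3)])
              (rule continuous_on_subset, assumption, blast)
        fix t assume t: "t \<in> {u<..<v} - K"
        then have "t \<in> {u..v}" by auto
        have "t \<in> {0..1} - K" using t uv(3) \<open>t \<in> {u..v}\<close> by blast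
        then have "(\<gamma> has_vector_derivative vector_derivative \<gamma> (at t)) (at t)"
          using K(2) by (simp add: C1_differentiable_on_eq vector_derivative_works)
        then have "(\<gamma> has_derivative (\<lambda>h. h *\<^sub>R vector_derivative \<gamma> (at t))) (at t)"
          by (simp add: has_vector_derivative_def)
        then have "(G \<circ> \<gamma> has_derivative (\<lambda>h. h *\<^sub>C F (\<gamma> t)) \<circ> (\<lambda>h. h *\<^sub>R vector_derivative \<gamma> (at t))) (at t)"
          using G[OF in_ball[OF \<open>t \<in> {u..v}\<close>]] by (rule diff_chain_at)
        then show "(G \<circ> \<gamma> has_vector_derivative ?f t) (at t)"
          by (simp add: has_vector_derivative_def o_def scaleR_scaleC_left)
      qed
      then show ?thesis by blast
    qed
    then show ?thesis using d(1) by blast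
  qed
  have "?f integrable_on cbox 0 1"
  proof (rule integrable_on_little_subintervals)
    show "\<forall>x\<in>cbox 0 1. \<exists>d>0. \<forall>u v. x \<in> cbox u v \<and> cbox u v \<subseteq> ball x d \<and> cbox u v \<subseteq> cbox 0 1 \<longrightarrow> ?f integrable_on cbox u v"
      using loc by simp
  qed
  then have "?f integrable_on {0..1}" by simp
  \<comment> \<open>the one-sided derivatives at the end points of the interval do not matter\<close>
  then show ?thesis
  proof (rule integrable_spike_finite[of "{0, 1}", rotated 2])
    fix t :: real assume "t \<in> {0..1} - {0, 1}"
    then have "t \<in> interior {0..1}" by auto
    then show "vector_derivative \<gamma> (at t within {0..1}) *\<^sub>C F (\<gamma> t) = ?f t"
      by (simp only: at_within_interior)
  qed simp
qed

lemma functional_banach_contour_integral: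
  assumes "valid_path \<gamma>" "path_image \<gamma> \<subseteq> S" "open S" "weakly_holomorphic F S" "complex_functional \<phi>"
  shows "\<phi> (banach_contour_integral \<gamma> F) = contour_integral \<gamma> (\<lambda>z. \<phi> (F z))"
proof -
  let ?f = "\<lambda>t. vector_derivative \<gamma> (at t within {0..1}) *\<^sub>C F (\<gamma> t)"
  have "(?f has_integral banach_contour_integral \<gamma> F) {0..1}"
    unfolding banach_contour_integral_def
    using weakly_holomorphic_contour_integrable[OF assms(1-4)] by (rule integrable_integral)
  then have "(\<phi> \<circ> ?f has_integral \<phi> (banach_contour_integral \<gamma> F)) {0..1}"
    using assms(5) by (intro has_integral_linear) (auto simp: complex_functional_def)
  then have "((\<lambda>z. \<phi> (F z)) has_contour_integral \<phi> (banach_contour_integral \<gamma> F)) \<gamma>"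
    using assms(5) by (simp add: has_contour_integral_def complex_functional_def o_def mult.commute)
  then show ?thesis by (rule contour_integral_unique[symmetric])
qed

section \<open>Spectrum and resolvent in a complex Banach algebra\<close>

text \<open>The unit is not assumed to be different from zero: the operators on the zero space are to be an
instance.\<close>

class complex_banach_algebra = complex_banach + real_normed_algebra + monoid_mult +
  assumes scaleC_mult_left: "(c *\<^sub>C x) * y = c *\<^sub>C (x * y)"
    and mult_scaleC_right: "x * (c *\<^sub>C y) = c *\<^sub>C (x * y)"

lemmas alg_distribs = left_diff_distrib right_diff_distrib scaleC_mult_left mult_scaleC_right

definition inverse_pair :: "'a::monoid_mult \<Rightarrow> 'a \<Rightarrow> bool" where
  "inverse_pair a b \<longleftrightarrow> a * b = 1 \<and> b * a = 1"

lemma inverse_pair_unique: "inverse_pair a b \<Longrightarrow> inverse_pair a c \<Longrightarrow> b = c"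
  unfolding inverse_pair_def by (metis mult.assoc mult_1_left mult_1_right)

lemma inverse_pair_commute:
  fixes a b c :: "'a::monoid_mult"
  assumes "inverse_pair a b" "a * c = c * a"
  shows "b * c = c * b"
proof -
  have "b * c = b * (c * (a * b))" using assms(1) by (simp add: inverse_pair_def)
  also have "\<dots> = b * (a * c) * b" using assms(2) by (simp add: mult.assoc)
  also have "\<dots> = c * b" using assms(1) by (simp add: inverse_pair_def mult.assoc[symmetric])
  finally show ?thesis .
qed

definition alg_spectrum :: "'a::complex_banach_algebra \<Rightarrow> complex set" where
  "alg_spectrum a = {z. \<not> (\<exists>b. inverse_pair (z *\<^sub>C 1 - a) b)}"

definition alg_resolvent :: "'a::complex_banach_algebra \<Rightarrow> complex \<Rightarrow> 'a" where
  "alg_resolvent a z = (THE b. inverse_pair (z *\<^sub>C 1 - a) b)"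

lemma inverse_pair_resolvent:
  assumes "z \<notin> alg_spectrum a"
  shows "inverse_pair (z *\<^sub>C 1 - a) (alg_resolvent a z)"
proof -
  obtain b where b: "inverse_pair (z *\<^sub>C 1 - a) b" using assms by (auto simp: alg_spectrum_def)
  then show ?thesis unfolding alg_resolvent_def
    by (rule theI) (use b inverse_pair_unique in blast)
qed

lemma not_in_alg_spectrum: "inverse_pair (z *\<^sub>C 1 - a) b \<Longrightarrow> z \<notin> alg_spectrum a"
  by (auto simp: alg_spectrum_def)

lemma norm_power_le: "norm (a ^ n) \<le> norm (1 :: 'a) * norm a ^ n" for a :: "'a::complex_banach_algebra"
proof (induction n)
  case (Suc n)
  have "norm (a ^ Suc n) \<le> norm a * norm (a ^ n)" by (simp add: norm_mult_ineq)
  also have "\<dots> \<le> norm a * (norm (1 :: 'a) * norm a ^ n)" by (intro mult_left_mono Suc) simp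
  finally show ?case by (simp add: mult_ac)
qed simp

lemma inverse_pair_geometric:
  fixes a :: "'a::complex_banach_algebra"
  assumes "summable (\<lambda>n. norm (a ^ n))"
  shows "inverse_pair (1 - a) (\<Sum>n. a ^ n)"
proof -
  have s: "summable (\<lambda>n. a ^ n)" using assms by (rule summable_norm_cancel)
  have split: "(\<Sum>n. a ^ n) = 1 + (\<Sum>n. a ^ Suc n)"
    using suminf_split_head[OF s] by simp
  have "(\<Sum>n. a ^ Suc n) = a * (\<Sum>n. a ^ n)"
    using suminf_mult[OF s, of a] by simp
  moreover have "(\<Sum>n. a ^ Suc n) = (\<Sum>n. a ^ n) * a"
    using suminf_mult2[OF s, of a] by (simp only: power_Suc2)
  ultimately show ?thesis
    using split by (simp add: inverse_pair_def algebra_simps)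
qed

text \<open>A bound on all powers, rather than on the norm of \<open>a\<close>, is what quasinilpotent elements offer.\<close>

lemma summable_powers_of_bound:
  fixes a :: "'a::complex_banach_algebra"
  assumes "\<And>n. norm (a ^ n) \<le> C * r ^ n" "0 \<le> r" "r < 1"
  shows "summable (\<lambda>n. norm (a ^ n))"
  by (rule summable_comparison_test[where g = "\<lambda>n. C * r ^ n"])
    (use assms in \<open>auto intro!: summable_mult summable_geometric\<close>)

lemma inverse_pair_one_minus:
  fixes a :: "'a::complex_banach_algebra"
  assumes "norm a < 1"
  shows "\<exists>b. inverse_pair (1 - a) b"
  using inverse_pair_geometric[OF summable_powers_of_bound[OF norm_power_le norm_ge_zero assms]] by blast

lemma resolvent_identity:
  assumes "z \<notin> alg_spectrum a" "w \<notin> alg_spectrum a"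
  shows "alg_resolvent a w - alg_resolvent a z = (z - w) *\<^sub>C (alg_resolvent a w * alg_resolvent a z)"
proof -
  let ?R = "alg_resolvent a"
  have z: "(z *\<^sub>C 1 - a) * ?R z = 1" and w: "?R w * (w *\<^sub>C 1 - a) = 1"
    using inverse_pair_resolvent assms by (auto simp: inverse_pair_def)
  have "?R w - ?R z = ?R w * ((z *\<^sub>C 1 - a) * ?R z) - (?R w * (w *\<^sub>C 1 - a)) * ?R z"
    by (simp add: z w)
  also have "\<dots> = ?R w * ((z *\<^sub>C 1 - a) - (w *\<^sub>C 1 - a)) * ?R z"
    by (simp add: algebra_simps)
  also have "(z *\<^sub>C 1 - a) - (w *\<^sub>C 1 - a) = (z - w) *\<^sub>C (1 :: 'a)"
    by (simp add: complex_vector.scale_left_diff_distrib)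
  finally show ?thesis by (simp add: mult_scaleC_right scaleC_mult_left)
qed

text \<open>\<open>w - a = (z - a)(1 - (z - w)R)\<close> with \<open>R\<close> the resolvent at \<open>z\<close>, and the second factor is inverted by the
geometric series.\<close>

lemma not_in_alg_spectrum_near:
  fixes a :: "'a::complex_banach_algebra"
  assumes z: "z \<notin> alg_spectrum a" and w: "norm (w - z) * norm (alg_resolvent a z) < 1"
  shows "w \<notin> alg_spectrum a"
proof -
  let ?R = "alg_resolvent a z" and ?d = "(z - w) *\<^sub>C alg_resolvent a z"
  have R: "(z *\<^sub>C 1 - a) * ?R = 1" "?R * (z *\<^sub>C 1 - a) = 1"
    using inverse_pair_resolvent[OF z] by (auto simp: inverse_pair_def)
  have "norm ?d < 1" using w by (simp add: norm_scaleC norm_minus_commute)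
  then obtain b where b: "(1 - ?d) * b = 1" "b * (1 - ?d) = 1"
    using inverse_pair_one_minus unfolding inverse_pair_def by blast
  have e: "w *\<^sub>C 1 - a = (z *\<^sub>C 1 - a) - (z - w) *\<^sub>C 1"
    by (simp add: complex_vector.scale_left_diff_distrib)
  have l: "w *\<^sub>C 1 - a = (z *\<^sub>C 1 - a) * (1 - ?d)"
    unfolding e right_diff_distrib mult_scaleC_right R by simp
  have r: "w *\<^sub>C 1 - a = (1 - ?d) * (z *\<^sub>C 1 - a)"
    unfolding e left_diff_distrib[of 1] scaleC_mult_left R by simp
  have "(w *\<^sub>C 1 - a) * (b * ?R) = 1"
    by (metis b(1) R(1) l mult.assoc mult_1_right)
  moreover have "(b * ?R) * (w *\<^sub>C 1 - a) = 1"
    by (metis b(2) R(2) l mult.assoc mult_1_left)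
  ultimately have "inverse_pair (w *\<^sub>C 1 - a) (b * ?R)" by (simp add: inverse_pair_def)
  then show ?thesis by (rule not_in_alg_spectrum)
qed

lemma closed_alg_spectrum: "closed (alg_spectrum a)"
  unfolding closed_def
proof (rule openI)
  fix z assume "z \<in> - alg_spectrum a"
  then have z: "z \<notin> alg_spectrum a" by simp
  let ?r = "1 / (norm (alg_resolvent a z) + 1)"
  have "w \<notin> alg_spectrum a" if "w \<in> ball z ?r" for w
  proof (rule not_in_alg_spectrum_near[OF z])
    have "norm (w - z) * norm (alg_resolvent a z) \<le> norm (w - z) * (norm (alg_resolvent a z) + 1)"
      by (intro mult_left_mono) auto
    also have "\<dots> < 1"
      using that by (simp add: dist_norm norm_minus_commute field_simps add_pos_nonneg)
    finally show "norm (w - z) * norm (alg_resolvent a z) < 1" .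
  qed
  moreover have "?r > 0" by (simp add: add_nonneg_pos)
  ultimately show "\<exists>e>0. ball z e \<subseteq> - alg_spectrum a" by blast
qed

text \<open>The bound follows from \<open>z R = 1 + a R\<close>.\<close>

lemma alg_resolvent_large:
  fixes a :: "'a::complex_banach_algebra"
  assumes "norm z > norm a"
  shows "z \<notin> alg_spectrum a"
    and "norm (alg_resolvent a z) \<le> norm (1 :: 'a) / (norm z - norm a)"
proof -
  have z0: "z \<noteq> 0" using assms by (metis norm_ge_zero norm_zero not_less)
  have "norm (inverse z *\<^sub>C a) = norm a / norm z"
    by (simp only: norm_scaleC norm_inverse divide_inverse mult.commute)
  then have "norm (inverse z *\<^sub>C a) < 1"
    using assms z0 by simp
  then obtain b where b: "(1 - inverse z *\<^sub>C a) * b = 1" "b * (1 - inverse z *\<^sub>C a) = 1"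
    using inverse_pair_one_minus unfolding inverse_pair_def by blast
  have e: "z *\<^sub>C 1 - a = z *\<^sub>C (1 - inverse z *\<^sub>C a)"
    using z0 by (simp add: complex_vector.scale_right_diff_distrib scaleC_scaleC scaleC_one)
  have "inverse_pair (z *\<^sub>C 1 - a) (inverse z *\<^sub>C b)"
    unfolding e inverse_pair_def using b z0 by (simp add: scaleC_mult_left mult_scaleC_right scaleC_scaleC scaleC_one)
  then show z: "z \<notin> alg_spectrum a" by (rule not_in_alg_spectrum)
  let ?R = "alg_resolvent a z"
  have "(z *\<^sub>C 1 - a) * ?R = 1" using inverse_pair_resolvent[OF z] by (simp add: inverse_pair_def)
  then have "z *\<^sub>C ?R = 1 + a * ?R" by (simp add: left_diff_distrib scaleC_mult_left algebra_simps)
  then have "norm z * norm ?R \<le> norm (1 :: 'a) + norm a * norm ?R"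
    by (metis norm_scaleC norm_triangle_mono norm_mult_ineq order_refl)
  then show "norm ?R \<le> norm (1 :: 'a) / (norm z - norm a)"
    using assms by (simp add: field_simps)
qed

lemma compact_alg_spectrum: "compact (alg_spectrum (a :: 'a::complex_banach_algebra))"
proof -
  have "alg_spectrum a \<subseteq> cball 0 (norm a)" using alg_resolvent_large(1)[of a] by (force simp: not_le)
  then show ?thesis
    using closed_alg_spectrum bounded_subset[OF bounded_cball] by (auto simp: compact_eq_bounded_closed)
qed

text \<open>By the resolvent identity, \<open>norm (R w)\<close> is at most twice \<open>norm (R z)\<close> for \<open>w\<close> close to \<open>z\<close>; the same
identity then yields a Lipschitz estimate at \<open>z\<close>.\<close>

lemma continuous_on_alg_resolvent: "continuous_on (- alg_spectrum a) (alg_resolvent a)"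
proof (intro continuous_at_imp_continuous_on ballI)
  fix z assume "z \<in> - alg_spectrum a"
  then have z: "z \<notin> alg_spectrum a" by simp
  let ?R = "alg_resolvent a"
  have ev: "norm (?R w - ?R z) \<le> norm (w - z) * (2 * norm (?R z) * norm (?R z))"
    if "norm (w - z) * norm (?R z) < 1 / 2" for w
  proof -
    have w: "w \<notin> alg_spectrum a" using that by (intro not_in_alg_spectrum_near[OF z]) simp
    have "norm (?R w - ?R z) = norm (w - z) * norm (?R w * ?R z)"
      by (simp add: resolvent_identity[OF z w] norm_scaleC norm_minus_commute)
    also have "\<dots> \<le> norm (w - z) * (norm (?R w) * norm (?R z))"
      by (intro mult_left_mono norm_mult_ineq) simp
    finally have *: "norm (?R w - ?R z) \<le> norm (w - z) * norm (?R z) * norm (?R w)" by (simp add: mult_ac)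
    also have "\<dots> \<le> 1 / 2 * norm (?R w)" using that by (intro mult_right_mono) auto
    finally have "norm (?R w) \<le> 2 * norm (?R z)"
      using norm_triangle_ineq2[of "?R w" "?R z"] by simp
    then have "norm (w - z) * norm (?R z) * norm (?R w) \<le> norm (w - z) * norm (?R z) * (2 * norm (?R z))"
      by (intro mult_left_mono) auto
    with * show ?thesis by (simp add: mult_ac)
  qed
  have lim0: "((\<lambda>w. norm (w - z) * c) \<longlongrightarrow> 0) (at z)" for c
  proof -
    have "((\<lambda>w. norm (w - z) * c) \<longlongrightarrow> norm (z - z) * c) (at z)" by (intro tendsto_intros)
    then show ?thesis by simp
  qed
  have "\<forall>\<^sub>F w in at z. norm (?R w - ?R z) \<le> norm (w - z) * (2 * norm (?R z) * norm (?R z))"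
  proof (rule eventually_mono)
    show "\<forall>\<^sub>F w in at z. norm (w - z) * norm (?R z) < 1 / 2"
      by (rule order_tendstoD(2)[OF lim0]) simp
  qed (rule ev)
  then have "((\<lambda>w. ?R w - ?R z) \<longlongrightarrow> 0) (at z)"
    by (rule Lim_null_comparison) (rule lim0)
  then show "isCont ?R z" unfolding isCont_def by (simp add: LIM_zero_iff)
qed

text \<open>By the resolvent identity the difference quotient of \<open>R\<close> at \<open>z\<close> is \<open>- R w * R z\<close>, which is continuous in
\<open>w\<close>.\<close>

lemma weakly_holomorphic_resolvent: "weakly_holomorphic (alg_resolvent a) (- alg_spectrum a)"
  unfolding weakly_holomorphic_def
proof (intro conjI allI impI continuous_on_alg_resolvent)
  fix \<phi> :: "'a \<Rightarrow> complex" assume phi: "complex_functional \<phi>"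
  then interpret bounded_linear \<phi> by (simp add: complex_functional_def)
  let ?R = "alg_resolvent a"
  have o: "open (- alg_spectrum a)" by (intro open_Compl closed_alg_spectrum)
  show "(\<lambda>z. \<phi> (?R z)) holomorphic_on (- alg_spectrum a)"
    unfolding holomorphic_on_open[OF o]
  proof
    fix z assume z: "z \<in> - alg_spectrum a"
    have "isCont ?R z" using continuous_on_eq_continuous_at[OF o] continuous_on_alg_resolvent[of a] z by blast
    then have "((\<lambda>w. \<phi> (- (?R w * ?R z))) \<longlongrightarrow> \<phi> (- (?R z * ?R z))) (at z)"
      unfolding isCont_def by (intro tendsto tendsto_intros)
    moreover have "\<forall>\<^sub>F w in at z. \<phi> (- (?R w * ?R z)) = (\<phi> (?R w) - \<phi> (?R z)) / (w - z)"
    proof -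
      have "\<forall>\<^sub>F w in at z. w \<in> - alg_spectrum a \<and> w \<noteq> z"
        using o z by (intro eventually_conj eventually_at_in_open' eventually_neq_at_within)
      then show ?thesis
      proof (rule eventually_mono)
        fix w assume w: "w \<in> - alg_spectrum a \<and> w \<noteq> z"
        have "\<phi> (?R w) - \<phi> (?R z) = (z - w) * \<phi> (?R w * ?R z)"
          using resolvent_identity[of z a w] z w phi by (simp add: diff[symmetric] complex_functional_def)
        then show "\<phi> (- (?R w * ?R z)) = (\<phi> (?R w) - \<phi> (?R z)) / (w - z)"
          using w by (simp add: neg field_simps)
      qed
    qed
    ultimately have "((\<lambda>w. (\<phi> (?R w) - \<phi> (?R z)) / (w - z)) \<longlongrightarrow> \<phi> (- (?R z * ?R z))) (at z)"
      by (rule Lim_transform_eventually)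
    then show "\<exists>f'. ((\<lambda>z. \<phi> (?R z)) has_field_derivative f') (at z)"
      unfolding has_field_derivative_iff by blast
  qed
qed

section \<open>The holomorphic functional calculus\<close>

lemma complex_functional_compose:
  fixes b :: "'a::complex_banach_algebra"
  assumes "complex_functional \<phi>"
  shows "complex_functional (\<lambda>x. \<phi> (b * x))" "complex_functional (\<lambda>x. \<phi> (x * b))"
  using assms
  by (auto simp: complex_functional_def mult_scaleC_right scaleC_mult_left
      intro: bounded_linear_compose[of \<phi>] bounded_linear_mult_right bounded_linear_mult_left)

lemma weakly_holomorphic_scaleC:
  assumes "f holomorphic_on S" "weakly_holomorphic F S"
  shows "weakly_holomorphic (\<lambda>z. f z *\<^sub>C F z) S"
  using assms unfolding weakly_holomorphic_def
  by (auto simp: complex_functional_def intro!: continuous_intros holomorphic_intros holomorphic_on_imp_continuous_on)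

lemma surrounding_contour_mono:
  assumes "surrounding_contour K \<Omega>' \<Gamma>" "\<Omega>' \<subseteq> \<Omega>"
  shows "surrounding_contour K \<Omega> \<Gamma>"
  using assms by (auto simp: surrounding_contour_iff cycle_in_def)

definition fcalc :: "complex set \<Rightarrow> (complex \<Rightarrow> complex) \<Rightarrow> 'a::complex_banach_algebra \<Rightarrow> 'a" where
  "fcalc \<Omega> f a =
     (let \<Gamma> = (SOME \<Gamma>. surrounding_contour (alg_spectrum a) \<Omega> \<Gamma>) in
      (1 / (2 * of_real pi * \<i>)) *\<^sub>C
        (\<Sum>\<gamma>\<leftarrow>\<Gamma>. banach_contour_integral \<gamma> (\<lambda>z. f z *\<^sub>C alg_resolvent a z)))"

definition spectral_nbhd :: "'a::complex_banach_algebra \<Rightarrow> complex set \<Rightarrow> bool" where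
  "spectral_nbhd a \<Omega> \<longleftrightarrow> open \<Omega> \<and> alg_spectrum a \<subseteq> \<Omega>"

lemma spectral_nbhd_Diff: "spectral_nbhd a \<Omega> \<Longrightarrow> open (\<Omega> - alg_spectrum a)"
  by (auto simp: spectral_nbhd_def intro: open_Diff closed_alg_spectrum)

lemma holomorphic_functional_resolvent:
  "complex_functional \<phi> \<Longrightarrow> S \<inter> alg_spectrum a = {} \<Longrightarrow> (\<lambda>z. \<phi> (alg_resolvent a z)) holomorphic_on S"
  using weakly_holomorphic_resolvent[of a] holomorphic_on_subset[of _ "- alg_spectrum a" S]
  unfolding weakly_holomorphic_def by blast

lemma functional_sum_list_integrals:
  fixes a :: "'a::complex_banach_algebra"
  assumes "spectral_nbhd a \<Omega>" "f holomorphic_on \<Omega>" "complex_functional \<phi>"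
    and "cycle_in (\<Omega> - alg_spectrum a) \<Gamma>"
  shows "\<phi> (\<Sum>\<gamma>\<leftarrow>\<Gamma>. banach_contour_integral \<gamma> (\<lambda>z. f z *\<^sub>C alg_resolvent a z)) =
    cycle_integral \<Gamma> (\<lambda>z. f z * \<phi> (alg_resolvent a z))"
  using assms(4)
proof (induction \<Gamma>)
  case Nil
  interpret bounded_linear \<phi> using assms(3) by (simp add: complex_functional_def)
  show ?case by (simp add: zero)
next
  case (Cons \<gamma> \<Gamma>)
  interpret bounded_linear \<phi> using assms(3) by (simp add: complex_functional_def)
  have "weakly_holomorphic (\<lambda>z. f z *\<^sub>C alg_resolvent a z) (\<Omega> - alg_spectrum a)"
    by (intro weakly_holomorphic_scaleC weakly_holomorphic_subset[OF weakly_holomorphic_resolvent]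
        holomorphic_on_subset[OF assms(2)]) auto
  then have "\<phi> (banach_contour_integral \<gamma> (\<lambda>z. f z *\<^sub>C alg_resolvent a z)) =
      contour_integral \<gamma> (\<lambda>z. \<phi> (f z *\<^sub>C alg_resolvent a z))"
    using Cons.prems spectral_nbhd_Diff[OF assms(1)] assms(3)
    by (intro functional_banach_contour_integral[where S = "\<Omega> - alg_spectrum a"]) auto
  then show ?case using Cons assms(3) by (simp add: add complex_functional_def)
qed

text \<open>Every identity between values of the functional calculus is proved through this formula. The contour
\<open>\<Gamma>\<close> is arbitrary, so that it can be chosen to suit the purpose.\<close>

lemma fcalc_functional:
  fixes a :: "'a::complex_banach_algebra"
  assumes D: "spectral_nbhd a \<Omega>" and f: "f holomorphic_on \<Omega>" and phi: "complex_functional \<phi>"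
    and \<Gamma>: "surrounding_contour (alg_spectrum a) \<Omega> \<Gamma>"
  shows "2 * pi * \<i> * \<phi> (fcalc \<Omega> f a) = cycle_integral \<Gamma> (\<lambda>z. f z * \<phi> (alg_resolvent a z))"
proof -
  define \<Delta> where "\<Delta> = (SOME \<Gamma>. surrounding_contour (alg_spectrum a) \<Omega> \<Gamma>)"
  have \<Delta>: "surrounding_contour (alg_spectrum a) \<Omega> \<Delta>"
    unfolding \<Delta>_def using \<Gamma> by (rule someI)
  then have "cycle_in (\<Omega> - alg_spectrum a) \<Delta>" by (simp add: surrounding_contour_iff)
  then have "2 * pi * \<i> * \<phi> (fcalc \<Omega> f a) = cycle_integral \<Delta> (\<lambda>z. f z * \<phi> (alg_resolvent a z))"
    using functional_sum_list_integrals[OF D f phi] phi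
    by (simp add: fcalc_def \<Delta>_def[symmetric] complex_functional_def)
  also have "\<dots> = cycle_integral \<Gamma> (\<lambda>z. f z * \<phi> (alg_resolvent a z))"
    using D by (intro surrounding_contour_integral_eq[OF \<Delta> \<Gamma>] holomorphic_intros
        holomorphic_functional_resolvent[OF phi] holomorphic_on_subset[OF f] closed_alg_spectrum)
      (auto simp: spectral_nbhd_def)
  finally show ?thesis .
qed

lemma ex_spectral_contour:
  assumes "spectral_nbhd a \<Omega>"
  obtains \<Gamma> where "surrounding_contour (alg_spectrum a) \<Omega> \<Gamma>" "C1_cycle \<Gamma>"
    "cycle_in (\<Omega> - alg_spectrum a) \<Gamma>"
  using ex_C1_surrounding_contour[OF compact_alg_spectrum[of a], of \<Omega>] assms
  by (auto simp: spectral_nbhd_def surrounding_contour_iff)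

lemma fcalc_eqI:
  fixes a :: "'a::complex_banach_algebra"
  assumes "spectral_nbhd a \<Omega>" "f holomorphic_on \<Omega>" "surrounding_contour (alg_spectrum a) \<Omega> \<Gamma>"
    and "\<And>\<phi>. complex_functional \<phi> \<Longrightarrow>
      cycle_integral \<Gamma> (\<lambda>z. f z * \<phi> (alg_resolvent a z)) = 2 * pi * \<i> * \<phi> x"
  shows "fcalc \<Omega> f a = x"
proof (rule complex_functionals_separate)
  fix \<phi> :: "'a \<Rightarrow> complex" assume phi: "complex_functional \<phi>"
  have "2 * pi * \<i> * \<phi> (fcalc \<Omega> f a) = 2 * pi * \<i> * \<phi> x"
    using fcalc_functional[OF assms(1,2) phi assms(3)] assms(4)[OF phi] by simp
  then show "\<phi> (fcalc \<Omega> f a) = \<phi> x" by simp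
qed

lemma fcalc_restrict:
  assumes "spectral_nbhd a \<Omega>'" "spectral_nbhd a \<Omega>" "\<Omega>' \<subseteq> \<Omega>" "f holomorphic_on \<Omega>"
    and eq: "\<And>z. z \<in> \<Omega>' \<Longrightarrow> g z = f z"
  shows "fcalc \<Omega> f a = fcalc \<Omega>' g a"
proof -
  obtain \<Gamma> where \<Gamma>: "surrounding_contour (alg_spectrum a) \<Omega>' \<Gamma>" "cycle_in (\<Omega>' - alg_spectrum a) \<Gamma>"
    using ex_spectral_contour[OF assms(1)] by blast
  have g: "g holomorphic_on \<Omega>'"
    using holomorphic_on_subset[OF assms(4,3)] eq by (metis holomorphic_cong)
  show ?thesis
  proof (rule fcalc_eqI[OF assms(2,4) surrounding_contour_mono[OF \<Gamma>(1) assms(3)]])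
    fix \<phi> :: "'a \<Rightarrow> complex" assume phi: "complex_functional \<phi>"
    have "cycle_integral \<Gamma> (\<lambda>z. f z * \<phi> (alg_resolvent a z)) = cycle_integral \<Gamma> (\<lambda>z. g z * \<phi> (alg_resolvent a z))"
      using eq by (intro cycle_integral_cong[OF \<Gamma>(2)]) auto
    then show "cycle_integral \<Gamma> (\<lambda>z. f z * \<phi> (alg_resolvent a z)) = 2 * pi * \<i> * \<phi> (fcalc \<Omega>' g a)"
      using fcalc_functional[OF assms(1) g phi \<Gamma>(1)] by simp
  qed
qed

lemma fcalc_cong:
  assumes "spectral_nbhd a \<Omega>" "f holomorphic_on \<Omega>" "\<And>z. z \<in> \<Omega> \<Longrightarrow> g z = f z"
  shows "fcalc \<Omega> f a = fcalc \<Omega> g a"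
  using fcalc_restrict[OF assms(1,1) order_refl assms(2,3)] .

lemma fcalc_add:
  assumes D: "spectral_nbhd a \<Omega>" and f: "f holomorphic_on \<Omega>" and g: "g holomorphic_on \<Omega>"
  shows "fcalc \<Omega> (\<lambda>z. f z + g z) a = fcalc \<Omega> f a + fcalc \<Omega> g a"
proof -
  obtain \<Gamma> where \<Gamma>: "surrounding_contour (alg_spectrum a) \<Omega> \<Gamma>" "cycle_in (\<Omega> - alg_spectrum a) \<Gamma>"
    using ex_spectral_contour[OF D] by blast
  show ?thesis
  proof (rule fcalc_eqI[OF D _ \<Gamma>(1)])
    show "(\<lambda>z. f z + g z) holomorphic_on \<Omega>" by (intro holomorphic_intros f g)
    fix \<phi> :: "'a \<Rightarrow> complex" assume phi: "complex_functional \<phi>"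
    then interpret bounded_linear \<phi> by (simp add: complex_functional_def)
    have hol: "(\<lambda>z. h z * \<phi> (alg_resolvent a z)) holomorphic_on \<Omega> - alg_spectrum a" if "h holomorphic_on \<Omega>" for h
      using phi by (intro holomorphic_intros holomorphic_functional_resolvent holomorphic_on_subset[OF that]) auto
    show "cycle_integral \<Gamma> (\<lambda>z. (f z + g z) * \<phi> (alg_resolvent a z)) = 2 * pi * \<i> * \<phi> (fcalc \<Omega> f a + fcalc \<Omega> g a)"
      using cycle_integral_add[OF \<Gamma>(2) spectral_nbhd_Diff[OF D] hol[OF f] hol[OF g]]
      by (simp only: add distrib_left distrib_right fcalc_functional[OF D f phi \<Gamma>(1)] fcalc_functional[OF D g phi \<Gamma>(1)])
  qed
qed

lemma fcalc_cmult:
  assumes D: "spectral_nbhd a \<Omega>" and f: "f holomorphic_on \<Omega>"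
  shows "fcalc \<Omega> (\<lambda>z. c * f z) a = c *\<^sub>C fcalc \<Omega> f a"
proof -
  obtain \<Gamma> where \<Gamma>: "surrounding_contour (alg_spectrum a) \<Omega> \<Gamma>" "cycle_in (\<Omega> - alg_spectrum a) \<Gamma>"
    using ex_spectral_contour[OF D] by blast
  show ?thesis
  proof (rule fcalc_eqI[OF D _ \<Gamma>(1)])
    show "(\<lambda>z. c * f z) holomorphic_on \<Omega>" by (intro holomorphic_intros f)
    fix \<phi> :: "'a \<Rightarrow> complex" assume phi: "complex_functional \<phi>"
    have "(\<lambda>z. f z * \<phi> (alg_resolvent a z)) holomorphic_on \<Omega> - alg_spectrum a"
      using phi by (intro holomorphic_intros holomorphic_functional_resolvent holomorphic_on_subset[OF f]) auto
    from cycle_integral_lmul[OF \<Gamma>(2) spectral_nbhd_Diff[OF D] this, of c]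
    show "cycle_integral \<Gamma> (\<lambda>z. (c * f z) * \<phi> (alg_resolvent a z)) = 2 * pi * \<i> * \<phi> (c *\<^sub>C fcalc \<Omega> f a)"
      using phi by (simp add: fcalc_functional[OF D f phi \<Gamma>(1), symmetric] complex_functional_def mult.assoc)
  qed
qed

text \<open>\<open>x \<mapsto> \<phi> (b * x)\<close> and \<open>x \<mapsto> \<phi> (x * b)\<close> are functionals again and agree on the resolvents.\<close>

lemma fcalc_commute:
  assumes D: "spectral_nbhd a \<Omega>" and f: "f holomorphic_on \<Omega>" and b: "a * b = b * a"
  shows "fcalc \<Omega> f a * b = b * fcalc \<Omega> f a"
proof (rule complex_functionals_separate)
  fix \<phi> :: "'a \<Rightarrow> complex" assume phi: "complex_functional \<phi>"
  obtain \<Gamma> where \<Gamma>: "surrounding_contour (alg_spectrum a) \<Omega> \<Gamma>" "cycle_in (\<Omega> - alg_spectrum a) \<Gamma>"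
    using ex_spectral_contour[OF D] by blast
  have "alg_resolvent a z * b = b * alg_resolvent a z" if "z \<notin> alg_spectrum a" for z
    using inverse_pair_commute[OF inverse_pair_resolvent[OF that]] b
    by (simp add: alg_distribs)
  then have "cycle_integral \<Gamma> (\<lambda>z. f z * \<phi> (alg_resolvent a z * b)) = cycle_integral \<Gamma> (\<lambda>z. f z * \<phi> (b * alg_resolvent a z))"
    by (intro cycle_integral_cong[OF \<Gamma>(2)]) auto
  then have "2 * pi * \<i> * \<phi> (fcalc \<Omega> f a * b) = 2 * pi * \<i> * \<phi> (b * fcalc \<Omega> f a)"
    using fcalc_functional[OF D f complex_functional_compose(1)[OF phi] \<Gamma>(1)]
      fcalc_functional[OF D f complex_functional_compose(2)[OF phi] \<Gamma>(1)] by simp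
  then show "\<phi> (fcalc \<Omega> f a * b) = \<phi> (b * fcalc \<Omega> f a)" by simp
qed

text \<open>Represent \<open>h(a)\<close> by a contour \<open>\<Gamma>2\<close> and \<open>f(a)\<close> by a contour \<open>\<Gamma>1\<close> inside the open set \<open>\<Omega>1\<close> of points
around which \<open>\<Gamma>2\<close> winds once. By the resolvent identity \<open>\<phi>(R w * R z) = (\<psi> w - \<psi> z)/(z - w)\<close> with \<open>\<psi> z = \<phi>(R z)\<close>.
In the double integral the term with \<open>\<psi> w\<close> is evaluated by Cauchy's formula along \<open>\<Gamma>2\<close> and gives
\<open>(f h)(a)\<close>; in the other term the integral along \<open>\<Gamma>1\<close> can be carried out first, and it vanishes because
\<open>z \<notin> \<Omega>1\<close>.\<close>

theorem fcalc_mult: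
  fixes a :: "'a::complex_banach_algebra"
  assumes D: "spectral_nbhd a \<Omega>" and f: "f holomorphic_on \<Omega>" and h: "h holomorphic_on \<Omega>"
  shows "fcalc \<Omega> (\<lambda>z. f z * h z) a = fcalc \<Omega> f a * fcalc \<Omega> h a"
proof (rule complex_functionals_separate)
  fix \<phi> :: "'a \<Rightarrow> complex" assume phi: "complex_functional \<phi>"
  let ?\<sigma> = "alg_spectrum a" and ?R = "alg_resolvent a" and ?c = "complex_of_real (2 * pi) * \<i>"
  have \<Omega>: "open \<Omega>" "?\<sigma> \<subseteq> \<Omega>" using D by (auto simp: spectral_nbhd_def)
  obtain \<Gamma>2 where \<Gamma>2: "surrounding_contour ?\<sigma> \<Omega> \<Gamma>2" "C1_cycle \<Gamma>2" "cycle_in (\<Omega> - ?\<sigma>) \<Gamma>2"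
    using ex_spectral_contour[OF D] by blast
  let ?I = "\<Union>\<gamma>\<in>set \<Gamma>2. path_image \<gamma>"
  have I: "?I \<subseteq> \<Omega> - ?\<sigma>" using \<Gamma>2(3) by (auto simp: cycle_in_def)
  have \<Gamma>2I: "cycle_in ?I \<Gamma>2" using \<Gamma>2(3) by (rule cycle_in_images)
  define \<Omega>1 where "\<Omega>1 = {z. z \<notin> ?I \<and> cycle_winding \<Gamma>2 z = 1}"
  have D1: "spectral_nbhd a \<Omega>1" and sub: "\<Omega>1 \<subseteq> \<Omega>"
    using open_cycle_winding_level[OF \<Gamma>2(3), of 1] I \<Gamma>2(1)
    by (auto simp: spectral_nbhd_def \<Omega>1_def surrounding_contour_iff)
  obtain \<Gamma>1 where \<Gamma>1: "surrounding_contour ?\<sigma> \<Omega>1 \<Gamma>1" "C1_cycle \<Gamma>1" "cycle_in (\<Omega>1 - ?\<sigma>) \<Gamma>1"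
    using ex_spectral_contour[OF D1] by blast
  have \<Gamma>1': "surrounding_contour ?\<sigma> \<Omega> \<Gamma>1" using \<Gamma>1(1) sub by (rule surrounding_contour_mono)
  have o1: "open (\<Omega>1 - ?\<sigma>)" using D1 by (rule spectral_nbhd_Diff)
  define \<psi> where "\<psi> z = \<phi> (?R z)" for z
  have psi: "\<psi> holomorphic_on S" if "S \<inter> ?\<sigma> = {}" for S
    unfolding \<psi>_def using holomorphic_functional_resolvent[OF phi that] .
  have inner: "?c * \<phi> (?R w * fcalc \<Omega> h a) =
      ?c * (\<psi> w * h w) - cycle_integral \<Gamma>2 (\<lambda>z. h z * \<psi> z / (z - w))" if w: "w \<in> \<Omega>1 - ?\<sigma>" for w
  proof -
    let ?S = "\<Omega> - ?\<sigma> - {w}"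
    have S: "cycle_in ?S \<Gamma>2" "open ?S" "cycle_in (\<Omega> - {w}) \<Gamma>2"
      using \<Gamma>2(3) w spectral_nbhd_Diff[OF D] by (auto simp: cycle_in_def \<Omega>1_def open_delete)
    have "?c * \<phi> (?R w * fcalc \<Omega> h a) = cycle_integral \<Gamma>2 (\<lambda>z. h z * \<phi> (?R w * ?R z))"
      by (rule fcalc_functional[OF D h complex_functional_compose(1)[OF phi] \<Gamma>2(1)])
    also have "\<dots> = cycle_integral \<Gamma>2 (\<lambda>z. \<psi> w * (h z / (z - w)) - h z * \<psi> z / (z - w))"
    proof (rule cycle_integral_cong[OF S(1)])
      fix z assume z: "z \<in> ?S"
      have "?R w - ?R z = (z - w) *\<^sub>C (?R w * ?R z)" using z w by (intro resolvent_identity) auto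
      then have "\<psi> w - \<psi> z = (z - w) * \<phi> (?R w * ?R z)"
        using phi unfolding \<psi>_def complex_functional_def by (metis bounded_linear.axioms(1) linear_diff bounded_linear.linear)
      then have e: "\<phi> (?R w * ?R z) = (\<psi> w - \<psi> z) / (z - w)" using z by simp
      show "h z * \<phi> (?R w * ?R z) = \<psi> w * (h z / (z - w)) - h z * \<psi> z / (z - w)"
        unfolding e by (simp add: diff_divide_distrib right_diff_distrib mult.commute)
    qed
    also have "\<dots> = \<psi> w * cycle_integral \<Gamma>2 (\<lambda>z. h z / (z - w)) - cycle_integral \<Gamma>2 (\<lambda>z. h z * \<psi> z / (z - w))"
    proof -
      have 1: "(\<lambda>z. h z / (z - w)) holomorphic_on ?S"
        by (intro holomorphic_intros holomorphic_on_subset[OF h]) auto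
      have 2: "(\<lambda>z. h z * \<psi> z / (z - w)) holomorphic_on ?S"
        by (intro holomorphic_intros holomorphic_on_subset[OF h] psi) auto
      show ?thesis
        using cycle_integral_diff[OF S(1,2) holomorphic_on_mult[OF holomorphic_on_const 1] 2, of "\<psi> w"]
          cycle_integral_lmul[OF S(1,2) 1, of "\<psi> w"] by simp
    qed
    also have "cycle_integral \<Gamma>2 (\<lambda>z. h z / (z - w)) = ?c * cycle_winding \<Gamma>2 w * h w"
      using \<Gamma>2(1) w sub by (intro Cauchy_formula_cycle[OF S(3) \<Omega>(1) _ h]) (auto simp: surrounding_contour_iff)
    also have "cycle_winding \<Gamma>2 w = 1" using w by (simp add: \<Omega>1_def)
    finally show ?thesis by (simp add: mult_ac)
  qed
  define B where "B w = cycle_integral \<Gamma>2 (\<lambda>z. h z * \<psi> z / (z - w))" for w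
  have "cycle_integral \<Gamma>1 (\<lambda>w. f w * B w) = 0"
  proof -
    have "cycle_integral \<Gamma>1 (\<lambda>w. f w * B w) =
        cycle_integral \<Gamma>1 (\<lambda>w. cycle_integral \<Gamma>2 (\<lambda>z. f w * (h z * \<psi> z / (z - w))))"
    proof (rule cycle_integral_cong[OF \<Gamma>1(3)])
      fix w assume w: "w \<in> \<Omega>1 - ?\<sigma>"
      have S: "cycle_in (\<Omega> - ?\<sigma> - {w}) \<Gamma>2" "open (\<Omega> - ?\<sigma> - {w})"
        using \<Gamma>2(3) w spectral_nbhd_Diff[OF D] by (auto simp: cycle_in_def \<Omega>1_def open_delete)
      have "(\<lambda>z. h z * \<psi> z / (z - w)) holomorphic_on \<Omega> - ?\<sigma> - {w}"
        by (intro holomorphic_intros holomorphic_on_subset[OF h] psi) auto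
      from cycle_integral_lmul[OF S this, of "f w"]
      show "f w * B w = cycle_integral \<Gamma>2 (\<lambda>z. f w * (h z * \<psi> z / (z - w)))"
        by (simp add: B_def)
    qed
    also have "\<dots> = cycle_integral \<Gamma>2 (\<lambda>z. cycle_integral \<Gamma>1 (\<lambda>w. f w * (h z * \<psi> z / (z - w))))"
    proof (rule cycle_integral_swap[OF \<Gamma>1(2) \<Gamma>2(2) \<Gamma>1(3) \<Gamma>2I])
      let ?P = "(\<Omega>1 - ?\<sigma>) \<times> ?I"
      have "continuous_on ?P (\<lambda>x. f (fst x))"
        using sub by (intro continuous_on_compose2[OF holomorphic_on_imp_continuous_on[OF f]] continuous_intros) auto
      moreover have "continuous_on ?P (\<lambda>x. h (snd x))"
        using I by (intro continuous_on_compose2[OF holomorphic_on_imp_continuous_on[OF h]] continuous_intros) auto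
      moreover have "continuous_on ?P (\<lambda>x. \<psi> (snd x))"
        using I by (intro continuous_on_compose2[OF holomorphic_on_imp_continuous_on[OF psi[of "- ?\<sigma>"]]] continuous_intros) auto
      ultimately show "continuous_on ?P (\<lambda>(w, z). f w * (h z * \<psi> z / (z - w)))"
        unfolding case_prod_unfold by (intro continuous_intros) (auto simp: \<Omega>1_def)
    qed
    also have "\<dots> = cycle_integral \<Gamma>2 (\<lambda>z. 0)"
    proof (rule cycle_integral_cong[OF \<Gamma>2I])
      fix z assume z: "z \<in> ?I"
      show "cycle_integral \<Gamma>1 (\<lambda>w. f w * (h z * \<psi> z / (z - w))) = 0"
      proof (rule Cauchy_theorem_cycle[OF cycle_in_mono[OF \<Gamma>1(3)]])
        show "open \<Omega>1" using D1 by (simp add: spectral_nbhd_def)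
        show "(\<lambda>w. f w * (h z * \<psi> z / (z - w))) holomorphic_on \<Omega>1"
          using z by (intro holomorphic_intros holomorphic_on_subset[OF f sub]) (auto simp: \<Omega>1_def)
      qed (use \<Gamma>1(1) in \<open>auto simp: surrounding_contour_iff\<close>)
    qed
    also have "\<dots> = 0"
      using cycle_integral_lmul[OF \<Gamma>2(3) spectral_nbhd_Diff[OF D] holomorphic_on_const, of 0 0] by simp
    finally show ?thesis .
  qed
  moreover have "cycle_integral \<Gamma>1 (\<lambda>w. f w * B w) =
      ?c * cycle_integral \<Gamma>1 (\<lambda>w. (f w * h w) * \<psi> w) - ?c * cycle_integral \<Gamma>1 (\<lambda>w. f w * \<phi> (?R w * fcalc \<Omega> h a))"
  proof -
    have 1: "(\<lambda>w. (f w * h w) * \<psi> w) holomorphic_on \<Omega>1 - ?\<sigma>"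
      using sub by (intro holomorphic_intros psi holomorphic_on_subset[OF f] holomorphic_on_subset[OF h]) auto
    have 2: "(\<lambda>w. f w * \<phi> (?R w * fcalc \<Omega> h a)) holomorphic_on \<Omega>1 - ?\<sigma>"
      using sub by (intro holomorphic_intros holomorphic_functional_resolvent[OF complex_functional_compose(2)[OF phi]]
          holomorphic_on_subset[OF f]) auto
    have "cycle_integral \<Gamma>1 (\<lambda>w. f w * B w) =
        cycle_integral \<Gamma>1 (\<lambda>w. ?c * ((f w * h w) * \<psi> w) - ?c * (f w * \<phi> (?R w * fcalc \<Omega> h a)))"
    proof (rule cycle_integral_cong[OF \<Gamma>1(3)])
      fix w assume w: "w \<in> \<Omega>1 - ?\<sigma>"
      have "B w = ?c * (\<psi> w * h w) - ?c * \<phi> (?R w * fcalc \<Omega> h a)"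
        using inner[OF w] by (simp add: B_def)
      then show "f w * B w = ?c * ((f w * h w) * \<psi> w) - ?c * (f w * \<phi> (?R w * fcalc \<Omega> h a))"
        by (simp add: right_diff_distrib mult_ac)
    qed
    then show ?thesis
      using cycle_integral_diff[OF \<Gamma>1(3) o1 holomorphic_on_mult[OF holomorphic_on_const 1] holomorphic_on_mult[OF holomorphic_on_const 2], of ?c ?c]
        cycle_integral_lmul[OF \<Gamma>1(3) o1 1, of ?c] cycle_integral_lmul[OF \<Gamma>1(3) o1 2, of ?c] by simp
  qed
  moreover have "cycle_integral \<Gamma>1 (\<lambda>w. (f w * h w) * \<psi> w) = ?c * \<phi> (fcalc \<Omega> (\<lambda>z. f z * h z) a)"
    unfolding \<psi>_def by (rule fcalc_functional[OF D holomorphic_on_mult[OF f h] phi \<Gamma>1', symmetric])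
  moreover have "cycle_integral \<Gamma>1 (\<lambda>w. f w * \<phi> (?R w * fcalc \<Omega> h a)) = ?c * \<phi> (fcalc \<Omega> f a * fcalc \<Omega> h a)"
    by (rule fcalc_functional[OF D f complex_functional_compose(2)[OF phi] \<Gamma>1', symmetric])
  ultimately show "\<phi> (fcalc \<Omega> (\<lambda>z. f z * h z) a) = \<phi> (fcalc \<Omega> f a * fcalc \<Omega> h a)" by simp
qed

lemma circlepath_surrounding:
  fixes a :: "'a::complex_banach_algebra"
  assumes "r > norm a"
  shows "surrounding_contour (alg_spectrum a) UNIV [circlepath 0 r]"
proof -
  have r: "r > 0" using assms norm_ge_zero[of a] by linarith
  have sp: "norm z \<le> norm a" if "z \<in> alg_spectrum a" for z
    using alg_resolvent_large(1)[of a z] that by force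
  have "winding_number (circlepath 0 r) z = 1" if "z \<in> alg_spectrum a" for z
    using sp[OF that] assms by (intro winding_number_circlepath) simp
  moreover have "z \<notin> alg_spectrum a" if "z \<in> path_image (circlepath 0 r)" for z
    using that sp[of z] assms r by auto
  ultimately show ?thesis by (auto simp: surrounding_contour_def)
qed

text \<open>Integrate over a circle of large radius \<open>r\<close>. There the resolvent differs from \<open>1/z\<close> by \<open>a R(z)/z\<close>, and
this contributes at most a constant divided by \<open>r - norm a\<close>.\<close>

lemma fcalc_one:
  fixes a :: "'a::complex_banach_algebra"
  assumes D: "spectral_nbhd a \<Omega>"
  shows "fcalc \<Omega> (\<lambda>z. 1) a = 1"
proof -
  have U: "spectral_nbhd a UNIV" by (simp add: spectral_nbhd_def)
  have "fcalc UNIV (\<lambda>z. 1) a = 1"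
  proof (rule complex_functionals_separate)
    fix \<phi> :: "'a \<Rightarrow> complex" assume phi: "complex_functional \<phi>"
    then interpret bounded_linear \<phi> by (simp add: complex_functional_def)
    obtain K where K: "K > 0" "\<And>x. norm (\<phi> x) \<le> norm x * K" using pos_bounded by blast
    define d where "d = norm (2 * pi * \<i> * (\<phi> (fcalc UNIV (\<lambda>z. 1) a) - \<phi> 1))"
    define M where "M = 2 * pi * (norm a * norm (1 :: 'a) * K)"
    have M: "M \<ge> 0" using K(1) by (simp add: M_def)
    have le: "d * (r - norm a) \<le> M" if r: "r > norm a" for r
    proof -
      have r0: "r > 0" using r norm_ge_zero[of a] by linarith
      let ?F = "\<lambda>z. \<phi> (alg_resolvent a z)" and ?S = "{z. norm z > norm a}"
      have S: "?S \<inter> alg_spectrum a = {}" using alg_resolvent_large(1)[of a] by auto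
      have F: "?F holomorphic_on ?S" using holomorphic_functional_resolvent[OF phi S] .
      have oS: "open ?S" by (intro open_Collect_less continuous_intros)
      have G: "(\<lambda>z. \<phi> 1 / z) holomorphic_on ?S" by (intro holomorphic_intros) (use norm_ge_zero in force)
      have pS: "path_image (circlepath 0 r) \<subseteq> ?S" using r r0 by auto
      have iF: "?F contour_integrable_on circlepath 0 r" "(\<lambda>z. \<phi> 1 / z) contour_integrable_on circlepath 0 r"
        using contour_integrable_holomorphic_simple[OF F oS _ pS] contour_integrable_holomorphic_simple[OF G oS _ pS] by auto
      have "contour_integral (circlepath 0 r) ?F = 2 * pi * \<i> * \<phi> (fcalc UNIV (\<lambda>z. 1) a)"
        using fcalc_functional[OF U _ phi circlepath_surrounding[OF r], of "\<lambda>z. 1"] by simp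
      moreover have "contour_integral (circlepath 0 r) (\<lambda>z. \<phi> 1 / z) = 2 * pi * \<i> * \<phi> 1"
        using Cauchy_integral_circlepath_simple[of "\<lambda>z. \<phi> 1" 0 r 0] r0 by (simp add: contour_integral_unique)
      ultimately have "d = norm (contour_integral (circlepath 0 r) (\<lambda>z. ?F z - \<phi> 1 / z))"
        using contour_integral_diff[OF iF] by (simp add: d_def right_diff_distrib)
      also have "\<dots> \<le> (norm a * norm (1 :: 'a) * K / ((r - norm a) * r)) * (2 * pi * r)"
      proof (rule has_contour_integral_bound_circlepath[OF has_contour_integral_integral[OF contour_integrable_diff[OF iF]]])
        show "0 \<le> norm a * norm (1 :: 'a) * K / ((r - norm a) * r)" using r r0 K(1) by simp
        show "0 < r" by fact
        fix z :: complex assume "norm (z - 0) = r"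
        then have z: "norm z = r" "z \<noteq> 0" using r0 by auto
        let ?R = "alg_resolvent a z"
        have zs: "z \<notin> alg_spectrum a" and R: "norm ?R \<le> norm (1 :: 'a) / (r - norm a)"
          using alg_resolvent_large[of a z] z r by auto
        have "(z *\<^sub>C 1 - a) * ?R = 1" using inverse_pair_resolvent[OF zs] by (simp add: inverse_pair_def)
        then have "z *\<^sub>C ?R = 1 + a * ?R" by (simp add: left_diff_distrib scaleC_mult_left algebra_simps)
        then have "z * \<phi> ?R = \<phi> 1 + \<phi> (a * ?R)" using phi add by (metis complex_functional_def)
        then have "\<phi> ?R - \<phi> 1 / z = \<phi> (a * ?R) / z" using z(2) by (simp add: field_simps)
        then have "norm (\<phi> ?R - \<phi> 1 / z) = norm (\<phi> (a * ?R)) / r" by (simp add: norm_divide z)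
        also have "\<dots> \<le> (norm a * (norm (1 :: 'a) / (r - norm a)) * K) / r"
        proof (intro divide_right_mono)
          have "norm (\<phi> (a * ?R)) \<le> norm (a * ?R) * K" by (rule K(2))
          also have "\<dots> \<le> (norm a * norm ?R) * K" using K(1) by (intro mult_right_mono norm_mult_ineq) auto
          also have "\<dots> \<le> (norm a * (norm (1 :: 'a) / (r - norm a))) * K"
            using K(1) R by (intro mult_right_mono mult_left_mono) auto
          finally show "norm (\<phi> (a * ?R)) \<le> norm a * (norm (1 :: 'a) / (r - norm a)) * K" .
        qed (use r0 in simp)
        finally show "norm (\<phi> ?R - \<phi> 1 / z) \<le> norm a * norm (1 :: 'a) * K / ((r - norm a) * r)" by simp
      qed
      also have "\<dots> = M / (r - norm a)" using r0 r by (simp add: M_def)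
      finally show ?thesis using r by (simp add: field_simps)
    qed
    have "d = 0"
    proof (rule ccontr)
      assume "d \<noteq> 0"
      then have d: "d > 0" by (simp add: d_def)
      \<comment> \<open>a radius for which the bound \<open>le\<close> contradicts \<open>d > 0\<close>\<close>
      have "d * (M / d + 1) \<le> M" using le[of "norm a + (M / d + 1)"] M d by (simp add: add_nonneg_pos)
      then show False using d by (simp add: distrib_left)
    qed
    then show "\<phi> (fcalc UNIV (\<lambda>z. 1) a) = \<phi> 1" by (simp add: d_def)
  qed
  moreover have "fcalc UNIV (\<lambda>z. 1) a = fcalc \<Omega> (\<lambda>z. 1) a"
    by (rule fcalc_restrict[OF D U]) auto
  ultimately show ?thesis by simp
qed

lemma fcalc_const:
  assumes "spectral_nbhd a \<Omega>"
  shows "fcalc \<Omega> (\<lambda>z. c) a = c *\<^sub>C 1"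
  using fcalc_cmult[OF assms holomorphic_on_const, of c 1] fcalc_one[OF assms] by simp

text \<open>Follows from \<open>z R(z) = 1 + a R(z)\<close>, as the constant term has integral zero.\<close>

lemma fcalc_ident:
  fixes a :: "'a::complex_banach_algebra"
  assumes D: "spectral_nbhd a \<Omega>"
  shows "fcalc \<Omega> (\<lambda>z. z) a = a"
proof -
  obtain \<Gamma> where \<Gamma>: "surrounding_contour (alg_spectrum a) \<Omega> \<Gamma>" "cycle_in (\<Omega> - alg_spectrum a) \<Gamma>"
    using ex_spectral_contour[OF D] by blast
  show ?thesis
  proof (rule fcalc_eqI[OF D holomorphic_on_ident \<Gamma>(1)])
    fix \<phi> :: "'a \<Rightarrow> complex" assume phi: "complex_functional \<phi>"
    then interpret bounded_linear \<phi> by (simp add: complex_functional_def)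
    have "cycle_integral \<Gamma> (\<lambda>z. z * \<phi> (alg_resolvent a z)) = cycle_integral \<Gamma> (\<lambda>z. \<phi> 1 + 1 * \<phi> (a * alg_resolvent a z))"
    proof (rule cycle_integral_cong[OF \<Gamma>(2)])
      fix z assume z: "z \<in> \<Omega> - alg_spectrum a"
      then have "(z *\<^sub>C 1 - a) * alg_resolvent a z = 1"
        using inverse_pair_resolvent[of z a] by (simp add: inverse_pair_def)
      then have "z *\<^sub>C alg_resolvent a z = 1 + a * alg_resolvent a z"
        by (simp add: left_diff_distrib scaleC_mult_left algebra_simps)
      then show "z * \<phi> (alg_resolvent a z) = \<phi> 1 + 1 * \<phi> (a * alg_resolvent a z)"
        using phi add by (metis complex_functional_def mult_1_left)
    qed
    also have "\<dots> = cycle_integral \<Gamma> (\<lambda>z. \<phi> 1) + cycle_integral \<Gamma> (\<lambda>z. 1 * \<phi> (a * alg_resolvent a z))"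
      by (intro cycle_integral_add[OF \<Gamma>(2) spectral_nbhd_Diff[OF D]] holomorphic_intros
          holomorphic_functional_resolvent[OF complex_functional_compose(1)[OF phi]]) auto
    also have "cycle_integral \<Gamma> (\<lambda>z. \<phi> 1) = 0"
      by (rule Cauchy_theorem_cycle[of UNIV]) (use \<Gamma>(2) cycle_in_mono in auto)
    also have "cycle_integral \<Gamma> (\<lambda>z. 1 * \<phi> (a * alg_resolvent a z)) = 2 * pi * \<i> * \<phi> (a * fcalc \<Omega> (\<lambda>z. 1) a)"
      by (rule fcalc_functional[OF D _ complex_functional_compose(1)[OF phi] \<Gamma>(1), symmetric]) simp
    finally show "cycle_integral \<Gamma> (\<lambda>z. z * \<phi> (alg_resolvent a z)) = 2 * pi * \<i> * \<phi> a"
      by (simp add: fcalc_one[OF D])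
  qed
qed

lemma fcalc_diff_const:
  assumes D: "spectral_nbhd a \<Omega>" and f: "f holomorphic_on \<Omega>"
  shows "fcalc \<Omega> (\<lambda>z. f z - c) a = fcalc \<Omega> f a - c *\<^sub>C 1"
  using fcalc_add[OF D f holomorphic_on_const, of "- c"] fcalc_const[OF D, of "- c"]
  by simp

lemma fcalc_shift_power_mult:
  assumes D: "spectral_nbhd a \<Omega>" and f: "f holomorphic_on \<Omega>"
  shows "fcalc \<Omega> (\<lambda>z. (z - c) ^ n * f z) a = (a - c *\<^sub>C 1) ^ n * fcalc \<Omega> f a"
proof (induction n)
  case (Suc n)
  have "fcalc \<Omega> (\<lambda>z. (z - c) * ((z - c) ^ n * f z)) a =
      fcalc \<Omega> (\<lambda>z. z - c) a * fcalc \<Omega> (\<lambda>z. (z - c) ^ n * f z) a"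
    by (intro fcalc_mult[OF D] holomorphic_intros f)
  also have "fcalc \<Omega> (\<lambda>z. z - c) a = a - c *\<^sub>C 1"
    using fcalc_diff_const[OF D holomorphic_on_ident] fcalc_ident[OF D] by simp
  finally show ?case using Suc by (simp add: mult.assoc)
qed simp

lemma fcalc_power:
  assumes D: "spectral_nbhd a \<Omega>" and f: "f holomorphic_on \<Omega>"
  shows "fcalc \<Omega> (\<lambda>z. f z ^ n) a = fcalc \<Omega> f a ^ n"
proof (induction n)
  case (Suc n)
  then show ?case using fcalc_mult[OF D f holomorphic_on_power[OF f, of n]] by simp
qed (simp add: fcalc_one[OF D])

text \<open>The reciprocal of \<open>f\<close> is holomorphic on a smaller neighbourhood of the spectrum only, on which \<open>f(a)\<close>
is unchanged.\<close>

lemma fcalc_inverse_pair: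
  assumes D: "spectral_nbhd a \<Omega>" and f: "f holomorphic_on \<Omega>"
    and nz: "\<And>z. z \<in> alg_spectrum a \<Longrightarrow> f z \<noteq> 0"
  shows "\<exists>b. inverse_pair (fcalc \<Omega> f a) b"
proof -
  define \<Omega>' where "\<Omega>' = {z \<in> \<Omega>. f z \<noteq> 0}"
  have "open \<Omega>'" unfolding \<Omega>'_def
    using D f continuous_open_preimage[of \<Omega> f "- {0}"]
    by (auto simp: spectral_nbhd_def holomorphic_on_imp_continuous_on vimage_def Int_def)
  then have D': "spectral_nbhd a \<Omega>'" using D nz by (auto simp: spectral_nbhd_def \<Omega>'_def)
  have sub: "\<Omega>' \<subseteq> \<Omega>" by (auto simp: \<Omega>'_def)
  have f': "f holomorphic_on \<Omega>'" using f sub by (rule holomorphic_on_subset)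
  have g: "(\<lambda>z. 1 / f z) holomorphic_on \<Omega>'" by (intro holomorphic_intros f') (auto simp: \<Omega>'_def)
  have one: "fcalc \<Omega>' (\<lambda>z. f z * (1 / f z)) a = 1" "fcalc \<Omega>' (\<lambda>z. 1 / f z * f z) a = 1"
    unfolding fcalc_one[OF D', symmetric]
    by (rule fcalc_cong[OF D' holomorphic_on_const, symmetric]; simp add: \<Omega>'_def)+
  have "inverse_pair (fcalc \<Omega>' f a) (fcalc \<Omega>' (\<lambda>z. 1 / f z) a)"
    unfolding inverse_pair_def using one fcalc_mult[OF D' f' g] fcalc_mult[OF D' g f'] by simp
  moreover have "fcalc \<Omega> f a = fcalc \<Omega>' f a" by (rule fcalc_restrict[OF D' D sub f]) simp
  ultimately show ?thesis by auto
qed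

lemma banach_contour_integral_bound:
  fixes F :: "complex \<Rightarrow> 'a::complex_banach"
  assumes \<gamma>: "valid_path \<gamma>" "continuous_on {0..1} (\<lambda>t. vector_derivative \<gamma> (at t))"
    and F: "continuous_on (path_image \<gamma>) F"
    and B: "\<And>t. t \<in> {0..1} \<Longrightarrow> norm (vector_derivative \<gamma> (at t) *\<^sub>C F (\<gamma> t)) \<le> B"
  shows "norm (banach_contour_integral \<gamma> F) \<le> B"
proof -
  have g: "continuous_on {0..1} \<gamma>"
    using \<gamma>(1) by (simp add: valid_path_def piecewise_C1_differentiable_on_def)
  have "banach_contour_integral \<gamma> F = integral {0..1} (\<lambda>t. vector_derivative \<gamma> (at t) *\<^sub>C F (\<gamma> t))"
    unfolding banach_contour_integral_def
  proof (rule integral_spike[of "{0, 1}"])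
    fix t :: real assume "t \<in> {0..1} - {0, 1}"
    then have "t \<in> interior {0..1}" by auto
    then show "vector_derivative \<gamma> (at t) *\<^sub>C F (\<gamma> t) = vector_derivative \<gamma> (at t within {0..1}) *\<^sub>C F (\<gamma> t)"
      by (simp only: at_within_interior)
  qed simp
  also have "norm \<dots> \<le> B * (1 - 0)"
    using B by (intro integral_bound continuous_intros \<gamma>(2) continuous_on_compose2[OF F g])
      (auto simp: path_image_def)
  finally show ?thesis by simp
qed

text \<open>Along a continuously differentiable contour the resolvent and the speed of the curve are bounded.\<close>

lemma fcalc_bound:
  fixes a :: "'a::complex_banach_algebra"
  assumes D: "spectral_nbhd a \<Omega>"
  shows "\<exists>C\<ge>0. \<forall>f B. f holomorphic_on \<Omega> \<and> (\<forall>z\<in>\<Omega>. norm (f z) \<le> B) \<longrightarrow> norm (fcalc \<Omega> f a) \<le> C * B"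
proof -
  let ?\<sigma> = "alg_spectrum a" and ?R = "alg_resolvent a"
  obtain \<Gamma> where \<Gamma>: "surrounding_contour ?\<sigma> \<Omega> \<Gamma>" "C1_cycle \<Gamma>" "cycle_in (\<Omega> - ?\<sigma>) \<Gamma>"
    using ex_spectral_contour[OF D] by blast
  let ?I = "\<lambda>f. \<Sum>\<gamma>\<leftarrow>\<Gamma>. banach_contour_integral \<gamma> (\<lambda>z. f z *\<^sub>C ?R z)"
  have eq: "fcalc \<Omega> f a = (1 / (2 * of_real pi * \<i>)) *\<^sub>C ?I f" if f: "f holomorphic_on \<Omega>" for f
  proof (rule fcalc_eqI[OF D f \<Gamma>(1)])
    fix \<phi> :: "'a \<Rightarrow> complex" assume phi: "complex_functional \<phi>"
    show "cycle_integral \<Gamma> (\<lambda>z. f z * \<phi> (?R z)) = 2 * pi * \<i> * \<phi> ((1 / (2 * of_real pi * \<i>)) *\<^sub>C ?I f)"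
      using functional_sum_list_integrals[OF D f phi \<Gamma>(3)] phi by (simp add: complex_functional_def)
  qed
  have "\<exists>C\<ge>0. \<forall>f B. f holomorphic_on \<Omega> \<and> (\<forall>z\<in>\<Omega>. norm (f z) \<le> B) \<longrightarrow> norm (?I f) \<le> C * B"
    using \<Gamma>(2,3)
  proof (induction \<Gamma>)
    case Nil
    show ?case by (intro exI[of _ 0]) simp
  next
    case (Cons \<gamma> \<Gamma>)
    then obtain C where C: "C \<ge> 0" "\<And>f B. f holomorphic_on \<Omega> \<Longrightarrow> (\<forall>z\<in>\<Omega>. norm (f z) \<le> B) \<Longrightarrow>
        norm (\<Sum>\<gamma>\<leftarrow>\<Gamma>. banach_contour_integral \<gamma> (\<lambda>z. f z *\<^sub>C ?R z)) \<le> C * B"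
      by (auto simp: C1_cycle_def)
    have g: "valid_path \<gamma>" "continuous_on {0..1} (\<lambda>t. vector_derivative \<gamma> (at t))" "path_image \<gamma> \<subseteq> \<Omega> - ?\<sigma>"
      using Cons.prems by (auto simp: C1_cycle_def)
    then have gc: "continuous_on {0..1} \<gamma>" by (simp add: valid_path_def piecewise_C1_differentiable_on_def)
    have cR: "continuous_on (path_image \<gamma>) ?R"
      using g(3) by (intro continuous_on_subset[OF continuous_on_alg_resolvent]) auto
    have "continuous_on {0..1} (\<lambda>t. vector_derivative \<gamma> (at t) *\<^sub>C ?R (\<gamma> t))"
      by (intro continuous_intros g(2) continuous_on_compose2[OF cR gc]) (auto simp: path_image_def)
    then have "bounded ((\<lambda>t. vector_derivative \<gamma> (at t) *\<^sub>C ?R (\<gamma> t)) ` {0..1})"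
      by (intro compact_imp_bounded compact_continuous_image) auto
    then obtain M where M: "M > 0" "\<And>t. t \<in> {0..1} \<Longrightarrow> norm (vector_derivative \<gamma> (at t) *\<^sub>C ?R (\<gamma> t)) \<le> M"
      unfolding bounded_pos by auto
    have "norm (\<Sum>\<gamma>\<leftarrow>\<gamma> # \<Gamma>. banach_contour_integral \<gamma> (\<lambda>z. f z *\<^sub>C ?R z)) \<le> (M + C) * B"
      if f: "f holomorphic_on \<Omega>" and B: "\<forall>z\<in>\<Omega>. norm (f z) \<le> B" for f B
    proof -
      have "norm (banach_contour_integral \<gamma> (\<lambda>z. f z *\<^sub>C ?R z)) \<le> B * M"
      proof (rule banach_contour_integral_bound[OF g(1,2)])
        show "continuous_on (path_image \<gamma>) (\<lambda>z. f z *\<^sub>C ?R z)"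
          using g(3) by (intro continuous_intros cR continuous_on_subset[OF holomorphic_on_imp_continuous_on[OF f]]) auto
        fix t :: real assume t: "t \<in> {0..1}"
        have "\<gamma> t \<in> path_image \<gamma>" using t by (simp add: path_image_def)
        then have "\<gamma> t \<in> \<Omega>" using g(3) by blast
        then have "norm (f (\<gamma> t)) * norm (vector_derivative \<gamma> (at t) *\<^sub>C ?R (\<gamma> t)) \<le> B * M"
          using B M(2)[OF t] by (intro mult_mono) (auto intro: order_trans[OF norm_ge_zero])
        then show "norm (vector_derivative \<gamma> (at t) *\<^sub>C f (\<gamma> t) *\<^sub>C ?R (\<gamma> t)) \<le> B * M"
          by (simp add: norm_scaleC norm_mult mult_ac)
      qed
      then have "norm (banach_contour_integral \<gamma> (\<lambda>z. f z *\<^sub>C ?R z) + (\<Sum>\<gamma>\<leftarrow>\<Gamma>. banach_contour_integral \<gamma> (\<lambda>z. f z *\<^sub>C ?R z))) \<le> B * M + C * B"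
        by (intro norm_triangle_mono C(2)[OF f B])
      then show ?thesis by (simp add: distrib_right mult.commute[of B M])
    qed
    then show ?case using C(1) M(1) by (intro exI[of _ "M + C"]) auto
  qed
  then obtain C where C: "C \<ge> 0" "\<And>f B. f holomorphic_on \<Omega> \<Longrightarrow> (\<forall>z\<in>\<Omega>. norm (f z) \<le> B) \<Longrightarrow> norm (?I f) \<le> C * B"
    by blast
  have "norm (fcalc \<Omega> f a) \<le> C * B" if f: "f holomorphic_on \<Omega>" and B: "\<forall>z\<in>\<Omega>. norm (f z) \<le> B" for f B
  proof -
    have "norm (fcalc \<Omega> f a) = 1 / (2 * pi) * norm (?I f)"
      by (simp add: eq[OF f] norm_scaleC norm_divide norm_mult)
    also have "\<dots> \<le> 1 * norm (?I f)" using pi_gt3 by (intro mult_right_mono) auto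
    also have "\<dots> \<le> C * B" using C(2)[OF f B] by simp
    finally show ?thesis .
  qed
  with C(1) show ?thesis by blast
qed

text \<open>The spectral radius formula in the form in which it is used: apply \<open>fcalc_bound\<close> to \<open>(z - c)\<^sup>n\<close>
on the disc.\<close>

lemma power_bound_of_spectrum:
  fixes a :: "'a::complex_banach_algebra"
  assumes "alg_spectrum a \<subseteq> ball c e"
  shows "\<exists>C\<ge>0. \<forall>n. norm ((a - c *\<^sub>C 1) ^ n) \<le> C * e ^ n"
proof -
  have D: "spectral_nbhd a (ball c e)" using assms by (simp add: spectral_nbhd_def)
  obtain C where C: "C \<ge> 0" "\<And>f B. f holomorphic_on ball c e \<Longrightarrow> (\<forall>z\<in>ball c e. norm (f z) \<le> B) \<Longrightarrow>
      norm (fcalc (ball c e) f a) \<le> C * B"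
    using fcalc_bound[OF D] by blast
  have "norm ((a - c *\<^sub>C 1) ^ n) \<le> C * e ^ n" for n
  proof -
    have "fcalc (ball c e) (\<lambda>z. (z - c) ^ n * 1) a = (a - c *\<^sub>C 1) ^ n * 1"
      using fcalc_shift_power_mult[OF D holomorphic_on_const] fcalc_one[OF D] by metis
    moreover have "norm (fcalc (ball c e) (\<lambda>z. (z - c) ^ n * 1) a) \<le> C * e ^ n"
      by (intro C(2) holomorphic_intros)
        (auto simp: norm_power dist_norm norm_minus_commute intro!: power_mono)
    ultimately show ?thesis by simp
  qed
  with C(1) show ?thesis by blast
qed

lemma spectrum_of_power_bound:
  fixes a :: "'a::complex_banach_algebra"
  assumes "\<And>n. norm (a ^ n) \<le> C * e ^ n" "0 \<le> e"
  shows "alg_spectrum a \<subseteq> cball 0 e"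
proof
  fix z assume z: "z \<in> alg_spectrum a"
  show "z \<in> cball 0 e"
  proof (rule ccontr)
    assume "z \<notin> cball 0 e"
    then have ze: "norm z > e" "z \<noteq> 0" using assms(2) by auto
    let ?b = "inverse z *\<^sub>C a"
    have pow: "?b ^ n = inverse z ^ n *\<^sub>C a ^ n" for n
      by (induction n) (simp_all add: scaleC_one scaleC_mult_left mult_scaleC_right scaleC_scaleC mult.commute)
    have "norm (?b ^ n) \<le> C * (e / norm z) ^ n" for n
    proof -
      have "norm (?b ^ n) = norm (a ^ n) / norm z ^ n"
        by (simp add: pow norm_scaleC norm_power norm_inverse divide_inverse power_inverse mult.commute)
      also have "\<dots> \<le> C * e ^ n / norm z ^ n" by (intro divide_right_mono assms(1)) simp
      finally show ?thesis by (simp add: power_divide)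
    qed
    then have "summable (\<lambda>n. norm (?b ^ n))"
      using ze assms(2) by (intro summable_powers_of_bound[of _ C "e / norm z"]) (auto simp: divide_less_eq)
    then have b: "inverse_pair (1 - ?b) (\<Sum>n. ?b ^ n)" by (rule inverse_pair_geometric)
    have e: "z *\<^sub>C 1 - a = z *\<^sub>C (1 - ?b)"
      using ze(2) by (simp add: complex_vector.scale_right_diff_distrib scaleC_scaleC scaleC_one)
    have "inverse_pair (z *\<^sub>C 1 - a) (inverse z *\<^sub>C (\<Sum>n. ?b ^ n))"
      unfolding e inverse_pair_def using b ze(2)
      by (simp add: inverse_pair_def scaleC_mult_left mult_scaleC_right scaleC_scaleC scaleC_one)
    then show False using z not_in_alg_spectrum by blast
  qed
qed

section \<open>The Banach algebra of complex-linear operators\<close>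

text \<open>A separate type for the bounded complex-linear operators makes the preceding sections available,
which work with a type class of algebras.\<close>

typedef (overloaded) 'a cop = "{A :: 'a::complex_banach \<Rightarrow>\<^sub>L 'a. complex_linear A}"
  morphisms blinfun_of_cop Cop
  by (rule exI[of _ 0]) (simp add: complex_linear_def)

setup_lifting type_definition_cop

instantiation cop :: (complex_banach) real_normed_vector
begin

lift_definition zero_cop :: "'a cop" is 0
  by (simp add: complex_linear_def)
lift_definition plus_cop :: "'a cop \<Rightarrow> 'a cop \<Rightarrow> 'a cop" is "(+)"
  by (simp add: complex_linear_def blinfun.add_left scaleC_add_right)
lift_definition minus_cop :: "'a cop \<Rightarrow> 'a cop \<Rightarrow> 'a cop" is "(-)"
  by (simp add: complex_linear_def blinfun.diff_left complex_vector.scale_right_diff_distrib)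
lift_definition uminus_cop :: "'a cop \<Rightarrow> 'a cop" is uminus
  by (simp add: complex_linear_def blinfun.minus_left)
lift_definition scaleR_cop :: "real \<Rightarrow> 'a cop \<Rightarrow> 'a cop" is scaleR
  by (simp add: complex_linear_def blinfun.scaleR_left scaleC_of_real[symmetric] scaleC_scaleC mult.commute)
lift_definition norm_cop :: "'a cop \<Rightarrow> real" is norm .
definition dist_cop :: "'a cop \<Rightarrow> 'a cop \<Rightarrow> real" where "dist_cop A B = norm (A - B)"
definition sgn_cop :: "'a cop \<Rightarrow> 'a cop" where "sgn_cop A = scaleR (inverse (norm A)) A"
definition uniformity_cop :: "('a cop \<times> 'a cop) filter" where
  "uniformity_cop = (INF e\<in>{0<..}. principal {(x, y). dist x y < e})"
definition open_cop :: "'a cop set \<Rightarrow> bool" where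
  "open_cop U \<longleftrightarrow> (\<forall>x\<in>U. eventually (\<lambda>(x', y). x' = x \<longrightarrow> y \<in> U) uniformity)"

instance
proof
  fix A B C :: "'a cop" and r s :: real
  show "A + B + C = A + (B + C)" by transfer (simp add: add.assoc)
  show "A + B = B + A" by transfer (simp add: add.commute)
  show "0 + A = A" by transfer simp
  show "- A + A = 0" by transfer simp
  show "A - B = A + - B" by transfer simp
  show "r *\<^sub>R (A + B) = r *\<^sub>R A + r *\<^sub>R B" by transfer (simp add: scaleR_add_right)
  show "(r + s) *\<^sub>R A = r *\<^sub>R A + s *\<^sub>R A" by transfer (simp add: scaleR_add_left)
  show "r *\<^sub>R s *\<^sub>R A = (r * s) *\<^sub>R A" by transfer simp
  show "1 *\<^sub>R A = A" by transfer simp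
  show "norm A = 0 \<longleftrightarrow> A = 0" by transfer simp
  show "norm (A + B) \<le> norm A + norm B" by transfer (rule norm_triangle_ineq)
  show "norm (r *\<^sub>R A) = \<bar>r\<bar> * norm A" by transfer simp
qed (simp_all add: dist_cop_def sgn_cop_def uniformity_cop_def open_cop_def)

end

definition cop_apply :: "'a::complex_banach cop \<Rightarrow> 'a \<Rightarrow> 'a" where
  "cop_apply A = blinfun_apply (blinfun_of_cop A)"

lemma cop_eqI: "(\<And>x. cop_apply A x = cop_apply B x) \<Longrightarrow> A = B"
  unfolding cop_apply_def by (metis blinfun_eqI blinfun_of_cop_inject)

lemma bounded_linear_cop_apply: "bounded_linear (cop_apply A)"
  unfolding cop_apply_def by (rule blinfun.bounded_linear_right)

lemma cop_apply_scaleC_right: "cop_apply A (c *\<^sub>C x) = c *\<^sub>C cop_apply A x"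
  using blinfun_of_cop[of A] by (simp add: cop_apply_def complex_linear_def)

lemma norm_cop_apply: "norm (cop_apply A x) \<le> norm A * norm x"
  unfolding cop_apply_def norm_cop.rep_eq by (rule norm_blinfun)

lemma norm_cop_bound: "0 \<le> K \<Longrightarrow> (\<And>x. norm (cop_apply A x) \<le> K * norm x) \<Longrightarrow> norm A \<le> K"
  unfolding cop_apply_def norm_cop.rep_eq by (intro norm_blinfun_bound)

lemma ex_cop:
  assumes "\<And>x y. f (x + y) = f x + f y" "\<And>c x. f (c *\<^sub>C x) = c *\<^sub>C f x" "\<And>x. norm (f x) \<le> K * norm x"
  shows "\<exists>A. cop_apply A = f"
proof -
  have bl: "bounded_linear f"
    by (rule bounded_linear_intro[where K = K])
      (use assms in \<open>auto simp: scaleC_of_real[symmetric] mult.commute\<close>)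
  have "complex_linear (Blinfun f)"
    using assms(2) by (simp add: complex_linear_def bounded_linear_Blinfun_apply[OF bl])
  then show ?thesis
    by (intro exI[of _ "Cop (Blinfun f)"])
      (simp add: cop_apply_def Cop_inverse bounded_linear_Blinfun_apply[OF bl])
qed

lemma bounded_linear_blinfun_of_cop: "bounded_linear blinfun_of_cop"
  by (rule bounded_linear_intro[where K = 1])
    (simp_all add: plus_cop.rep_eq scaleR_cop.rep_eq norm_cop.rep_eq)

instance cop :: (complex_banach) banach
proof
  fix X :: "nat \<Rightarrow> 'a cop" assume "Cauchy X"
  then have "Cauchy (\<lambda>n. blinfun_of_cop (X n))"
    unfolding Cauchy_def by (simp add: dist_norm norm_cop.rep_eq minus_cop.rep_eq)
  then obtain L where L: "(\<lambda>n. blinfun_of_cop (X n)) \<longlonglongrightarrow> L"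
    by (auto simp: Cauchy_convergent_iff convergent_def)
  have "complex_linear L"
    unfolding complex_linear_def
  proof (intro allI)
    fix c x
    have "(\<lambda>n. blinfun_of_cop (X n) (c *\<^sub>C x)) \<longlonglongrightarrow> L (c *\<^sub>C x)"
      by (intro blinfun.tendsto L tendsto_const)
    moreover have "(\<lambda>n. c *\<^sub>C blinfun_of_cop (X n) x) \<longlonglongrightarrow> c *\<^sub>C L x"
      by (intro tendsto_scaleC blinfun.tendsto L tendsto_const)
    moreover have "blinfun_of_cop (X n) (c *\<^sub>C x) = c *\<^sub>C blinfun_of_cop (X n) x" for n
      using cop_apply_scaleC_right[of "X n"] by (simp add: cop_apply_def)
    ultimately show "L (c *\<^sub>C x) = c *\<^sub>C L x" using LIMSEQ_unique by fastforce
  qed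
  then have "X \<longlonglongrightarrow> Cop L"
    using L by (simp add: LIMSEQ_iff norm_cop.rep_eq minus_cop.rep_eq Cop_inverse)
  then show "convergent X" by (auto simp: convergent_def)
qed

instantiation cop :: (complex_banach) complex_banach_algebra
begin

lift_definition one_cop :: "'a cop" is id_blinfun
  by (simp add: complex_linear_def)
lift_definition times_cop :: "'a cop \<Rightarrow> 'a cop \<Rightarrow> 'a cop" is blinfun_compose
  by (simp add: complex_linear_def)
lift_definition scaleC_cop :: "complex \<Rightarrow> 'a cop \<Rightarrow> 'a cop" is "\<lambda>c A. scalar_op c o\<^sub>L A"
  by (simp add: complex_linear_def scaleC_scaleC mult.commute)

lemma cop_apply_simps [simp]:
  "cop_apply 0 x = 0" "cop_apply 1 x = x" "cop_apply (A + B) x = cop_apply A x + cop_apply B x"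
  "cop_apply (A - B) x = cop_apply A x - cop_apply B x" "cop_apply (- A) x = - cop_apply A x"
  "cop_apply (r *\<^sub>R A) x = r *\<^sub>R cop_apply A x" "cop_apply (c *\<^sub>C A) x = c *\<^sub>C cop_apply A x"
  "cop_apply (A * B) x = cop_apply A (cop_apply B x)"
  by (simp_all add: cop_apply_def zero_cop.rep_eq one_cop.rep_eq plus_cop.rep_eq minus_cop.rep_eq
      uminus_cop.rep_eq scaleR_cop.rep_eq scaleC_cop.rep_eq times_cop.rep_eq
      blinfun.add_left blinfun.diff_left blinfun.minus_left blinfun.scaleR_left)

lemma cop_apply_right_simps [simp]:
  "cop_apply A 0 = 0" "cop_apply A (x + y) = cop_apply A x + cop_apply A y"
  "cop_apply A (x - y) = cop_apply A x - cop_apply A y" "cop_apply A (- x) = - cop_apply A x"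
  "cop_apply A (r *\<^sub>R x) = r *\<^sub>R cop_apply A x" "cop_apply A (c *\<^sub>C x) = c *\<^sub>C cop_apply A x"
  using cop_apply_scaleC_right[of A c x]
  by (simp_all add: cop_apply_def blinfun.add_right blinfun.diff_right blinfun.minus_right blinfun.scaleR_right)

instance
proof
  fix A B C :: "'a cop" and c d :: complex and r :: real
  show "A * B * C = A * (B * C)" "(A + B) * C = A * C + B * C" "A * (B + C) = A * B + A * C"
    "1 * A = A" "A * 1 = A" "r *\<^sub>R A * B = r *\<^sub>R (A * B)" "A * r *\<^sub>R B = r *\<^sub>R (A * B)"
    "c *\<^sub>C (A + B) = c *\<^sub>C A + c *\<^sub>C B" "(c + d) *\<^sub>C A = c *\<^sub>C A + d *\<^sub>C A"
    "c *\<^sub>C d *\<^sub>C A = (c * d) *\<^sub>C A" "complex_of_real r *\<^sub>C A = r *\<^sub>R A"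
    "c *\<^sub>C A * B = c *\<^sub>C (A * B)" "A * c *\<^sub>C B = c *\<^sub>C (A * B)"
    by (rule cop_eqI; simp add: scaleC_add_right scaleC_add_left scaleC_scaleC scaleC_of_real)+
  show "norm (A * B) \<le> norm A * norm B"
    unfolding norm_cop.rep_eq times_cop.rep_eq by (rule norm_blinfun_compose)
  have le: "norm (c *\<^sub>C A) \<le> norm c * norm A" for c :: complex and A :: "'a cop"
  proof (rule norm_cop_bound)
    show "norm (cop_apply (c *\<^sub>C A) x) \<le> norm c * norm A * norm x" for x
      using mult_left_mono[OF norm_cop_apply[of A x], of "norm c"] by (simp add: norm_scaleC mult.assoc)
  qed simp
  show "norm (c *\<^sub>C A) = norm c * norm A"
  proof (cases "c = 0")
    case True
    have "0 *\<^sub>C A = 0" by (rule cop_eqI) simp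
    then show ?thesis using True by simp
  next
    case False
    have "inverse c *\<^sub>C c *\<^sub>C A = A" using False by (intro cop_eqI) (simp add: scaleC_scaleC scaleC_one)
    then have "norm A \<le> inverse (norm c) * norm (c *\<^sub>C A)"
      using le[of "inverse c" "c *\<^sub>C A"] by (simp only: norm_inverse)
    then have "norm c * norm A \<le> norm (c *\<^sub>C A)" using False by (simp add: field_simps)
    with le[of c A] show ?thesis by simp
  qed
qed

end

lemma cop_apply_power: "cop_apply (A ^ n) x = (cop_apply A ^^ n) x"
  by (induction n) simp_all

lemma blinfun_of_cop_scaleC: "blinfun_of_cop (c *\<^sub>C A) = scalar_op c o\<^sub>L blinfun_of_cop A"
  by (rule scaleC_cop.rep_eq)

lemma scalar_op_conv: "scalar_op c = blinfun_of_cop (c *\<^sub>C 1)"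
  by (rule blinfun_eqI) (simp add: blinfun_of_cop_scaleC one_cop.rep_eq)

lemma inverse_of_complex_linear:
  assumes "complex_linear A" "A o\<^sub>L B = id_blinfun" "B o\<^sub>L A = id_blinfun"
  shows "complex_linear B"
  unfolding complex_linear_def
proof (intro allI)
  fix c x
  have AB: "A (B y) = y" and BA: "B (A y) = y" for y
    using arg_cong[OF assms(2), of "\<lambda>F. blinfun_apply F y"] arg_cong[OF assms(3), of "\<lambda>F. blinfun_apply F y"]
    by simp_all
  have "B (c *\<^sub>C x) = B (c *\<^sub>C A (B x))" by (simp add: AB)
  also have "\<dots> = B (A (c *\<^sub>C B x))" using assms(1) by (simp add: complex_linear_def)
  finally show "B (c *\<^sub>C x) = c *\<^sub>C B x" by (simp add: BA)
qed

lemma is_inverse_op_cop: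
  "is_inverse_op (blinfun_of_cop A) (blinfun_of_cop b) \<longleftrightarrow> inverse_pair A b"
  unfolding is_inverse_op_def inverse_pair_def one_cop.rep_eq[symmetric] times_cop.rep_eq[symmetric]
    blinfun_of_cop_inject ..

lemma is_inverse_op_iff:
  "is_inverse_op (blinfun_of_cop A) B \<longleftrightarrow> (\<exists>b. B = blinfun_of_cop b \<and> inverse_pair A b)"
proof
  assume B: "is_inverse_op (blinfun_of_cop A) B"
  have "complex_linear (blinfun_of_cop A)" using blinfun_of_cop[of A] by (simp only: mem_Collect_eq)
  then have "complex_linear B"
    using B unfolding is_inverse_op_def by (elim conjE) (rule inverse_of_complex_linear)
  then have "B = blinfun_of_cop (Cop B)" by (simp add: Cop_inverse)
  then obtain b where b: "B = blinfun_of_cop b" ..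
  with B show "\<exists>b. B = blinfun_of_cop b \<and> inverse_pair A b" using is_inverse_op_cop by blast
qed (use is_inverse_op_cop in blast)

lemma scalar_op_minus_cop: "scalar_op z - blinfun_of_cop A = blinfun_of_cop (z *\<^sub>C 1 - A)"
  by (simp add: scalar_op_conv minus_cop.rep_eq)

lemma spectrum_cop: "spectrum (blinfun_of_cop A) = alg_spectrum A"
  unfolding spectrum_def alg_spectrum_def scalar_op_minus_cop is_inverse_op_iff by blast

lemma resolvent_cop:
  assumes "z \<notin> alg_spectrum A"
  shows "resolvent (blinfun_of_cop A) z = blinfun_of_cop (alg_resolvent A z)"
  unfolding resolvent_def scalar_op_minus_cop is_inverse_op_iff
  using inverse_pair_resolvent[OF assms] inverse_pair_unique by (intro the_equality) blast+

text \<open>The embedding of the complex-linear operators into all bounded operators is bounded and linear and hence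
commutes with the integrals; both sides use the same contour.\<close>

lemma riesz_dunford_cop:
  assumes D: "spectral_nbhd A \<Omega>" and f: "f holomorphic_on \<Omega>"
  shows "riesz_dunford \<Omega> f (blinfun_of_cop A) = blinfun_of_cop (fcalc \<Omega> f A)"
proof -
  interpret bounded_linear blinfun_of_cop by (rule bounded_linear_blinfun_of_cop)
  define \<Gamma> where "\<Gamma> = (SOME \<Gamma>. surrounding_contour (alg_spectrum A) \<Omega> \<Gamma>)"
  have "\<exists>\<Gamma>. surrounding_contour (alg_spectrum A) \<Omega> \<Gamma>" using ex_spectral_contour[OF D] by blast
  then have "surrounding_contour (alg_spectrum A) \<Omega> \<Gamma>" unfolding \<Gamma>_def by (rule someI_ex)
  then have \<Gamma>: "cycle_in (\<Omega> - alg_spectrum A) \<Gamma>" by (simp add: surrounding_contour_iff)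
  have one: "op_contour_integral \<gamma> (\<lambda>z. scalar_op (f z) o\<^sub>L resolvent (blinfun_of_cop A) z) =
      blinfun_of_cop (banach_contour_integral \<gamma> (\<lambda>z. f z *\<^sub>C alg_resolvent A z))" if "\<gamma> \<in> set \<Gamma>" for \<gamma>
  proof -
    have g: "valid_path \<gamma>" "path_image \<gamma> \<subseteq> \<Omega> - alg_spectrum A" using \<Gamma> that by (auto simp: cycle_in_def)
    let ?F = "\<lambda>z. f z *\<^sub>C alg_resolvent A z"
    have "weakly_holomorphic ?F (\<Omega> - alg_spectrum A)"
      by (intro weakly_holomorphic_scaleC weakly_holomorphic_subset[OF weakly_holomorphic_resolvent]
          holomorphic_on_subset[OF f]) auto
    then have i: "(\<lambda>t. vector_derivative \<gamma> (at t within {0..1}) *\<^sub>C ?F (\<gamma> t)) integrable_on {0..1}"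
      by (rule weakly_holomorphic_contour_integrable[OF g spectral_nbhd_Diff[OF D]])
    have "op_contour_integral \<gamma> (\<lambda>z. scalar_op (f z) o\<^sub>L resolvent (blinfun_of_cop A) z) =
        integral {0..1} (blinfun_of_cop \<circ> (\<lambda>t. vector_derivative \<gamma> (at t within {0..1}) *\<^sub>C ?F (\<gamma> t)))"
      unfolding op_contour_integral_def
    proof (rule integral_cong)
      fix t :: real assume "t \<in> {0..1}"
      then have "\<gamma> t \<in> path_image \<gamma>" by (simp add: path_image_def)
      then have "\<gamma> t \<notin> alg_spectrum A" using g(2) by blast
      then show "scalar_op (vector_derivative \<gamma> (at t within {0..1})) o\<^sub>L
            (scalar_op (f (\<gamma> t)) o\<^sub>L resolvent (blinfun_of_cop A) (\<gamma> t)) =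
          (blinfun_of_cop \<circ> (\<lambda>t. vector_derivative \<gamma> (at t within {0..1}) *\<^sub>C ?F (\<gamma> t))) t"
        by (simp add: resolvent_cop blinfun_of_cop_scaleC del: complex_vector.scale_scale)
    qed
    also have "\<dots> = blinfun_of_cop (banach_contour_integral \<gamma> ?F)"
      unfolding banach_contour_integral_def by (rule integral_linear[OF i bounded_linear_blinfun_of_cop])
    finally show ?thesis .
  qed
  have "(\<Sum>\<gamma>\<leftarrow>\<Gamma>. op_contour_integral \<gamma> (\<lambda>z. scalar_op (f z) o\<^sub>L resolvent (blinfun_of_cop A) z)) =
      blinfun_of_cop (\<Sum>\<gamma>\<leftarrow>\<Gamma>. banach_contour_integral \<gamma> (\<lambda>z. f z *\<^sub>C alg_resolvent A z))"
    using one
  proof (induction \<Gamma>)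
    case (Cons \<gamma> \<Gamma>)
    then show ?case by (simp add: add)
  qed (simp add: zero)
  then show ?thesis
    by (simp add: riesz_dunford_def fcalc_def spectrum_cop \<Gamma>_def[symmetric] blinfun_of_cop_scaleC)
qed

definition eigenvalues :: "'a::complex_banach cop \<Rightarrow> complex set" where
  "eigenvalues A = {\<mu>. \<exists>x. x \<noteq> 0 \<and> cop_apply A x = \<mu> *\<^sub>C x}"

text \<open>The root space before taking the closure. Working with it avoids all questions about closures of
sums of subspaces.\<close>

definition alg_root_space :: "'a::complex_banach cop \<Rightarrow> complex \<Rightarrow> 'a set" where
  "alg_root_space A \<mu> = {x. \<exists>n. cop_apply ((A - \<mu> *\<^sub>C 1) ^ n) x = 0}"

lemma point_spectrum_cop: "point_spectrum (blinfun_of_cop A) = eigenvalues A"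
  by (simp add: point_spectrum_def eigenvalues_def cop_apply_def)

lemma root_space_cop: "root_space (blinfun_of_cop A) \<mu> = closure (alg_root_space A \<mu>)"
proof -
  have "blinfun_of_cop A - scalar_op \<mu> = blinfun_of_cop (A - \<mu> *\<^sub>C 1)"
    by (simp add: scalar_op_conv minus_cop.rep_eq)
  then have "(blinfun_apply (blinfun_of_cop A - scalar_op \<mu>) ^^ n) x = cop_apply ((A - \<mu> *\<^sub>C 1) ^ n) x" for n x
    unfolding cop_apply_power by (simp add: cop_apply_def)
  then have "(\<Union>j\<in>{1..}. {x. (blinfun_apply (blinfun_of_cop A - scalar_op \<mu>) ^^ j) x = 0}) =
      (\<Union>j\<in>{1..}. {x. cop_apply ((A - \<mu> *\<^sub>C 1) ^ j) x = 0})" by simp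
  also have "\<dots> = alg_root_space A \<mu>"
    unfolding alg_root_space_def
  proof (intro equalityI subsetI)
    fix x assume "x \<in> {x. \<exists>n. cop_apply ((A - \<mu> *\<^sub>C 1) ^ n) x = 0}"
    then obtain n where "cop_apply ((A - \<mu> *\<^sub>C 1) ^ n) x = 0" by blast
    then have "cop_apply ((A - \<mu> *\<^sub>C 1) ^ Suc n) x = 0" by simp
    then show "x \<in> (\<Union>j\<in>{1..}. {x. cop_apply ((A - \<mu> *\<^sub>C 1) ^ j) x = 0})" by force
  qed auto
  finally show ?thesis by (simp add: root_space_def)
qed

section \<open>Root spaces under the functional calculus\<close>

lemma commuting_apply: "A * B = B * A \<Longrightarrow> cop_apply A (cop_apply B x) = cop_apply B (cop_apply A x)"
  by (metis cop_apply_simps(8))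

lemma commuting_power: "(a :: 'a::monoid_mult) * b = b * a \<Longrightarrow> a ^ n * b = b * a ^ n"
  by (induction n) (simp_all add: mult.assoc, metis mult.assoc)

lemma commuting_power_mult: "(a :: 'a::monoid_mult) * b = b * a \<Longrightarrow> (a * b) ^ n = a ^ n * b ^ n"
proof (induction n)
  case (Suc n)
  have "(a * b) ^ Suc n = a * (b * a ^ n) * b ^ n"
    by (simp only: power_Suc Suc.IH[OF Suc.prems] mult.assoc)
  also have "b * a ^ n = a ^ n * b" using commuting_power[OF Suc.prems, of n] by simp
  also have "a * (a ^ n * b) * b ^ n = a ^ Suc n * b ^ Suc n" by (simp only: power_Suc mult.assoc)
  finally show ?case .
qed simp

lemma kernel_power_mono:
  assumes "cop_apply (D ^ n) x = 0" "n \<le> m"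
  shows "cop_apply (D ^ m) x = 0"
proof -
  have "D ^ m = D ^ (m - n) * D ^ n" using assms(2) by (simp flip: power_add)
  then show ?thesis using assms(1) by simp
qed

lemma alg_root_space_mono: "x \<in> alg_root_space A \<mu> \<Longrightarrow> \<exists>n. \<forall>m\<ge>n. cop_apply ((A - \<mu> *\<^sub>C 1) ^ m) x = 0"
  unfolding alg_root_space_def using kernel_power_mono by blast

lemma subspace_alg_root_space: "complex_vector.subspace (alg_root_space A \<mu>)"
proof (rule complex_vector.subspaceI)
  show "0 \<in> alg_root_space A \<mu>" by (auto simp: alg_root_space_def)
  fix x y assume "x \<in> alg_root_space A \<mu>" "y \<in> alg_root_space A \<mu>"
  then obtain m n where "\<forall>k\<ge>m. cop_apply ((A - \<mu> *\<^sub>C 1) ^ k) x = 0" "\<forall>k\<ge>n. cop_apply ((A - \<mu> *\<^sub>C 1) ^ k) y = 0"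
    using alg_root_space_mono by meson
  then have "cop_apply ((A - \<mu> *\<^sub>C 1) ^ max m n) (x + y) = 0" by simp
  then show "x + y \<in> alg_root_space A \<mu>" unfolding alg_root_space_def by blast
qed (auto simp: alg_root_space_def)

lemma alg_root_space_invariant:
  assumes "B * A = A * B" "x \<in> alg_root_space A \<mu>"
  shows "cop_apply B x \<in> alg_root_space A \<mu>"
proof -
  obtain n where n: "cop_apply ((A - \<mu> *\<^sub>C 1) ^ n) x = 0" using assms(2) by (auto simp: alg_root_space_def)
  have "(A - \<mu> *\<^sub>C 1) * B = B * (A - \<mu> *\<^sub>C 1)"
    using assms(1) by (simp add: alg_distribs)
  from commuting_power[OF this] have "cop_apply ((A - \<mu> *\<^sub>C 1) ^ n) (cop_apply B x) = 0"
    using n by (simp add: commuting_apply)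
  then show ?thesis by (auto simp: alg_root_space_def)
qed

lemma eigenvalue_of_root_vector:
  assumes "x \<in> alg_root_space A \<mu>" "x \<noteq> 0"
  shows "\<mu> \<in> eigenvalues A"
proof -
  define n where "n = (LEAST n. cop_apply ((A - \<mu> *\<^sub>C 1) ^ n) x = 0)"
  have n: "cop_apply ((A - \<mu> *\<^sub>C 1) ^ n) x = 0"
    unfolding n_def using assms(1) by (auto simp: alg_root_space_def intro: LeastI_ex)
  with assms(2) obtain m where m: "n = Suc m" by (cases n) auto
  let ?y = "cop_apply ((A - \<mu> *\<^sub>C 1) ^ m) x"
  have "?y \<noteq> 0" using not_less_Least[of m "\<lambda>n. cop_apply ((A - \<mu> *\<^sub>C 1) ^ n) x = 0"] m n_def by auto
  moreover have "cop_apply A ?y = \<mu> *\<^sub>C ?y" using n m by simp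
  ultimately show ?thesis unfolding eigenvalues_def by blast
qed

lemma eigenvalues_subset_spectrum: "eigenvalues A \<subseteq> alg_spectrum A"
proof
  fix \<mu> assume "\<mu> \<in> eigenvalues A"
  then obtain x where x: "x \<noteq> 0" "cop_apply (\<mu> *\<^sub>C 1 - A) x = 0" by (auto simp: eigenvalues_def)
  show "\<mu> \<in> alg_spectrum A"
  proof (rule ccontr)
    assume "\<mu> \<notin> alg_spectrum A"
    then have "alg_resolvent A \<mu> * (\<mu> *\<^sub>C 1 - A) = 1"
      using inverse_pair_resolvent by (auto simp: inverse_pair_def)
    then have "cop_apply (alg_resolvent A \<mu>) (cop_apply (\<mu> *\<^sub>C 1 - A) x) = x"
      by (metis cop_apply_simps(2,8))
    with x show False by simp
  qed
qed

text \<open>For \<open>G = g(T)\<close> and \<open>D = T - \<zeta>\<close> with \<open>g(\<zeta>) = \<gamma> \<noteq> 0\<close> this is the coprimality of \<open>D\<^sup>n\<close> and \<open>G\<close>, obtained without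
polynomials: if \<open>D x = y + u\<close> is split by induction, then \<open>\<gamma> x = G x - K D x = (G x - K u) - K y\<close> splits \<open>x\<close>.\<close>

lemma kernel_split:
  assumes g: "G = \<gamma> *\<^sub>C 1 + D * K" "\<gamma> \<noteq> 0"
    and com: "D * G = G * D" "D * K = K * D" "G * K = K * G"
    and x: "cop_apply (D ^ n) (cop_apply G x) = 0"
  shows "\<exists>y u. x = y + u \<and> cop_apply G y = 0 \<and> cop_apply (D ^ n) u = 0"
  using x
proof (induction n arbitrary: x)
  case 0
  then show ?case by (intro exI[of _ x] exI[of _ 0]) simp
next
  case (Suc n)
  have "cop_apply (D ^ n) (cop_apply G (cop_apply D x)) = 0"
    using Suc.prems commuting_apply[OF com(1), of x] by (simp only: power_Suc2 cop_apply_simps)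
  from Suc.IH[OF this] obtain y u where yu: "cop_apply D x = y + u" "cop_apply G y = 0" "cop_apply (D ^ n) u = 0" by blast
  define y' u' where "y' = - (inverse \<gamma> *\<^sub>C cop_apply K y)" and "u' = inverse \<gamma> *\<^sub>C (cop_apply G x - cop_apply K u)"
  have "cop_apply G x = \<gamma> *\<^sub>C x + cop_apply D (cop_apply K x)" unfolding g(1) by simp
  also have "cop_apply D (cop_apply K x) = cop_apply K y + cop_apply K u"
    using commuting_apply[OF com(2), of x] yu(1) by simp
  finally have "\<gamma> *\<^sub>C x = (cop_apply G x - cop_apply K u) - cop_apply K y" by (simp add: algebra_simps)
  then have "inverse \<gamma> *\<^sub>C \<gamma> *\<^sub>C x = u' + y'" by (simp add: u'_def y'_def complex_vector.scale_right_diff_distrib)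
  then have "x = y' + u'" using g(2) by (simp add: scaleC_scaleC scaleC_one)
  moreover have "cop_apply G y' = 0"
    using commuting_apply[OF com(3), of y] yu(2) by (simp add: y'_def)
  moreover have "cop_apply (D ^ Suc n) (cop_apply K u) = 0"
    using commuting_apply[OF commuting_power[OF com(2)], of n u] yu(3) by simp
  then have "cop_apply (D ^ Suc n) u' = 0"
    using Suc.prems by (simp only: u'_def cop_apply_right_simps) simp
  ultimately show ?case by blast
qed

definition nontrivial_on :: "(complex \<Rightarrow> complex) \<Rightarrow> complex set \<Rightarrow> bool" where
  "nontrivial_on h \<Omega> \<longleftrightarrow> (\<forall>U\<in>components \<Omega>. \<exists>z\<in>U. h z \<noteq> 0)"

text \<open>The exponent may be zero, so that \<open>\<zeta>\<close> need not be a zero of \<open>h\<close>.\<close>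

lemma holomorphic_factor_zero_global:
  assumes \<Omega>: "open \<Omega>" and h: "h holomorphic_on \<Omega>" "nontrivial_on h \<Omega>" and \<zeta>: "\<zeta> \<in> \<Omega>"
  obtains g n where "g holomorphic_on \<Omega>" "g \<zeta> \<noteq> 0" "\<And>z. z \<in> \<Omega> \<Longrightarrow> h z = (z - \<zeta>) ^ n * g z"
proof (cases "h \<zeta> = 0")
  case False
  then show ?thesis using that[of h 0] h(1) by simp
next
  case True
  define U where "U = connected_component_set \<Omega> \<zeta>"
  have U: "U \<in> components \<Omega>" "open U" "connected U" "U \<subseteq> \<Omega>" "\<zeta> \<in> U"
    using \<zeta> \<Omega> by (auto simp: U_def components_def open_connected_component connected_component_subset)
  have "\<not> h constant_on U"
    using h(2) U(1,5) True unfolding nontrivial_on_def constant_on_def by metis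
  then obtain g0 r n where g0: "0 < n" "0 < r" "ball \<zeta> r \<subseteq> U" "g0 holomorphic_on ball \<zeta> r"
      "\<And>w. w \<in> ball \<zeta> r \<Longrightarrow> h w = (w - \<zeta>) ^ n * g0 w" "\<And>w. w \<in> ball \<zeta> r \<Longrightarrow> g0 w \<noteq> 0"
    using holomorphic_factor_zero_nonconstant[OF holomorphic_on_subset[OF h(1) U(4)] U(2,3,5) True] by metis
  define g where "g z = (if z = \<zeta> then g0 \<zeta> else h z / (z - \<zeta>) ^ n)" for z
  have "g holomorphic_on (\<Omega> - {\<zeta>})"
  proof -
    have "(\<lambda>z. h z / (z - \<zeta>) ^ n) holomorphic_on (\<Omega> - {\<zeta>})"
      by (intro holomorphic_intros holomorphic_on_subset[OF h(1)]) auto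
    then show ?thesis by (rule holomorphic_transform) (simp add: g_def)
  qed
  moreover have "g holomorphic_on ball \<zeta> r"
    using g0(4) by (rule holomorphic_transform) (simp add: g_def g0(5))
  ultimately have "g holomorphic_on ((\<Omega> - {\<zeta>}) \<union> ball \<zeta> r)"
    using \<Omega> by (intro holomorphic_on_Un) (auto simp: open_delete)
  moreover have "(\<Omega> - {\<zeta>}) \<union> ball \<zeta> r = \<Omega>" using g0(2,3) U(4) by auto
  ultimately have "g holomorphic_on \<Omega>" by simp
  then show ?thesis
  proof (rule that[of g n])
    show "g \<zeta> \<noteq> 0" using g0(2,6) by (simp add: g_def)
    show "h z = (z - \<zeta>) ^ n * g z" for z using True g0(1) by (simp add: g_def)
  qed
qed

lemma finite_zeros_in_compact:
  assumes \<Omega>: "open \<Omega>" and h: "h holomorphic_on \<Omega>" "nontrivial_on h \<Omega>" and K: "compact K" "K \<subseteq> \<Omega>"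
  shows "finite {z \<in> K. h z = 0}"
proof (rule ccontr)
  let ?Z = "{z \<in> K. h z = 0}"
  assume "infinite ?Z"
  moreover have "?Z \<subseteq> K" by auto
  ultimately have "\<exists>\<zeta>\<in>K. \<zeta> islimpt ?Z"
    by (rule Heine_Borel_imp_Bolzano_Weierstrass[OF K(1)])
  then obtain \<zeta> where \<zeta>: "\<zeta> \<in> K" "\<zeta> islimpt ?Z" by (elim bexE)
  have "\<zeta> \<in> \<Omega>" using \<zeta>(1) K(2) by blast
  then obtain g n where g: "g holomorphic_on \<Omega>" "g \<zeta> \<noteq> 0" "\<And>z. z \<in> \<Omega> \<Longrightarrow> h z = (z - \<zeta>) ^ n * g z"
    using holomorphic_factor_zero_global[OF \<Omega> h] by metis
  have "open (\<Omega> \<inter> g -` (- {0}))"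
    using \<Omega> g(1) by (intro continuous_open_preimage holomorphic_on_imp_continuous_on) auto
  moreover have "\<zeta> \<in> \<Omega> \<inter> g -` (- {0})" using \<open>\<zeta> \<in> \<Omega>\<close> g(2) by simp
  ultimately obtain z where "z \<in> ?Z" "z \<in> \<Omega> \<inter> g -` (- {0})" "z \<noteq> \<zeta>"
    using \<zeta>(2) by (meson islimptE)
  then show False using g(3)[of z] by simp
qed

text \<open>\<open>K = k(T)\<close> for the difference quotient \<open>k\<close> of \<open>g\<close> at \<open>\<zeta>\<close>, which is holomorphic on all of \<open>\<Omega>\<close>.\<close>

lemma fcalc_divided_difference:
  assumes D: "spectral_nbhd T \<Omega>" and g: "g holomorphic_on \<Omega>" and \<zeta>: "\<zeta> \<in> \<Omega>"
  shows "\<exists>K. fcalc \<Omega> g T = g \<zeta> *\<^sub>C 1 + (T - \<zeta> *\<^sub>C 1) * K \<and> (\<forall>B. T * B = B * T \<longrightarrow> K * B = B * K)"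
proof -
  define k where "k = (\<lambda>z. if z = \<zeta> then deriv g \<zeta> else (g z - g \<zeta>) / (z - \<zeta>))"
  have k: "k holomorphic_on \<Omega>"
    unfolding k_def using g D by (intro pole_lemma_open) (auto simp: spectral_nbhd_def)
  have "fcalc \<Omega> g T = fcalc \<Omega> (\<lambda>z. g \<zeta> + (z - \<zeta>) ^ 1 * k z) T"
    by (rule fcalc_cong[OF D g]) (simp add: k_def)
  also have "\<dots> = g \<zeta> *\<^sub>C 1 + (T - \<zeta> *\<^sub>C 1) ^ 1 * fcalc \<Omega> k T"
    by (subst fcalc_add[OF D]) (auto intro!: holomorphic_intros k simp: fcalc_const[OF D] fcalc_shift_power_mult[OF D k, of \<zeta> 1, simplified])
  finally show ?thesis using fcalc_commute[OF D k] by (intro exI[of _ "fcalc \<Omega> k T"]) simp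
qed

text \<open>Induction on the set \<open>Z\<close> of zeros in the spectrum: write \<open>h = (z - \<zeta>)\<^sup>n g\<close> with \<open>g(\<zeta>) \<noteq> 0\<close> and split the kernel of
\<open>(T - \<zeta>)\<^sup>n g(T)\<close> by \<open>kernel_split\<close>. Without zeros in the spectrum \<open>h(T)\<close> is invertible.\<close>

lemma fcalc_kernel_decomposition:
  fixes T :: "'a::complex_banach cop"
  assumes D: "spectral_nbhd T \<Omega>" and "finite Z" and Z: "Z \<subseteq> \<Omega>"
    and h: "h holomorphic_on \<Omega>" "nontrivial_on h \<Omega>"
    and zeros: "\<And>z. z \<in> alg_spectrum T \<Longrightarrow> h z = 0 \<Longrightarrow> z \<in> Z"
    and x: "cop_apply (fcalc \<Omega> h T) x = 0"
  shows "\<exists>y. (\<forall>\<zeta>\<in>Z. y \<zeta> \<in> alg_root_space T \<zeta>) \<and> x = (\<Sum>\<zeta>\<in>Z. y \<zeta>)"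
  using assms(2-)
proof (induction Z arbitrary: h x rule: finite_induct)
  case empty
  then obtain b where "inverse_pair (fcalc \<Omega> h T) b"
    using fcalc_inverse_pair[OF D, of h] by blast
  then have "cop_apply b (cop_apply (fcalc \<Omega> h T) x) = x"
    unfolding inverse_pair_def by (metis cop_apply_simps(2,8))
  then have "x = 0" using empty by simp
  then show ?case by simp
next
  case (insert \<zeta> Z)
  have \<zeta>: "\<zeta> \<in> \<Omega>" and \<Omega>: "open \<Omega>" using insert.prems D by (auto simp: spectral_nbhd_def)
  obtain g n where g: "g holomorphic_on \<Omega>" "g \<zeta> \<noteq> 0" "\<And>z. z \<in> \<Omega> \<Longrightarrow> h z = (z - \<zeta>) ^ n * g z"
    using holomorphic_factor_zero_global[OF \<Omega> insert.prems(2,3) \<zeta>] by metis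
  let ?D = "T - \<zeta> *\<^sub>C 1" and ?G = "fcalc \<Omega> g T"
  obtain K where K: "?G = g \<zeta> *\<^sub>C 1 + ?D * K" "\<And>B. T * B = B * T \<Longrightarrow> K * B = B * K"
    using fcalc_divided_difference[OF D g(1) \<zeta>] by blast
  have "fcalc \<Omega> h T = ?D ^ n * ?G"
    using fcalc_cong[OF D insert.prems(2), of "\<lambda>z. (z - \<zeta>) ^ n * g z"] g(3)
      fcalc_shift_power_mult[OF D g(1)] by simp
  then have x: "cop_apply (?D ^ n) (cop_apply ?G x) = 0" using insert.prems(5) by simp
  have TD: "T * ?D = ?D * T" by (simp add: alg_distribs)
  have GD: "?D * ?G = ?G * ?D" using fcalc_commute[OF D g(1) TD] by simp
  have TG: "T * ?G = ?G * T" using fcalc_commute[OF D g(1), of T] by simp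
  obtain y u where yu: "x = y + u" "cop_apply ?G y = 0" "cop_apply (?D ^ n) u = 0"
    using kernel_split[OF K(1) g(2) GD _ _ x] K(2)[OF TD] K(2)[OF TG] by auto
  have "nontrivial_on g \<Omega>"
    unfolding nontrivial_on_def
  proof
    fix U assume U: "U \<in> components \<Omega>"
    then obtain z where z: "z \<in> U" "h z \<noteq> 0" using insert.prems(3) by (auto simp: nontrivial_on_def)
    have "z \<in> \<Omega>" using U z(1) in_components_subset by blast
    then show "\<exists>z\<in>U. g z \<noteq> 0" using z g(3)[of z] by (intro bexI[of _ z]) auto
  qed
  moreover have "z \<in> Z" if "z \<in> alg_spectrum T" "g z = 0" for z
    using that insert.prems(4)[of z] g(2) g(3)[of z] D by (auto simp: spectral_nbhd_def)
  ultimately obtain w where w: "\<forall>\<zeta>\<in>Z. w \<zeta> \<in> alg_root_space T \<zeta>" "y = (\<Sum>\<zeta>\<in>Z. w \<zeta>)"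
    using insert.IH[of g y] g(1) yu(2) insert.prems(1) by blast
  have "u \<in> alg_root_space T \<zeta>" using yu(3) by (auto simp: alg_root_space_def)
  then show ?case
    using w insert.hyps yu(1)
    by (intro exI[of _ "w(\<zeta> := u)"]) (auto simp: add.commute intro!: sum.cong)
qed

lemma alg_root_space_fcalc:
  assumes D: "spectral_nbhd T \<Omega>" and f: "f holomorphic_on \<Omega>" and \<zeta>: "\<zeta> \<in> \<Omega>"
  shows "alg_root_space T \<zeta> \<subseteq> alg_root_space (fcalc \<Omega> f T) (f \<zeta>)"
proof
  fix x assume "x \<in> alg_root_space T \<zeta>"
  then obtain n where n: "cop_apply ((T - \<zeta> *\<^sub>C 1) ^ n) x = 0" by (auto simp: alg_root_space_def)
  obtain K where K: "fcalc \<Omega> f T = f \<zeta> *\<^sub>C 1 + (T - \<zeta> *\<^sub>C 1) * K" "\<And>B. T * B = B * T \<Longrightarrow> K * B = B * K"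
    using fcalc_divided_difference[OF D f \<zeta>] by blast
  have KD: "K * (T - \<zeta> *\<^sub>C 1) = (T - \<zeta> *\<^sub>C 1) * K"
    by (rule K(2)) (simp add: alg_distribs)
  have "(fcalc \<Omega> f T - f \<zeta> *\<^sub>C 1) ^ n = K ^ n * (T - \<zeta> *\<^sub>C 1) ^ n"
    using commuting_power_mult[OF KD, of n] by (simp add: K(1) KD)
  then have "cop_apply ((fcalc \<Omega> f T - f \<zeta> *\<^sub>C 1) ^ n) x = 0" using n by simp
  then show "x \<in> alg_root_space (fcalc \<Omega> f T) (f \<zeta>)" by (auto simp: alg_root_space_def)
qed

text \<open>Apply \<open>fcalc_kernel_decomposition\<close> to \<open>(f - \<mu>)\<^sup>n\<close>. Points \<open>\<zeta>\<close> of the spectrum that are not eigenvalues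
contribute zero, since their algebraic root spaces are trivial.\<close>

lemma alg_root_space_fcalc_decomposition:
  assumes D: "spectral_nbhd T \<Omega>" and f: "f holomorphic_on \<Omega>" and nc: "\<forall>U\<in>components \<Omega>. \<not> f constant_on U"
  shows "finite {\<zeta> \<in> alg_spectrum T. f \<zeta> = \<mu>}"
    and "x \<in> alg_root_space (fcalc \<Omega> f T) \<mu> \<Longrightarrow>
      \<exists>y. (\<forall>\<zeta>\<in>{\<zeta> \<in> alg_spectrum T. f \<zeta> = \<mu>}. y \<zeta> \<in> alg_root_space T \<zeta>) \<and>
          x = (\<Sum>\<zeta>\<in>{\<zeta> \<in> alg_spectrum T. f \<zeta> = \<mu>}. y \<zeta>)"
proof -
  let ?Z = "{\<zeta> \<in> alg_spectrum T. f \<zeta> = \<mu>}"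
  have \<Omega>: "open \<Omega>" "alg_spectrum T \<subseteq> \<Omega>" using D by (auto simp: spectral_nbhd_def)
  have nt: "nontrivial_on (\<lambda>z. f z - \<mu>) \<Omega>"
    unfolding nontrivial_on_def using nc unfolding constant_on_def by (metis right_minus_eq)
  have hol: "(\<lambda>z. f z - \<mu>) holomorphic_on \<Omega>" by (intro holomorphic_intros f)
  show fin: "finite ?Z"
    using finite_zeros_in_compact[OF \<Omega>(1) hol nt compact_alg_spectrum[of T] \<Omega>(2)] by simp
  assume "x \<in> alg_root_space (fcalc \<Omega> f T) \<mu>"
  then obtain n where n: "cop_apply ((fcalc \<Omega> f T - \<mu> *\<^sub>C 1) ^ n) x = 0" by (auto simp: alg_root_space_def)
  have pw: "fcalc \<Omega> (\<lambda>z. (f z - \<mu>) ^ n) T = (fcalc \<Omega> f T - \<mu> *\<^sub>C 1) ^ n"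
    using fcalc_power[OF D hol] fcalc_diff_const[OF D f] by simp
  have "nontrivial_on (\<lambda>z. (f z - \<mu>) ^ n) \<Omega>" using nt by (simp add: nontrivial_on_def) (meson)
  then show "\<exists>y. (\<forall>\<zeta>\<in>?Z. y \<zeta> \<in> alg_root_space T \<zeta>) \<and> x = (\<Sum>\<zeta>\<in>?Z. y \<zeta>)"
    using \<Omega>(2) n pw by (intro fcalc_kernel_decomposition[OF D fin _ holomorphic_on_power[OF hol]]) auto
qed

lemma eigenvalues_fcalc:
  assumes D: "spectral_nbhd T \<Omega>" and f: "f holomorphic_on \<Omega>" and nc: "\<forall>U\<in>components \<Omega>. \<not> f constant_on U"
  shows "eigenvalues (fcalc \<Omega> f T) = f ` eigenvalues T"
proof (intro equalityI subsetI)
  fix \<mu> assume "\<mu> \<in> eigenvalues (fcalc \<Omega> f T)"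
  then obtain x where x: "x \<noteq> 0" "cop_apply (fcalc \<Omega> f T) x = \<mu> *\<^sub>C x" by (auto simp: eigenvalues_def)
  then have "cop_apply ((fcalc \<Omega> f T - \<mu> *\<^sub>C 1) ^ 1) x = 0" by simp
  then have "x \<in> alg_root_space (fcalc \<Omega> f T) \<mu>" unfolding alg_root_space_def by blast
  then obtain y where y: "\<forall>\<zeta>\<in>{\<zeta> \<in> alg_spectrum T. f \<zeta> = \<mu>}. y \<zeta> \<in> alg_root_space T \<zeta>"
      "x = (\<Sum>\<zeta>\<in>{\<zeta> \<in> alg_spectrum T. f \<zeta> = \<mu>}. y \<zeta>)"
    using alg_root_space_fcalc_decomposition(2)[OF D f nc] by blast
  then obtain \<zeta> where "\<zeta> \<in> alg_spectrum T" "f \<zeta> = \<mu>" "y \<zeta> \<noteq> 0"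
    using x(1) by (metis (mono_tags, lifting) mem_Collect_eq sum.neutral)
  then show "\<mu> \<in> f ` eigenvalues T" using y(1) eigenvalue_of_root_vector[of "y \<zeta>" T \<zeta>] by auto
next
  fix \<mu> assume "\<mu> \<in> f ` eigenvalues T"
  then obtain \<zeta> where \<zeta>: "\<mu> = f \<zeta>" "\<zeta> \<in> eigenvalues T" by blast
  then obtain x where x: "x \<noteq> 0" "cop_apply T x = \<zeta> *\<^sub>C x" by (auto simp: eigenvalues_def)
  then have "cop_apply ((T - \<zeta> *\<^sub>C 1) ^ 1) x = 0" by simp
  then have "x \<in> alg_root_space T \<zeta>" unfolding alg_root_space_def by blast
  moreover have "\<zeta> \<in> \<Omega>" using \<zeta>(2) eigenvalues_subset_spectrum D by (auto simp: spectral_nbhd_def)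
  ultimately have "x \<in> alg_root_space (fcalc \<Omega> f T) \<mu>" using alg_root_space_fcalc[OF D f] \<zeta>(1) by blast
  then show "\<mu> \<in> eigenvalues (fcalc \<Omega> f T)" using x(1) by (rule eigenvalue_of_root_vector)
qed

section \<open>Unconditional bases and multipliers\<close>

definition unconditionality_bound :: "'i set \<Rightarrow> ('i \<Rightarrow> 'a::complex_banach set) \<Rightarrow> real \<Rightarrow> bool" where
  "unconditionality_bound I X C \<longleftrightarrow>
     (\<forall>F1 F2 x. finite F2 \<and> F1 \<subseteq> F2 \<and> F2 \<subseteq> I \<and> (\<forall>\<alpha>\<in>F2. x \<alpha> \<in> X \<alpha>) \<longrightarrow>
        norm (\<Sum>\<alpha>\<in>F1. x \<alpha>) \<le> C * norm (\<Sum>\<alpha>\<in>F2. x \<alpha>))"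

lemma unconditionality_boundD:
  assumes "unconditionality_bound I X C" "finite F2" "F1 \<subseteq> F2" "F2 \<subseteq> I" "\<And>\<alpha>. \<alpha> \<in> F2 \<Longrightarrow> x \<alpha> \<in> X \<alpha>"
  shows "norm (\<Sum>\<alpha>\<in>F1. x \<alpha>) \<le> C * norm (\<Sum>\<alpha>\<in>F2. x \<alpha>)"
  using assms unfolding unconditionality_bound_def by blast

text \<open>Independence is a consequence of the unconditional inequality with \<open>F1\<close> a singleton.\<close>

lemma unconditional_basis_iff:
  "unconditional_basis I X \<longleftrightarrow> countable I \<and> (\<forall>\<alpha>\<in>I. complex_vector.subspace (X \<alpha>)) \<and>
     closure (complex_vector.span (\<Union>\<alpha>\<in>I. X \<alpha>)) = UNIV \<and> (\<exists>C>0. unconditionality_bound I X C)"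
proof -
  have "\<forall>\<alpha>\<in>F. x \<alpha> = 0"
    if ub: "unconditionality_bound I X C" and F: "finite F" "F \<subseteq> I" "\<forall>\<alpha>\<in>F. x \<alpha> \<in> X \<alpha>" "(\<Sum>\<alpha>\<in>F. x \<alpha>) = 0" for C F x
  proof
    fix \<alpha> assume "\<alpha> \<in> F"
    then have "norm (\<Sum>\<alpha>\<in>{\<alpha>}. x \<alpha>) \<le> C * norm (\<Sum>\<alpha>\<in>F. x \<alpha>)"
      using F by (intro unconditionality_boundD[OF ub]) auto
    then show "x \<alpha> = 0" using F(4) by simp
  qed
  then show ?thesis
    unfolding unconditional_basis_def independent_subspaces_def unconditionality_bound_def[symmetric] by blast
qed

lemma closure_complex_subspace:
  assumes "complex_vector.subspace S"
  shows "complex_vector.subspace (closure S)"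
proof (rule complex_vector.subspaceI)
  show "0 \<in> closure S" using complex_vector.subspace_0[OF assms] closure_subset by blast
  fix x y assume "x \<in> closure S" "y \<in> closure S"
  then obtain u v where "\<And>n. u n \<in> S" "u \<longlonglongrightarrow> x" "\<And>n. v n \<in> S" "v \<longlonglongrightarrow> y"
    unfolding closure_sequential by blast
  then show "x + y \<in> closure S"
    unfolding closure_sequential using assms
    by (intro exI[of _ "\<lambda>n. u n + v n"]) (auto intro: tendsto_add complex_vector.subspace_add)
next
  fix c x assume "x \<in> closure S"
  then obtain u where "\<And>n. u n \<in> S" "u \<longlonglongrightarrow> x" unfolding closure_sequential by blast
  then show "c *\<^sub>C x \<in> closure S"
    unfolding closure_sequential using assms
    by (intro exI[of _ "\<lambda>n. c *\<^sub>C u n"]) (auto intro: tendsto_scaleC complex_vector.subspace_scale)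
qed

lemma unconditionality_bound_closure:
  assumes ub: "unconditionality_bound I X C"
  shows "unconditionality_bound I (\<lambda>\<alpha>. closure (X \<alpha>)) C"
  unfolding unconditionality_bound_def
proof (intro allI impI)
  fix F1 F2 x
  assume F: "finite F2 \<and> F1 \<subseteq> F2 \<and> F2 \<subseteq> I \<and> (\<forall>\<alpha>\<in>F2. x \<alpha> \<in> closure (X \<alpha>))"
  then have "\<forall>\<alpha>\<in>F2. \<exists>u. (\<forall>n. u n \<in> X \<alpha>) \<and> u \<longlonglongrightarrow> x \<alpha>" unfolding closure_sequential by blast
  then obtain u where u: "\<And>\<alpha> n. \<alpha> \<in> F2 \<Longrightarrow> u \<alpha> n \<in> X \<alpha>" "\<And>\<alpha>. \<alpha> \<in> F2 \<Longrightarrow> u \<alpha> \<longlonglongrightarrow> x \<alpha>"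
    unfolding bchoice_iff by blast
  show "norm (\<Sum>\<alpha>\<in>F1. x \<alpha>) \<le> C * norm (\<Sum>\<alpha>\<in>F2. x \<alpha>)"
  proof (rule LIMSEQ_le)
    show "(\<lambda>n. norm (\<Sum>\<alpha>\<in>F1. u \<alpha> n)) \<longlonglongrightarrow> norm (\<Sum>\<alpha>\<in>F1. x \<alpha>)"
      using u(2) F by (intro tendsto_norm tendsto_sum) auto
    show "(\<lambda>n. C * norm (\<Sum>\<alpha>\<in>F2. u \<alpha> n)) \<longlonglongrightarrow> C * norm (\<Sum>\<alpha>\<in>F2. x \<alpha>)"
      using u(2) F by (intro tendsto_mult tendsto_const tendsto_norm tendsto_sum) auto
    show "\<exists>N. \<forall>n\<ge>N. norm (\<Sum>\<alpha>\<in>F1. u \<alpha> n) \<le> C * norm (\<Sum>\<alpha>\<in>F2. u \<alpha> n)"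
      using F u(1) by (intro exI[of _ 0] allI impI unconditionality_boundD[OF ub]) auto
  qed
qed

text \<open>The norm is convex in each coefficient separately, so that its maximum over the cube is attained at a
vertex, that is, at a subset sum. The vector \<open>y\<close> collects the terms already treated.\<close>

lemma norm_convex_subset_sums:
  fixes x :: "'i \<Rightarrow> 'a::real_normed_vector"
  assumes "finite F" "\<And>\<alpha>. \<alpha> \<in> F \<Longrightarrow> 0 \<le> c \<alpha> \<and> c \<alpha> \<le> 1"
    and "\<And>G. G \<subseteq> F \<Longrightarrow> norm (y + (\<Sum>\<alpha>\<in>G. x \<alpha>)) \<le> B"
  shows "norm (y + (\<Sum>\<alpha>\<in>F. c \<alpha> *\<^sub>R x \<alpha>)) \<le> B"
  using assms
proof (induction F arbitrary: y rule: finite_induct)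
  case empty
  from empty(2)[of "{}"] show ?case by simp
next
  case (insert a F)
  have "norm ((y + c a *\<^sub>R x a) + (\<Sum>\<alpha>\<in>F. c \<alpha> *\<^sub>R x \<alpha>)) \<le> B"
  proof (rule insert.IH)
    fix G assume G: "G \<subseteq> F"
    then have aG: "a \<notin> G" "finite G" using insert.hyps by (auto intro: finite_subset)
    let ?s = "\<Sum>\<alpha>\<in>G. x \<alpha>"
    have c: "0 \<le> c a" "c a \<le> 1" using insert.prems(1)[of a] by auto
    have "(y + c a *\<^sub>R x a) + ?s = (1 - c a) *\<^sub>R (y + ?s) + c a *\<^sub>R (y + (\<Sum>\<alpha>\<in>insert a G. x \<alpha>))"
      using aG by (simp add: algebra_simps)
    also have "norm \<dots> \<le> (1 - c a) * B + c a * B"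
      using c insert.prems(2)[of G] insert.prems(2)[of "insert a G"] G
      by (intro norm_triangle_mono) (auto intro!: mult_left_mono)
    finally show "norm ((y + c a *\<^sub>R x a) + ?s) \<le> B" by (simp add: algebra_simps)
  qed (use insert.prems in auto)
  then show ?case using insert.hyps by (simp add: add.assoc)
qed

text \<open>The factor 4 comes from splitting the coefficients into the positive and negative parts of their real
and imaginary parts.\<close>

lemma unconditional_coefficients:
  assumes ub: "unconditionality_bound I X C" and F: "finite F" "F \<subseteq> I" "\<And>\<alpha>. \<alpha> \<in> F \<Longrightarrow> x \<alpha> \<in> X \<alpha>"
    and c: "\<And>\<alpha>. \<alpha> \<in> F \<Longrightarrow> norm (c \<alpha>) \<le> B" and B: "B \<ge> 0" "C \<ge> 0"
  shows "norm (\<Sum>\<alpha>\<in>F. c \<alpha> *\<^sub>C x \<alpha>) \<le> 4 * C * B * norm (\<Sum>\<alpha>\<in>F. x \<alpha>)"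
proof -
  let ?n = "norm (\<Sum>\<alpha>\<in>F. x \<alpha>)"
  have unit: "norm (\<Sum>\<alpha>\<in>F. d \<alpha> *\<^sub>R x \<alpha>) \<le> C * ?n" if "\<And>\<alpha>. \<alpha> \<in> F \<Longrightarrow> 0 \<le> d \<alpha> \<and> d \<alpha> \<le> 1" for d
    using norm_convex_subset_sums[OF F(1) that, where y = 0 and x = x and B = "C * ?n"] unconditionality_boundD[OF ub F(1) _ F(2,3)] by simp
  have pos: "norm (\<Sum>\<alpha>\<in>F. d \<alpha> *\<^sub>R x \<alpha>) \<le> C * B * ?n" if d: "\<And>\<alpha>. \<alpha> \<in> F \<Longrightarrow> 0 \<le> d \<alpha> \<and> d \<alpha> \<le> B" for d
  proof (cases "B = 0")
    case True
    then have "(\<Sum>\<alpha>\<in>F. d \<alpha> *\<^sub>R x \<alpha>) = 0" using d by (intro sum.neutral) force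
    then show ?thesis using True by simp
  next
    case False
    then have B0: "B > 0" using B by simp
    have "(\<Sum>\<alpha>\<in>F. d \<alpha> *\<^sub>R x \<alpha>) = B *\<^sub>R (\<Sum>\<alpha>\<in>F. (d \<alpha> / B) *\<^sub>R x \<alpha>)"
      using False by (simp add: scaleR_sum_right)
    then have "norm (\<Sum>\<alpha>\<in>F. d \<alpha> *\<^sub>R x \<alpha>) = B * norm (\<Sum>\<alpha>\<in>F. (d \<alpha> / B) *\<^sub>R x \<alpha>)" using B by simp
    also have "\<dots> \<le> B * (C * ?n)" using d B0 by (intro mult_left_mono unit) auto
    finally show ?thesis by (simp add: mult_ac)
  qed
  have real: "norm (\<Sum>\<alpha>\<in>F. d \<alpha> *\<^sub>R x \<alpha>) \<le> 2 * C * B * ?n" if d: "\<And>\<alpha>. \<alpha> \<in> F \<Longrightarrow> \<bar>d \<alpha>\<bar> \<le> B" for d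
  proof -
    have "(\<Sum>\<alpha>\<in>F. d \<alpha> *\<^sub>R x \<alpha>) = (\<Sum>\<alpha>\<in>F. max (d \<alpha>) 0 *\<^sub>R x \<alpha>) - (\<Sum>\<alpha>\<in>F. max (- d \<alpha>) 0 *\<^sub>R x \<alpha>)"
      unfolding sum_subtractf[symmetric] scaleR_diff_left[symmetric] by (intro sum.cong) (auto simp: max_def)
    also have "norm \<dots> \<le> C * B * ?n + C * B * ?n"
      using d B by (intro order_trans[OF norm_triangle_ineq4] add_mono pos) force+
    finally show ?thesis by (simp add: mult.assoc mult.left_commute[of C B])
  qed
  have "(\<Sum>\<alpha>\<in>F. c \<alpha> *\<^sub>C x \<alpha>) = (\<Sum>\<alpha>\<in>F. Re (c \<alpha>) *\<^sub>R x \<alpha>) + \<i> *\<^sub>C (\<Sum>\<alpha>\<in>F. Im (c \<alpha>) *\<^sub>R x \<alpha>)"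
  proof -
    have "c \<alpha> *\<^sub>C x \<alpha> = Re (c \<alpha>) *\<^sub>R x \<alpha> + \<i> *\<^sub>C Im (c \<alpha>) *\<^sub>R x \<alpha>" for \<alpha>
    proof -
      have "c \<alpha> *\<^sub>C x \<alpha> = (of_real (Re (c \<alpha>)) + \<i> * of_real (Im (c \<alpha>))) *\<^sub>C x \<alpha>"
        by (subst complex_eq[of "c \<alpha>"]) (rule refl)
      also have "\<dots> = of_real (Re (c \<alpha>)) *\<^sub>C x \<alpha> + \<i> *\<^sub>C of_real (Im (c \<alpha>)) *\<^sub>C x \<alpha>"
        by (simp only: scaleC_add_left scaleC_scaleC)
      finally show ?thesis by (simp only: scaleC_of_real)
    qed
    then show ?thesis by (simp add: sum.distrib complex_vector.scale_sum_right)
  qed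
  also have "norm \<dots> \<le> 2 * C * B * ?n + norm (\<i> *\<^sub>C (\<Sum>\<alpha>\<in>F. Im (c \<alpha>) *\<^sub>R x \<alpha>))"
    using c by (intro norm_triangle_mono real order_refl) (auto intro: order_trans[OF abs_Re_le_cmod])
  also have "norm (\<i> *\<^sub>C (\<Sum>\<alpha>\<in>F. Im (c \<alpha>) *\<^sub>R x \<alpha>)) \<le> 2 * C * B * ?n"
    unfolding norm_scaleC norm_ii mult_1 using c by (intro real) (auto intro: order_trans[OF abs_Im_le_cmod])
  finally show ?thesis by (simp add: mult.assoc mult.left_commute[of C B])
qed

lemma span_Union_subspaces:
  assumes "\<And>\<alpha>. \<alpha> \<in> I \<Longrightarrow> complex_vector.subspace (X \<alpha>)" "v \<in> complex_vector.span (\<Union>\<alpha>\<in>I. X \<alpha>)"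
  shows "\<exists>F x. finite F \<and> F \<subseteq> I \<and> (\<forall>\<alpha>\<in>I. x \<alpha> \<in> X \<alpha>) \<and> (\<forall>\<alpha>. \<alpha> \<notin> F \<longrightarrow> x \<alpha> = 0) \<and> v = (\<Sum>\<alpha>\<in>F. x \<alpha>)"
  using assms(2)
proof (induction rule: complex_vector.span_induct_alt)
  case base
  show ?case using assms(1) by (intro exI[of _ "{}"] exI[of _ "\<lambda>_. 0"]) (auto simp: complex_vector.subspace_0)
next
  case (step c w v)
  then obtain \<beta> F x where b: "\<beta> \<in> I" "w \<in> X \<beta>" and F: "finite F" "F \<subseteq> I" "\<forall>\<alpha>\<in>I. x \<alpha> \<in> X \<alpha>"
    "\<forall>\<alpha>. \<alpha> \<notin> F \<longrightarrow> x \<alpha> = 0" "v = (\<Sum>\<alpha>\<in>F. x \<alpha>)" by blast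
  let ?x = "x(\<beta> := c *\<^sub>C w + x \<beta>)"
  have "(\<Sum>\<alpha>\<in>insert \<beta> F. ?x \<alpha>) = (c *\<^sub>C w + x \<beta>) + (\<Sum>\<alpha>\<in>F - {\<beta>}. x \<alpha>)"
    using F(1) by (subst sum.insert_remove) (auto intro!: sum.cong)
  also have "\<dots> = c *\<^sub>C w + v"
    using F(1,4,5) by (cases "\<beta> \<in> F") (auto simp: sum.remove add.assoc)
  finally have "c *\<^sub>C w + v = (\<Sum>\<alpha>\<in>insert \<beta> F. ?x \<alpha>)" ..
  moreover have "\<forall>\<alpha>\<in>I. ?x \<alpha> \<in> X \<alpha>"
    using F(3) b assms(1)[OF b(1)] by (auto intro: complex_vector.subspace_add complex_vector.subspace_scale)
  ultimately show ?case
    using F b by (intro exI[of _ "insert \<beta> F"] exI[of _ ?x]) auto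
qed

text \<open>The closure \<open>S\<close> of the graph of a bounded densely defined operator is the graph of a bounded operator on
the whole space.\<close>

lemma cop_of_dense_graph:
  fixes R :: "'a::complex_banach \<Rightarrow> 'a \<Rightarrow> bool"
  assumes add: "\<And>u v u' v'. R u v \<Longrightarrow> R u' v' \<Longrightarrow> R (u + u') (v + v')"
    and scale: "\<And>c u v. R u v \<Longrightarrow> R (c *\<^sub>C u) (c *\<^sub>C v)"
    and bound: "\<And>u v. R u v \<Longrightarrow> norm v \<le> K * norm u" and K: "K \<ge> 0"
    and dense: "closure {u. \<exists>v. R u v} = UNIV"
  shows "\<exists>A. (\<forall>u v. R u v \<longrightarrow> cop_apply A u = v) \<and> norm A \<le> K"
proof -
  have diff: "R (u - u') (v - v')" if "R u v" "R u' v'" for u v u' v'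
    using add[OF that(1) scale[OF that(2), of "-1"]] by (simp add: scaleC_one)
  define S where "S u v \<longleftrightarrow> (\<exists>p q. (\<forall>n. R (p n) (q n)) \<and> p \<longlonglongrightarrow> u \<and> q \<longlonglongrightarrow> v)" for u v
  have S_bound: "norm v \<le> K * norm u" if uv: "S u v" for u v
  proof -
    obtain p q where "\<forall>n. R (p n) (q n)" "p \<longlonglongrightarrow> u" "q \<longlonglongrightarrow> v" using uv unfolding S_def by blast
    then show ?thesis
      by (intro LIMSEQ_le[OF tendsto_norm tendsto_mult[OF tendsto_const tendsto_norm]]) (auto intro: bound)
  qed
  have S_add: "S (u + u') (v + v')" if uv: "S u v" "S u' v'" for u v u' v'
  proof -
    obtain p q p' q' where "\<forall>n. R (p n) (q n)" "p \<longlonglongrightarrow> u" "q \<longlonglongrightarrow> v"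
      "\<forall>n. R (p' n) (q' n)" "p' \<longlonglongrightarrow> u'" "q' \<longlonglongrightarrow> v'" using uv unfolding S_def by blast
    then show ?thesis unfolding S_def
      by (intro exI[of _ "\<lambda>n. p n + p' n"] exI[of _ "\<lambda>n. q n + q' n"]) (auto intro: add tendsto_add)
  qed
  have S_scale: "S (c *\<^sub>C u) (c *\<^sub>C v)" if uv: "S u v" for c u v
  proof -
    obtain p q where "\<forall>n. R (p n) (q n)" "p \<longlonglongrightarrow> u" "q \<longlonglongrightarrow> v" using uv unfolding S_def by blast
    then show ?thesis unfolding S_def
      by (intro exI[of _ "\<lambda>n. c *\<^sub>C p n"] exI[of _ "\<lambda>n. c *\<^sub>C q n"]) (auto intro: scale tendsto_scaleC)
  qed
  have S_unique: "v = v'" if "S u v" "S u v'" for u v v'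
  proof -
    have "S (u - u) (v - v')" using S_add[OF that(1) S_scale[OF that(2), of "-1"]] by (simp add: scaleC_one)
    then show ?thesis using S_bound by fastforce
  qed
  have S_ex: "\<exists>v. S u v" for u
  proof -
    obtain p where p: "\<And>n. \<exists>v. R (p n) v" "p \<longlonglongrightarrow> u"
      using dense closure_sequential[of u "{u. \<exists>v. R u v}"] by auto
    then obtain q where q: "\<And>n. R (p n) (q n)" by metis
    have "Cauchy p" using p(2) by (rule LIMSEQ_imp_Cauchy)
    have "Cauchy q"
    proof (rule CauchyI)
      fix e :: real assume "e > 0"
      then have "e / (K + 1) > 0" using K by simp
      then obtain M where M: "\<And>m n. m \<ge> M \<Longrightarrow> n \<ge> M \<Longrightarrow> norm (p m - p n) < e / (K + 1)"
        using CauchyD[OF \<open>Cauchy p\<close>] by blast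
      have "norm (q m - q n) < e" if "m \<ge> M" "n \<ge> M" for m n
      proof -
        have "norm (q m - q n) \<le> K * norm (p m - p n)" by (intro bound diff q)
        also have "\<dots> \<le> (K + 1) * norm (p m - p n)" by (intro mult_right_mono) auto
        also have "\<dots> < e" using M[OF that] K by (simp add: field_simps)
        finally show ?thesis .
      qed
      then show "\<exists>M. \<forall>m\<ge>M. \<forall>n\<ge>M. norm (q m - q n) < e" by blast
    qed
    then obtain v where "q \<longlonglongrightarrow> v" by (auto simp: Cauchy_convergent_iff convergent_def)
    then show ?thesis using p(2) q unfolding S_def by blast
  qed
  define f where "f u = (THE v. S u v)" for u
  have f: "f u = v \<longleftrightarrow> S u v" for u v
    unfolding f_def using S_ex S_unique by (metis the_equality)
  obtain A where A: "cop_apply A = f"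
  proof -
    have "f (u + v) = f u + f v" for u v unfolding f by (rule S_add) (use f in blast)+
    moreover have "f (c *\<^sub>C u) = c *\<^sub>C f u" for c u unfolding f by (rule S_scale) (use f in blast)
    moreover have "norm (f u) \<le> K * norm u" for u using S_bound f by blast
    ultimately show ?thesis using ex_cop[of f K] that by blast
  qed
  have "cop_apply A u = v" if "R u v" for u v
    unfolding A f S_def using that by (intro exI[of _ "\<lambda>_. u"] exI[of _ "\<lambda>_. v"]) auto
  moreover have "norm A \<le> K" by (rule norm_cop_bound[OF K]) (use A f S_bound in metis)
  ultimately show ?thesis by blast
qed

lemma cop_eq_on_dense:
  assumes "closure (complex_vector.span S) = UNIV" "\<And>x. x \<in> S \<Longrightarrow> cop_apply A x = cop_apply B x"
  shows "A = B"
proof (rule cop_eqI)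
  fix x
  have "closed {x. cop_apply A x = cop_apply B x}"
    by (intro closed_Collect_eq linear_continuous_on bounded_linear_cop_apply)
  moreover have "cop_apply A x = cop_apply B x" if "x \<in> complex_vector.span S" for x
    using that by (induction rule: complex_vector.span_induct_alt) (auto simp: assms(2))
  ultimately have "closure (complex_vector.span S) \<subseteq> {x. cop_apply A x = cop_apply B x}"
    by (intro closure_minimal) auto
  then show "cop_apply A x = cop_apply B x" using assms(1) by auto
qed

theorem ex_multiplier:
  assumes X: "\<And>\<alpha>. \<alpha> \<in> I \<Longrightarrow> complex_vector.subspace (X \<alpha>)"
    "closure (complex_vector.span (\<Union>\<alpha>\<in>I. X \<alpha>)) = UNIV"
    and ub: "unconditionality_bound I X C" "C \<ge> 0"
    and c: "\<And>\<alpha>. \<alpha> \<in> I \<Longrightarrow> norm (c \<alpha>) \<le> B" "B \<ge> 0"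
  shows "\<exists>M. (\<forall>\<alpha>\<in>I. \<forall>x\<in>X \<alpha>. cop_apply M x = c \<alpha> *\<^sub>C x) \<and> norm M \<le> 4 * C * B"
proof -
  define R where "R u v \<longleftrightarrow> (\<exists>F x. finite F \<and> F \<subseteq> I \<and> (\<forall>\<alpha>\<in>I. x \<alpha> \<in> X \<alpha>) \<and> (\<forall>\<alpha>. \<alpha> \<notin> F \<longrightarrow> x \<alpha> = 0) \<and>
     u = (\<Sum>\<alpha>\<in>F. x \<alpha>) \<and> v = (\<Sum>\<alpha>\<in>F. c \<alpha> *\<^sub>C x \<alpha>))" for u v
  have "\<exists>A. (\<forall>u v. R u v \<longrightarrow> cop_apply A u = v) \<and> norm A \<le> 4 * C * B"
  proof (rule cop_of_dense_graph)
    fix u v u' v' assume "R u v" "R u' v'"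
    from \<open>R u v\<close> obtain F x where F: "finite F" "F \<subseteq> I" "\<forall>\<alpha>\<in>I. x \<alpha> \<in> X \<alpha>" "\<forall>\<alpha>. \<alpha> \<notin> F \<longrightarrow> x \<alpha> = 0"
        "u = (\<Sum>\<alpha>\<in>F. x \<alpha>)" "v = (\<Sum>\<alpha>\<in>F. c \<alpha> *\<^sub>C x \<alpha>)" unfolding R_def by blast
    from \<open>R u' v'\<close> obtain F' x' where F': "finite F'" "F' \<subseteq> I" "\<forall>\<alpha>\<in>I. x' \<alpha> \<in> X \<alpha>" "\<forall>\<alpha>. \<alpha> \<notin> F' \<longrightarrow> x' \<alpha> = 0"
        "u' = (\<Sum>\<alpha>\<in>F'. x' \<alpha>)" "v' = (\<Sum>\<alpha>\<in>F'. c \<alpha> *\<^sub>C x' \<alpha>)" unfolding R_def by blast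
    have "u = (\<Sum>\<alpha>\<in>F \<union> F'. x \<alpha>)" "u' = (\<Sum>\<alpha>\<in>F \<union> F'. x' \<alpha>)"
      "v = (\<Sum>\<alpha>\<in>F \<union> F'. c \<alpha> *\<^sub>C x \<alpha>)" "v' = (\<Sum>\<alpha>\<in>F \<union> F'. c \<alpha> *\<^sub>C x' \<alpha>)"
      unfolding F(5,6) F'(5,6) using F(1,4) F'(1,4) by (auto intro!: sum.mono_neutral_left)
    then have "u + u' = (\<Sum>\<alpha>\<in>F \<union> F'. x \<alpha> + x' \<alpha>)" "v + v' = (\<Sum>\<alpha>\<in>F \<union> F'. c \<alpha> *\<^sub>C (x \<alpha> + x' \<alpha>))"
      by (simp_all add: sum.distrib scaleC_add_right)
    then show "R (u + u') (v + v')"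
      unfolding R_def using F F' X(1)
      by (intro exI[of _ "F \<union> F'"] exI[of _ "\<lambda>\<alpha>. x \<alpha> + x' \<alpha>"]) (auto intro: complex_vector.subspace_add)
  next
    fix d u v assume "R u v"
    then obtain F x where F: "finite F" "F \<subseteq> I" "\<forall>\<alpha>\<in>I. x \<alpha> \<in> X \<alpha>" "\<forall>\<alpha>. \<alpha> \<notin> F \<longrightarrow> x \<alpha> = 0"
        "u = (\<Sum>\<alpha>\<in>F. x \<alpha>)" "v = (\<Sum>\<alpha>\<in>F. c \<alpha> *\<^sub>C x \<alpha>)" unfolding R_def by blast
    then show "R (d *\<^sub>C u) (d *\<^sub>C v)"
      unfolding R_def using X(1)
      by (intro exI[of _ F] exI[of _ "\<lambda>\<alpha>. d *\<^sub>C x \<alpha>"])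
        (auto simp: complex_vector.scale_sum_right mult.commute intro: complex_vector.subspace_scale)
  next
    fix u v assume "R u v"
    then obtain F x where F: "finite F" "F \<subseteq> I" "\<forall>\<alpha>\<in>I. x \<alpha> \<in> X \<alpha>"
        "u = (\<Sum>\<alpha>\<in>F. x \<alpha>)" "v = (\<Sum>\<alpha>\<in>F. c \<alpha> *\<^sub>C x \<alpha>)" unfolding R_def by blast
    show "norm v \<le> 4 * C * B * norm u"
      unfolding F(4,5) using F(2,3) c ub(2) by (intro unconditional_coefficients[OF ub(1) F(1,2)]) auto
  next
    have "complex_vector.span (\<Union>\<alpha>\<in>I. X \<alpha>) \<subseteq> {u. \<exists>v. R u v}"
      using span_Union_subspaces[of I X] X(1) unfolding R_def by blast
    then show "closure {u. \<exists>v. R u v} = UNIV" using closure_mono X(2) by blast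
  qed (use ub c in simp)
  then obtain A where A: "\<And>u v. R u v \<Longrightarrow> cop_apply A u = v" "norm A \<le> 4 * C * B" by blast
  have "R x (c \<alpha> *\<^sub>C x)" if "\<alpha> \<in> I" "x \<in> X \<alpha>" for \<alpha> x
    unfolding R_def using that X(1)
    by (intro exI[of _ "{\<alpha>}"] exI[of _ "\<lambda>\<beta>. if \<beta> = \<alpha> then x else 0"]) (auto simp: complex_vector.subspace_0)
  then show ?thesis using A by blast
qed

section \<open>From an operator to a function of it\<close>

definition dense_root_spaces :: "'a::complex_banach cop \<Rightarrow> bool" where
  "dense_root_spaces A \<longleftrightarrow> closure (complex_vector.span (\<Union>\<mu>\<in>eigenvalues A. alg_root_space A \<mu>)) = UNIV"

text \<open>Both density of the span and the unconditional inequality may be checked on the algebraic root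
spaces.\<close>

lemma root_spaces_basis_cop:
  "root_spaces_basis (blinfun_of_cop A) \<longleftrightarrow> countable (eigenvalues A) \<and> dense_root_spaces A \<and>
     (\<exists>C>0. unconditionality_bound (eigenvalues A) (alg_root_space A) C)"
proof -
  let ?I = "eigenvalues A" and ?E = "alg_root_space A"
  have "complex_vector.subspace (closure (?E \<mu>))" for \<mu>
    by (intro closure_complex_subspace subspace_alg_root_space)
  moreover have "unconditionality_bound ?I (\<lambda>\<mu>. closure (?E \<mu>)) C \<longleftrightarrow> unconditionality_bound ?I ?E C" for C
  proof
    assume ub: "unconditionality_bound ?I (\<lambda>\<mu>. closure (?E \<mu>)) C"
    show "unconditionality_bound ?I ?E C"
      unfolding unconditionality_bound_def
      by (intro allI impI unconditionality_boundD[OF ub]) (auto intro: closure_subset[THEN subsetD])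
  qed (rule unconditionality_bound_closure)
  moreover have "closure (complex_vector.span (\<Union>\<mu>\<in>?I. closure (?E \<mu>))) = closure (complex_vector.span (\<Union>\<mu>\<in>?I. ?E \<mu>))"
  proof
    let ?S = "complex_vector.span (\<Union>\<mu>\<in>?I. ?E \<mu>)"
    have "closure (?E \<mu>) \<subseteq> closure ?S" if "\<mu> \<in> ?I" for \<mu>
      using that by (intro closure_mono) (auto intro: complex_vector.span_base)
    then have "complex_vector.span (\<Union>\<mu>\<in>?I. closure (?E \<mu>)) \<subseteq> closure ?S"
      by (intro complex_vector.span_minimal closure_complex_subspace) auto
    then show "closure (complex_vector.span (\<Union>\<mu>\<in>?I. closure (?E \<mu>))) \<subseteq> closure ?S"
      by (intro closure_minimal) auto
    show "closure ?S \<subseteq> closure (complex_vector.span (\<Union>\<mu>\<in>?I. closure (?E \<mu>)))"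
      using closure_subset by (intro closure_mono complex_vector.span_mono) blast
  qed
  moreover have "root_space (blinfun_of_cop A) = (\<lambda>\<mu>. closure (?E \<mu>))" by (rule ext) (rule root_space_cop)
  ultimately show ?thesis
    unfolding root_spaces_basis_def unconditional_basis_iff point_spectrum_cop dense_root_spaces_def by simp
qed

text \<open>A vector of the algebraic root space of \<open>f(T)\<close> at \<open>\<mu>\<close> is a sum of vectors from those of \<open>T\<close> at the points
of \<open>G {\<mu>}\<close>, and these finite sets of eigenvalues are disjoint for different \<open>\<mu>\<close>. So the inequality for
\<open>f(T)\<close> with index sets \<open>F1 \<subseteq> F2\<close> is the one for \<open>T\<close> with index sets \<open>G F1 \<subseteq> G F2\<close>, with the same
constant.\<close>

theorem root_spaces_basis_fcalc:
  fixes T :: "'a::complex_banach cop"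
  assumes D: "spectral_nbhd T \<Omega>" and f: "f holomorphic_on \<Omega>" and nc: "\<forall>U\<in>components \<Omega>. \<not> f constant_on U"
    and basis: "root_spaces_basis (blinfun_of_cop T)"
  shows "root_spaces_basis (blinfun_of_cop (fcalc \<Omega> f T))"
proof -
  let ?A = "fcalc \<Omega> f T" and ?I = "eigenvalues T"
  have cI: "countable ?I" and dense: "dense_root_spaces T" using basis by (auto simp: root_spaces_basis_cop)
  obtain C where C: "C > 0" and ub: "unconditionality_bound ?I (alg_root_space T) C"
    using basis by (auto simp: root_spaces_basis_cop)
  have eig: "eigenvalues ?A = f ` ?I" by (rule eigenvalues_fcalc[OF D f nc])
  have I\<Omega>: "?I \<subseteq> \<Omega>" using eigenvalues_subset_spectrum D by (auto simp: spectral_nbhd_def)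
  have "(\<Union>\<zeta>\<in>?I. alg_root_space T \<zeta>) \<subseteq> (\<Union>\<mu>\<in>eigenvalues ?A. alg_root_space ?A \<mu>)"
    unfolding eig using alg_root_space_fcalc[OF D f] I\<Omega> by blast
  then have "dense_root_spaces ?A"
    using dense closure_mono[OF complex_vector.span_mono] unfolding dense_root_spaces_def by blast
  moreover have "unconditionality_bound (eigenvalues ?A) (alg_root_space ?A) C"
    unfolding unconditionality_bound_def
  proof (intro allI impI)
    fix F1 F2 x
    assume F: "finite F2 \<and> F1 \<subseteq> F2 \<and> F2 \<subseteq> eigenvalues ?A \<and> (\<forall>\<mu>\<in>F2. x \<mu> \<in> alg_root_space ?A \<mu>)"
    let ?Z = "\<lambda>\<mu>. {\<zeta> \<in> alg_spectrum T. f \<zeta> = \<mu>}"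
    have "\<forall>\<mu>\<in>F2. \<exists>y. (\<forall>\<zeta>\<in>?Z \<mu>. y \<zeta> \<in> alg_root_space T \<zeta>) \<and> x \<mu> = (\<Sum>\<zeta>\<in>?Z \<mu>. y \<zeta>)"
      using F alg_root_space_fcalc_decomposition(2)[OF D f nc] by blast
    from bchoice[OF this] obtain y where y0: "\<forall>\<mu>\<in>F2. (\<forall>\<zeta>\<in>?Z \<mu>. y \<mu> \<zeta> \<in> alg_root_space T \<zeta>) \<and>
        x \<mu> = (\<Sum>\<zeta>\<in>?Z \<mu>. y \<mu> \<zeta>)" ..
    have y: "\<And>\<mu> \<zeta>. \<mu> \<in> F2 \<Longrightarrow> \<zeta> \<in> ?Z \<mu> \<Longrightarrow> y \<mu> \<zeta> \<in> alg_root_space T \<zeta>"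
        "\<And>\<mu>. \<mu> \<in> F2 \<Longrightarrow> x \<mu> = (\<Sum>\<zeta>\<in>?Z \<mu>. y \<mu> \<zeta>)"
      using y0 by simp_all
    define G where "G F = (\<Union>\<mu>\<in>F. ?Z \<mu> \<inter> ?I)" for F
    have fin: "finite (?Z \<mu>)" for \<mu> by (rule alg_root_space_fcalc_decomposition(1)[OF D f nc])
    have conv: "(\<Sum>\<mu>\<in>H. x \<mu>) = (\<Sum>\<zeta>\<in>G H. y (f \<zeta>) \<zeta>)" if H: "H \<subseteq> F2" for H
    proof -
      have "x \<mu> = (\<Sum>\<zeta>\<in>?Z \<mu> \<inter> ?I. y (f \<zeta>) \<zeta>)" if "\<mu> \<in> H" for \<mu>
      proof -
        have "(\<Sum>\<zeta>\<in>?Z \<mu> \<inter> ?I. y (f \<zeta>) \<zeta>) = (\<Sum>\<zeta>\<in>?Z \<mu> \<inter> ?I. y \<mu> \<zeta>)" by (intro sum.cong) auto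
        also have "\<dots> = (\<Sum>\<zeta>\<in>?Z \<mu>. y \<mu> \<zeta>)"
          using fin y(1)[of \<mu>] eigenvalue_of_root_vector that H by (intro sum.mono_neutral_left) blast+
        finally show ?thesis using y(2)[of \<mu>] that H by auto
      qed
      then have "(\<Sum>\<mu>\<in>H. x \<mu>) = (\<Sum>\<mu>\<in>H. \<Sum>\<zeta>\<in>?Z \<mu> \<inter> ?I. y (f \<zeta>) \<zeta>)" by (rule sum.cong[OF refl])
      also have "\<dots> = (\<Sum>\<zeta>\<in>G H. y (f \<zeta>) \<zeta>)"
        unfolding G_def using F H fin
        by (intro sum.UNION_disjoint[symmetric]) (auto intro: finite_subset)
      finally show ?thesis .
    qed
    have "finite (G F2)" unfolding G_def using F fin by auto
    then have "norm (\<Sum>\<zeta>\<in>G F1. y (f \<zeta>) \<zeta>) \<le> C * norm (\<Sum>\<zeta>\<in>G F2. y (f \<zeta>) \<zeta>)"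
      using F y(1) by (intro unconditionality_boundD[OF ub]) (auto simp: G_def)
    then show "norm (\<Sum>\<mu>\<in>F1. x \<mu>) \<le> C * norm (\<Sum>\<mu>\<in>F2. x \<mu>)" using conv F by auto
  qed
  ultimately show ?thesis
    using cI C by (auto simp: root_spaces_basis_cop eig)
qed

definition root_multiplier :: "'a::complex_banach cop \<Rightarrow> (complex \<Rightarrow> complex) \<Rightarrow> 'a cop \<Rightarrow> bool" where
  "root_multiplier A c M \<longleftrightarrow> (\<forall>\<mu>\<in>eigenvalues A. \<forall>x\<in>alg_root_space A \<mu>. cop_apply M x = c \<mu> *\<^sub>C x)"

lemma root_multiplier_unique:
  assumes "dense_root_spaces A" "root_multiplier A c M" "root_multiplier A c' M'"
    and "\<And>\<mu>. \<mu> \<in> eigenvalues A \<Longrightarrow> c \<mu> = c' \<mu>"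
  shows "M = M'"
  using assms(1) unfolding dense_root_spaces_def
  by (rule cop_eq_on_dense) (use assms(2-4) in \<open>auto simp: root_multiplier_def\<close>)

text \<open>An operator commuting with \<open>A\<close> maps the root spaces of \<open>A\<close> to themselves, and there multipliers are
scalar.\<close>

lemma root_multiplier_commute:
  assumes dense: "dense_root_spaces A" and M: "root_multiplier A c M" and B: "B * A = A * B"
  shows "B * M = M * B"
  using dense unfolding dense_root_spaces_def
proof (rule cop_eq_on_dense)
  fix x assume "x \<in> (\<Union>\<mu>\<in>eigenvalues A. alg_root_space A \<mu>)"
  then obtain \<mu> where \<mu>: "\<mu> \<in> eigenvalues A" "x \<in> alg_root_space A \<mu>" by blast
  then have "cop_apply B x \<in> alg_root_space A \<mu>" by (intro alg_root_space_invariant[OF B])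
  then show "cop_apply (B * M) x = cop_apply (M * B) x" using M \<mu> by (simp add: root_multiplier_def)
qed

lemma root_multiplier_one: "root_multiplier A (\<lambda>\<mu>. 1) 1"
  by (simp add: root_multiplier_def scaleC_one)

lemma root_multiplier_const: "root_multiplier A (\<lambda>\<mu>. z) (z *\<^sub>C 1)"
  by (simp add: root_multiplier_def)

lemma root_multiplier_diff:
  "root_multiplier A c M \<Longrightarrow> root_multiplier A c' M' \<Longrightarrow> root_multiplier A (\<lambda>\<mu>. c \<mu> - c' \<mu>) (M - M')"
  by (simp add: root_multiplier_def complex_vector.scale_left_diff_distrib)

lemma root_multiplier_mult:
  "root_multiplier A c M \<Longrightarrow> root_multiplier A c' M' \<Longrightarrow> root_multiplier A (\<lambda>\<mu>. c \<mu> * c' \<mu>) (M * M')"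
  by (simp add: root_multiplier_def mult.commute)

lemma root_multiplier_power:
  "root_multiplier A c M \<Longrightarrow> root_multiplier A (\<lambda>\<mu>. c \<mu> ^ n) (M ^ n)"
  by (induction n) (simp_all add: root_multiplier_one root_multiplier_mult)

lemma ex_root_multiplier:
  assumes "dense_root_spaces A" "unconditionality_bound (eigenvalues A) (alg_root_space A) C" "C \<ge> 0"
    and "\<And>\<mu>. \<mu> \<in> eigenvalues A \<Longrightarrow> norm (c \<mu>) \<le> B" "B \<ge> 0"
  shows "\<exists>M. root_multiplier A c M \<and> norm M \<le> 4 * C * B"
  unfolding root_multiplier_def
  by (rule ex_multiplier) (use assms subspace_alg_root_space in \<open>auto simp: dense_root_spaces_def\<close>)

lemma root_multiplier_closure:
  assumes "root_multiplier A c M" "\<mu> \<in> eigenvalues A" "x \<in> closure (alg_root_space A \<mu>)"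
  shows "cop_apply M x = c \<mu> *\<^sub>C x"
proof -
  have "closed {x. cop_apply M x = c \<mu> *\<^sub>C x}"
    by (intro closed_Collect_eq linear_continuous_on bounded_linear_cop_apply bounded_linear_scaleC)
  then have "closure (alg_root_space A \<mu>) \<subseteq> {x. cop_apply M x = c \<mu> *\<^sub>C x}"
    using assms(1,2) by (intro closure_minimal) (auto simp: root_multiplier_def)
  with assms(3) show ?thesis by blast
qed

lemma eigenvalue_bound: "\<mu> \<in> eigenvalues A \<Longrightarrow> norm \<mu> \<le> norm A"
  using eigenvalues_subset_spectrum[of A] alg_resolvent_large(1)[of A \<mu>] by (auto simp: not_le[symmetric])

lemma scalar_part_cop:
  assumes "root_spaces_basis (blinfun_of_cop A)"
  shows "\<exists>S. root_multiplier A (\<lambda>\<mu>. \<mu>) S \<and> scalar_part (blinfun_of_cop A) = blinfun_of_cop S"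
proof -
  have dense: "dense_root_spaces A" using assms by (simp add: root_spaces_basis_cop)
  obtain C where C: "C > 0" "unconditionality_bound (eigenvalues A) (alg_root_space A) C"
    using assms by (auto simp: root_spaces_basis_cop)
  have "\<exists>S. root_multiplier A (\<lambda>\<mu>. \<mu>) S \<and> norm S \<le> 4 * C * norm A"
    using C eigenvalue_bound by (intro ex_root_multiplier[OF dense]) auto
  then obtain S where S: "root_multiplier A (\<lambda>\<mu>. \<mu>) S" by blast
  have "scalar_part (blinfun_of_cop A) = blinfun_of_cop S"
    unfolding scalar_part_def point_spectrum_cop root_space_cop
  proof (rule the_equality)
    show "complex_linear (blinfun_of_cop S) \<and>
        (\<forall>\<mu>\<in>eigenvalues A. \<forall>x\<in>closure (alg_root_space A \<mu>). blinfun_apply (blinfun_of_cop S) x = \<mu> *\<^sub>C x)"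
      using root_multiplier_closure[OF S] blinfun_of_cop[of S] by (simp add: cop_apply_def)
  next
    fix S' assume S': "complex_linear S' \<and>
        (\<forall>\<mu>\<in>eigenvalues A. \<forall>x\<in>closure (alg_root_space A \<mu>). blinfun_apply S' x = \<mu> *\<^sub>C x)"
    then have eq: "blinfun_of_cop (Cop S') = S'" by (simp add: Cop_inverse)
    then have "root_multiplier A (\<lambda>\<mu>. \<mu>) (Cop S')"
      using S' closure_subset by (auto simp: root_multiplier_def cop_apply_def)
    then have "Cop S' = S" using root_multiplier_unique[OF dense _ S] by blast
    then show "S' = blinfun_of_cop S" using eq by simp
  qed
  with S show ?thesis by blast
qed

lemma good_discrete_cop:
  assumes "root_multiplier A (\<lambda>\<mu>. \<mu>) S"
  shows "good_discrete (blinfun_of_cop A) \<longleftrightarrow>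
    root_spaces_basis (blinfun_of_cop A) \<and> alg_spectrum (A - S) \<subseteq> {0}"
proof (cases "root_spaces_basis (blinfun_of_cop A)")
  case True
  then obtain S' where S': "root_multiplier A (\<lambda>\<mu>. \<mu>) S'" "scalar_part (blinfun_of_cop A) = blinfun_of_cop S'"
    using scalar_part_cop by blast
  have "dense_root_spaces A" and "countable (eigenvalues A)" using True by (auto simp: root_spaces_basis_cop)
  then have "S' = S" using root_multiplier_unique[OF _ S'(1) assms] by blast
  then show ?thesis
    using S'(2) True \<open>countable (eigenvalues A)\<close>
    by (simp add: good_discrete_def quasinilpotent_def point_spectrum_cop minus_cop.rep_eq[symmetric] spectrum_cop)
qed (simp add: good_discrete_def)

section \<open>Local spectral projections\<close>

text \<open>The powers of \<open>N * J\<close> decay like those of \<open>N\<close>, faster than any geometric sequence.\<close>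

lemma quasinilpotent_one_minus:
  fixes N J :: "'a::complex_banach_algebra"
  assumes N: "alg_spectrum N \<subseteq> {0}" and NJ: "N * J = J * N"
  shows "\<exists>b. inverse_pair (1 - N * J) b"
proof -
  \<comment> \<open>any \<open>d > 0\<close> with \<open>d * norm J < 1\<close> would do\<close>
  define d where "d = 1 / (2 * (norm J + 1))"
  have J1: "norm J + 1 > 0" by (simp add: add_nonneg_pos)
  have d: "d > 0" "d * norm J < 1"
    using J1 by (auto simp: d_def divide_less_eq)
  have "alg_spectrum N \<subseteq> ball 0 d" using N d(1) by force
  from power_bound_of_spectrum[OF this] obtain C where C: "C \<ge> 0" "\<And>n. norm (N ^ n) \<le> C * d ^ n"
    by auto
  have "norm ((N * J) ^ n) \<le> (C * norm (1 :: 'a)) * (d * norm J) ^ n" for n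
  proof -
    have "norm ((N * J) ^ n) \<le> norm (N ^ n) * norm (J ^ n)"
      using commuting_power_mult[OF NJ] norm_mult_ineq by metis
    also have "\<dots> \<le> (C * d ^ n) * (norm (1 :: 'a) * norm J ^ n)"
      using C(1) C(2)[of n] d(1) by (intro mult_mono norm_power_le) auto
    finally show ?thesis by (simp add: power_mult_distrib mult_ac)
  qed
  from summable_powers_of_bound[OF this] show ?thesis
    using d inverse_pair_geometric by (metis mult_nonneg_nonneg norm_ge_zero less_imp_le)
qed

lemma power_eq_on_projection:
  fixes a b p :: "'a::complex_banach_algebra"
  assumes "a * p = b * p" "b * p = p * b"
  shows "a ^ n * p = b ^ n * p"
proof (induction n)
  case (Suc n)
  have "a ^ Suc n * p = a * (p * b ^ n)"
    using Suc commuting_power[OF assms(2), of n] by (simp add: mult.assoc)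
  also have "\<dots> = b * (p * b ^ n)" using assms(1) by (simp add: mult.assoc[symmetric])
  also have "\<dots> = b ^ Suc n * p" using commuting_power[OF assms(2), of n] by (simp add: mult.assoc)
  finally show ?case .
qed simp

text \<open>With respect to the decomposition given by the idempotent \<open>p\<close> the element is \<open>a\<close>, with inverse \<open>B\<close>, on one
part and the scalar \<open>c\<close> on the other.\<close>

lemma inverse_pair_on_split:
  fixes a p B :: "'a::complex_banach_algebra"
  assumes p: "p * p = p" and "c \<noteq> 0" and aB: "a * B = p"
    and com: "a * p = p * a" "B * p = p * B" "B * a = a * B"
  shows "\<exists>b. inverse_pair (a * p + c *\<^sub>C (1 - p)) b"
proof -
  let ?b = "B * p + inverse c *\<^sub>C (1 - p)"
  have z: "p * (1 - p) = 0" "(1 - p) * p = 0" "(1 - p) * (1 - p) = 1 - p"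
    using p by (simp_all add: algebra_simps)
  have l: "(a * p) * (B * p) = p" "(B * p) * (a * p) = p"
    using p aB com by (metis mult.assoc)+
  have m: "(a * p) * (1 - p) = 0" "(1 - p) * (B * p) = 0" "(B * p) * (1 - p) = 0" "(1 - p) * (a * p) = 0"
    using z com by (metis mult.assoc mult_zero_left mult_zero_right)+
  have "(a * p + c *\<^sub>C (1 - p)) * ?b = 1" "?b * (a * p + c *\<^sub>C (1 - p)) = 1"
    using l m z assms(2)
    by (simp_all only: distrib_left distrib_right scaleC_mult_left mult_scaleC_right) (simp_all add: scaleC_scaleC scaleC_one)
  then show ?thesis unfolding inverse_pair_def by blast
qed

text \<open>The operator \<open>B\<close> inverts \<open>z - T\<close> on the range of \<open>P\<close>. First invert \<open>f(z) - A\<close> there: the multiplier \<open>J\<close> with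
values \<open>1/(f(z) - \<mu>)\<close>, \<open>\<mu> \<in> V\<close>, inverts \<open>f(z) - S\<close>, and the quasinilpotent perturbation \<open>A - S\<close> is absorbed by
the factor \<open>(1 - N J)\<^sup>-\<^sup>1\<close>. As \<open>f(z) - A\<close> is a multiple of \<open>z - T\<close>, this suffices.\<close>

lemma resolvent_factor_on_spectral_subset:
  fixes T :: "'a::complex_banach cop"
  assumes D: "spectral_nbhd T \<Omega>" and f: "f holomorphic_on \<Omega>" and A: "A = fcalc \<Omega> f T"
    and dense: "dense_root_spaces A"
    and ub: "unconditionality_bound (eigenvalues A) (alg_root_space A) C" "C \<ge> 0"
    and S: "root_multiplier A (\<lambda>\<mu>. \<mu>) S" and N: "alg_spectrum (A - S) \<subseteq> {0}"
    and P: "root_multiplier A (\<lambda>\<mu>. if \<mu> \<in> V then 1 else 0) P"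
    and z: "z \<in> \<Omega>" and d: "d > 0" "\<And>\<mu>. \<mu> \<in> V \<Longrightarrow> d \<le> norm (f z - \<mu>)"
  shows "\<exists>B. (z *\<^sub>C 1 - T) * B = P \<and> B * T = T * B \<and> B * P = P * B"
proof -
  note com = root_multiplier_commute[OF dense]
  have TA: "T * A = A * T" unfolding A using fcalc_commute[OF D f, of T] by simp
  define c where "c \<mu> = (if \<mu> \<in> V then 1 / (f z - \<mu>) else 0)" for \<mu>
  have "norm (c \<mu>) \<le> 1 / d" for \<mu>
    using d(1) d(2)[of \<mu>] by (auto simp: c_def norm_divide intro: frac_le)
  then have "\<exists>J. root_multiplier A c J \<and> norm J \<le> 4 * C * (1 / d)"
    using d(1) by (intro ex_root_multiplier[OF dense ub]) auto
  then obtain J where J: "root_multiplier A c J" by blast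
  have SA: "S * A = A * S" and JA: "J * A = A * J" and PA: "P * A = A * P"
    using com[OF S, of A] com[OF J, of A] com[OF P, of A] by simp_all
  define N where "N = A - S"
  have NJ: "N * J = J * N" and NP: "N * P = P * N" and TN: "T * N = N * T"
    using com[OF J SA] com[OF P SA] JA PA com[OF S TA] TA by (simp_all add: N_def algebra_simps)
  have JP: "J * P = P * J" using com[OF P JA] .
  have TJ: "T * J = J * T" and TP: "T * P = P * T" using com[OF J TA] com[OF P TA] by simp_all
  have PJ: "P * J = J"
    using root_multiplier_unique[OF dense root_multiplier_mult[OF P J] J] by (auto simp: c_def)
  have fS: "(f z *\<^sub>C 1 - S) * J = P"
  proof (rule root_multiplier_unique[OF dense root_multiplier_mult[OF root_multiplier_diff[OF root_multiplier_const S] J] P])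
    show "(f z - \<mu>) * c \<mu> = (if \<mu> \<in> V then 1 else 0)" for \<mu>
      using d(1) d(2)[of \<mu>] by (auto simp: c_def)
  qed
  obtain b where b: "inverse_pair (1 - N * J) b"
    using quasinilpotent_one_minus[OF _ NJ] N by (auto simp: N_def)
  have bT: "b * T = T * b" and bP: "b * P = P * b"
    using TN TJ NP JP by (intro inverse_pair_commute[OF b]; simp add: left_diff_distrib right_diff_distrib; metis mult.assoc)+
  have fA: "(f z *\<^sub>C 1 - A) * (J * b) = P"
  proof -
    have "(f z *\<^sub>C 1 - A) * J = (f z *\<^sub>C 1 - S) * J - N * J" by (simp add: N_def algebra_simps)
    also have "\<dots> = P - N * (P * J)" unfolding fS PJ ..
    also have "\<dots> = P * (1 - N * J)" using NP by (metis mult.assoc right_diff_distrib mult_1_right)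
    finally have "(f z *\<^sub>C 1 - A) * (J * b) = P * ((1 - N * J) * b)" by (metis mult.assoc)
    then show ?thesis using b by (simp add: inverse_pair_def)
  qed
  obtain K where K: "A = f z *\<^sub>C 1 + (T - z *\<^sub>C 1) * K" "\<And>B. T * B = B * T \<Longrightarrow> K * B = B * K"
    using fcalc_divided_difference[OF D f z] unfolding A by blast
  have "f z *\<^sub>C 1 - A = (z *\<^sub>C 1 - T) * K" unfolding K(1) by (simp add: algebra_simps)
  then have "(z *\<^sub>C 1 - T) * (K * (J * b)) = P" using fA by (simp add: mult.assoc)
  moreover have KT: "K * T = T * K" and KP: "K * P = P * K" using K(2) TP by auto
  have "K * (J * b) * T = T * (K * (J * b))" using KT TJ bT by (metis mult.assoc)
  moreover have "K * (J * b) * P = P * (K * (J * b))" using KP JP bP by (metis mult.assoc)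
  ultimately show ?thesis by blast
qed

text \<open>On the range of \<open>P\<close> the operator \<open>T\<close> has spectrum in \<open>G1 \<union> G2\<close>, where \<open>G1\<close> is a small disc around \<open>\<zeta>\<close> and \<open>G2\<close> the
exterior of a larger one. To stay within the algebra of operators on the whole space, the restriction
of \<open>T\<close> to that range is replaced by \<open>TV = T P + \<zeta> (1 - P)\<close>, which adds at most the point \<open>\<zeta> \<in> G1\<close> to the
spectrum. The function \<open>q\<close>, equal to 1 on \<open>G1\<close> and 0 on \<open>G2\<close>, is holomorphic on \<open>G1 \<union> G2\<close>, and \<open>E = q(TV) P\<close>.
On a vector annihilated by \<open>(TV - z)\<^sup>n\<close> the operator \<open>q(TV)\<close> is multiplication by \<open>q(z)\<close>, because
\<open>q - q(z)\<close> is divisible by the \<open>n\<close>-th power of the linear function that vanishes at \<open>z\<close>. The power bound is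
\<open>fcalc_bound\<close> for the functions \<open>(w - \<zeta>)\<^sup>n q(w)\<close>.\<close>

lemma local_spectral_projection:
  fixes T :: "'a::complex_banach cop"
  assumes D: "spectral_nbhd T \<Omega>" and f: "f holomorphic_on \<Omega>" and nc: "\<forall>U\<in>components \<Omega>. \<not> f constant_on U"
    and A: "A = fcalc \<Omega> f T"
    and dense: "dense_root_spaces A"
    and ub: "unconditionality_bound (eigenvalues A) (alg_root_space A) C" "C \<ge> 0"
    and S: "root_multiplier A (\<lambda>\<mu>. \<mu>) S" and N: "alg_spectrum (A - S) \<subseteq> {0}"
    and \<zeta>: "\<zeta> \<in> alg_spectrum T" "deriv f \<zeta> \<noteq> 0" and e: "e > 0"
  shows "\<exists>U E C'. open U \<and> \<zeta> \<in> U \<and> U \<subseteq> ball \<zeta> e \<and> inj_on f U \<and>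
    root_multiplier T (\<lambda>z. if z \<in> U then 1 else 0) E \<and>
    (\<forall>n. norm ((T - \<zeta> *\<^sub>C 1) ^ n * E) \<le> C' * e ^ n)"
proof -
  note com = root_multiplier_commute[OF dense]
  have \<Omega>: "open \<Omega>" "alg_spectrum T \<subseteq> \<Omega>" using D by (auto simp: spectral_nbhd_def)
  have TA: "T * A = A * T" unfolding A using fcalc_commute[OF D f, of T] by simp
  obtain r where r: "r > 0" "ball \<zeta> r \<subseteq> \<Omega>" "inj_on f (ball \<zeta> r)"
    using has_complex_derivative_locally_injective[OF f _ \<Omega>(1) \<zeta>(2)] \<zeta>(1) \<Omega>(2) by blast
  define \<epsilon> where "\<epsilon> = min (r / 2) e"
  have \<epsilon>: "\<epsilon> > 0" "\<epsilon> < r" "\<epsilon> \<le> e" using r(1) e by (auto simp: \<epsilon>_def)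
  define G1 G2 where "G1 = ball \<zeta> (\<epsilon> / 2)" and "G2 = - cball \<zeta> \<epsilon>"
  have G: "open G1" "open G2" "G1 \<inter> G2 = {}" using \<epsilon> by (auto simp: G1_def G2_def)
  have G1r: "G1 \<subseteq> ball \<zeta> r" "G1 \<subseteq> ball \<zeta> e" using \<epsilon> by (auto simp: G1_def)
  \<comment> \<open>the part of the spectrum that has to be avoided; injectivity keeps \<open>f\<close> away from \<open>f \<zeta>\<close> on it\<close>
  define K1 where "K1 = alg_spectrum T \<inter> (cball \<zeta> \<epsilon> - G1)"
  have K1: "compact K1" unfolding K1_def
    using G(1) by (intro compact_Int compact_alg_spectrum compact_diff) auto
  have "closed (f ` K1)"
    using K1 \<Omega>(2) by (intro compact_imp_closed compact_continuous_image continuous_on_subset[OF holomorphic_on_imp_continuous_on[OF f]])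
      (auto simp: K1_def)
  moreover have "f \<zeta> \<notin> f ` K1"
  proof
    assume "f \<zeta> \<in> f ` K1"
    then obtain w where w: "w \<in> K1" "f w = f \<zeta>" by auto
    then have "w \<in> ball \<zeta> r" using \<epsilon> by (auto simp: K1_def)
    then have "w = \<zeta>" using r(1,3) w(2) by (auto dest: inj_onD)
    then show False using w(1) \<epsilon> by (auto simp: K1_def G1_def)
  qed
  ultimately obtain d where d: "d > 0" "\<And>w. w \<in> K1 \<Longrightarrow> d \<le> dist (f \<zeta>) (f w)"
    using separate_point_closed[of "f ` K1" "f \<zeta>"] by auto
  define V where "V = ball (f \<zeta>) (d / 2)"
  have "\<exists>P. root_multiplier A (\<lambda>\<mu>. if \<mu> \<in> V then 1 else 0) P \<and> norm P \<le> 4 * C * 1"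
    by (intro ex_root_multiplier[OF dense ub]) auto
  then obtain P where P: "root_multiplier A (\<lambda>\<mu>. if \<mu> \<in> V then 1 else 0) P" by blast
  have PP: "P * P = P"
    by (rule root_multiplier_unique[OF dense root_multiplier_mult[OF P P] P]) auto
  have TP: "T * P = P * T" using com[OF P TA] .
  define TV where "TV = T * P + \<zeta> *\<^sub>C (1 - P)"
  have TVP: "TV * P = T * P" unfolding TV_def using PP by (simp add: distrib_right left_diff_distrib mult.assoc scaleC_mult_left)
  have PTV: "P * TV = TV * P" unfolding TV_def using PP TP
    by (simp add: distrib_right distrib_left left_diff_distrib right_diff_distrib mult.assoc scaleC_mult_left mult_scaleC_right)
  have spec: "alg_spectrum TV \<subseteq> G1 \<union> G2"
  proof
    fix z assume z: "z \<in> alg_spectrum TV"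
    show "z \<in> G1 \<union> G2"
    proof (rule ccontr)
      assume nG: "z \<notin> G1 \<union> G2"
      then have z\<zeta>: "z - \<zeta> \<noteq> 0" using \<epsilon> by (auto simp: G1_def)
      have "\<exists>B. (z *\<^sub>C 1 - T) * B = P \<and> B * T = T * B \<and> B * P = P * B"
      proof (cases "z \<in> alg_spectrum T")
        case True
        then have "z \<in> K1" using nG by (auto simp: K1_def G2_def)
        have "d / 2 \<le> norm (f z - \<mu>)" if "\<mu> \<in> V" for \<mu>
          using d(2)[OF \<open>z \<in> K1\<close>] that dist_triangle[of "f \<zeta>" "f z" \<mu>]
          by (simp add: V_def dist_norm norm_minus_commute)
        then show ?thesis
          using True \<Omega>(2) d(1)
          by (intro resolvent_factor_on_spectral_subset[OF D f A dense ub S N P, of z "d / 2"]) auto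
      next
        case False
        let ?R = "alg_resolvent T z"
        have R: "inverse_pair (z *\<^sub>C 1 - T) ?R" by (rule inverse_pair_resolvent[OF False])
        have "?R * T = T * ?R" "?R * P = P * ?R"
          using TP by (intro inverse_pair_commute[OF R]; simp add: alg_distribs)+
        then show ?thesis
          using R TP PP unfolding inverse_pair_def
          by (intro exI[of _ "?R * P"]) (metis mult.assoc mult_1_left)
      qed
      then obtain B where B: "(z *\<^sub>C 1 - T) * B = P" "B * T = T * B" "B * P = P * B" by blast
      have "\<exists>b. inverse_pair ((z *\<^sub>C 1 - T) * P + (z - \<zeta>) *\<^sub>C (1 - P)) b"
        using B TP by (intro inverse_pair_on_split[OF PP z\<zeta> B(1)])
          (auto simp: alg_distribs)
      moreover have "(z *\<^sub>C 1 - T) * P + (z - \<zeta>) *\<^sub>C (1 - P) = z *\<^sub>C 1 - TV"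
        by (simp add: TV_def algebra_simps scaleC_mult_left)
      ultimately show False using z not_in_alg_spectrum by metis
    qed
  qed
  have DV: "spectral_nbhd TV (G1 \<union> G2)" using spec G by (auto simp: spectral_nbhd_def)
  have piecewise: "(\<lambda>z. if z \<in> G1 then g1 z else g2 z) holomorphic_on (G1 \<union> G2)"
    if "g1 holomorphic_on G1" "g2 holomorphic_on G2" for g1 g2 :: "complex \<Rightarrow> complex"
  proof (rule holomorphic_on_Un)
    show "(\<lambda>z. if z \<in> G1 then g1 z else g2 z) holomorphic_on G1"
      using that(1) by (rule holomorphic_transform) simp
    show "(\<lambda>z. if z \<in> G1 then g1 z else g2 z) holomorphic_on G2"
      using that(2) by (rule holomorphic_transform) (use G(3) in auto)
  qed (use G in auto)
  define q where "q z = (if z \<in> G1 then 1 else 0 :: complex)" for z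
  have q: "q holomorphic_on (G1 \<union> G2)" unfolding q_def by (rule piecewise) auto
  define Q where "Q = fcalc (G1 \<union> G2) q TV"
  have QP: "Q * P = P * Q" unfolding Q_def using PTV by (intro fcalc_commute[OF DV q]) simp
  define U where "U = \<Omega> \<inter> f -` V \<inter> G1"
  have "open U" unfolding U_def
    using \<Omega>(1) G(1) by (intro open_Int continuous_open_preimage holomorphic_on_imp_continuous_on f) (auto simp: V_def)
  moreover have "\<zeta> \<in> U" using \<zeta>(1) \<Omega>(2) d(1) \<epsilon> by (auto simp: U_def V_def G1_def)
  moreover have "U \<subseteq> ball \<zeta> e" using G1r(2) by (auto simp: U_def)
  moreover have "inj_on f U" using r(3) G1r(1) by (auto simp: U_def intro: inj_on_subset)
  moreover have "root_multiplier T (\<lambda>z. if z \<in> U then 1 else 0) (Q * P)"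
    unfolding root_multiplier_def
  proof (intro ballI)
    fix z x assume z: "z \<in> eigenvalues T" and x: "x \<in> alg_root_space T z"
    have z\<sigma>: "z \<in> alg_spectrum T" using z eigenvalues_subset_spectrum by blast
    then have z\<Omega>: "z \<in> \<Omega>" using \<Omega>(2) by blast
    have fz: "f z \<in> eigenvalues A" "x \<in> alg_root_space A (f z)"
      using z x eigenvalues_fcalc[OF D f nc] alg_root_space_fcalc[OF D f z\<Omega>] unfolding A by auto
    show "cop_apply (Q * P) x = (if z \<in> U then 1 else 0) *\<^sub>C x"
    proof (cases "f z \<in> V")
      case False
      then have "cop_apply P x = 0" using P fz by (simp add: root_multiplier_def)
      then show ?thesis using False by (simp add: U_def)
    next
      case True
      then have Px: "cop_apply P x = x" using P fz by (simp add: root_multiplier_def scaleC_one)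
      obtain n where n: "cop_apply ((T - z *\<^sub>C 1) ^ n) x = 0" using x by (auto simp: alg_root_space_def)
      have "(TV - z *\<^sub>C 1) ^ n * P = (T - z *\<^sub>C 1) ^ n * P"
        using TVP TP by (intro power_eq_on_projection)
          (simp_all add: alg_distribs)
      then have nV: "cop_apply ((TV - z *\<^sub>C 1) ^ n) x = 0"
        using n Px by (metis cop_apply_simps(8))
      have "z \<notin> K1" using d(1) d(2)[of z] True by (force simp: V_def)
      then consider "z \<in> G1" | "z \<in> G2" "z \<notin> G1" using z\<sigma> by (auto simp: K1_def G2_def)
      then have "cop_apply Q x = (if z \<in> G1 then 1 else 0) *\<^sub>C x"
      proof cases
        case 1
        \<comment> \<open>\<open>q - 1 = (w - z)\<^sup>n k\<close>, with \<open>z\<close> outside \<open>G2\<close>\<close>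
        let ?k = "\<lambda>w. if w \<in> G1 then 0 else - (1 / (w - z) ^ n)"
        have k: "?k holomorphic_on (G1 \<union> G2)"
          using 1 G(3) by (intro piecewise holomorphic_intros) auto
        have kn: "(\<lambda>w. (w - z) ^ n * ?k w) holomorphic_on (G1 \<union> G2)" by (intro holomorphic_intros k)
        have "Q = fcalc (G1 \<union> G2) (\<lambda>w. 1 + (w - z) ^ n * ?k w) TV"
          unfolding Q_def using 1 G(3) by (intro fcalc_cong[OF DV q]) (auto simp: q_def)
        also have "\<dots> = 1 + (TV - z *\<^sub>C 1) ^ n * fcalc (G1 \<union> G2) ?k TV"
          by (simp only: fcalc_add[OF DV holomorphic_on_const kn] fcalc_one[OF DV] fcalc_shift_power_mult[OF DV k])
        also have "(TV - z *\<^sub>C 1) ^ n * fcalc (G1 \<union> G2) ?k TV = fcalc (G1 \<union> G2) ?k TV * (TV - z *\<^sub>C 1) ^ n"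
          by (intro commuting_power fcalc_commute[OF DV k, symmetric])
            (simp add: alg_distribs)
        finally show ?thesis using nV 1 by (simp add: scaleC_one)
      next
        case 2
        \<comment> \<open>\<open>q = (w - z)\<^sup>n k\<close>, with \<open>z\<close> outside \<open>G1\<close>\<close>
        let ?k = "\<lambda>w. if w \<in> G1 then 1 / (w - z) ^ n else 0"
        have k: "?k holomorphic_on (G1 \<union> G2)"
          using 2 by (intro piecewise holomorphic_intros) auto
        have "Q = fcalc (G1 \<union> G2) (\<lambda>w. (w - z) ^ n * ?k w) TV"
          unfolding Q_def using 2 by (intro fcalc_cong[OF DV q]) (auto simp: q_def)
        also have "\<dots> = (TV - z *\<^sub>C 1) ^ n * fcalc (G1 \<union> G2) ?k TV"
          by (rule fcalc_shift_power_mult[OF DV k])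
        also have "\<dots> = fcalc (G1 \<union> G2) ?k TV * (TV - z *\<^sub>C 1) ^ n"
          by (intro commuting_power fcalc_commute[OF DV k, symmetric])
            (simp add: alg_distribs)
        finally show ?thesis using nV 2 by simp
      qed
      then show ?thesis using Px True z\<Omega> by (simp add: U_def)
    qed
  qed
  moreover
  obtain C1 where C1: "C1 \<ge> 0" "\<And>g B. g holomorphic_on (G1 \<union> G2) \<Longrightarrow> (\<forall>z\<in>G1 \<union> G2. norm (g z) \<le> B) \<Longrightarrow>
      norm (fcalc (G1 \<union> G2) g TV) \<le> C1 * B"
    using fcalc_bound[OF DV] by blast
  have "norm ((T - \<zeta> *\<^sub>C 1) ^ n * (Q * P)) \<le> (C1 * norm P) * e ^ n" for n
  proof -
    have "(TV - \<zeta> *\<^sub>C 1) ^ n * P = (T - \<zeta> *\<^sub>C 1) ^ n * P"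
      using TVP TP by (intro power_eq_on_projection)
        (simp_all add: alg_distribs)
    moreover have "(TV - \<zeta> *\<^sub>C 1) ^ n * Q = fcalc (G1 \<union> G2) (\<lambda>z. (z - \<zeta>) ^ n * q z) TV"
      unfolding Q_def by (rule fcalc_shift_power_mult[OF DV q, symmetric])
    moreover have "(T - \<zeta> *\<^sub>C 1) ^ n * (Q * P) = ((T - \<zeta> *\<^sub>C 1) ^ n * P) * Q"
      by (simp only: QP mult.assoc)
    moreover have "((TV - \<zeta> *\<^sub>C 1) ^ n * P) * Q = ((TV - \<zeta> *\<^sub>C 1) ^ n * Q) * P"
      by (simp only: QP mult.assoc)
    ultimately have "(T - \<zeta> *\<^sub>C 1) ^ n * (Q * P) = fcalc (G1 \<union> G2) (\<lambda>z. (z - \<zeta>) ^ n * q z) TV * P"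
      by simp
    also have "norm \<dots> \<le> norm (fcalc (G1 \<union> G2) (\<lambda>z. (z - \<zeta>) ^ n * q z) TV) * norm P" by (rule norm_mult_ineq)
    also have "\<dots> \<le> (C1 * e ^ n) * norm P"
    proof (intro mult_right_mono C1(2) ballI)
      show "(\<lambda>z. (z - \<zeta>) ^ n * q z) holomorphic_on (G1 \<union> G2)" by (intro holomorphic_intros q)
      show "norm ((z - \<zeta>) ^ n * q z) \<le> e ^ n" for z
        using G1r(2) e by (auto simp: q_def norm_mult norm_power dist_norm norm_minus_commute intro!: power_mono)
    qed simp
    finally show ?thesis by (simp add: mult_ac)
  qed
  ultimately show ?thesis by blast
qed

section \<open>From a function of an operator back to the operator\<close>

lemma compact_local_to_global:
  assumes K: "compact K" and loc: "\<And>x. x \<in> K \<Longrightarrow> \<exists>U. open U \<and> x \<in> U \<and> P U"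
    and empty: "P {}" and un: "\<And>U V. P U \<Longrightarrow> P V \<Longrightarrow> P (U \<union> V)"
  obtains W where "K \<subseteq> W" "P W"
proof -
  let ?\<U> = "{U. open U \<and> P U}"
  have "K \<subseteq> \<Union>?\<U>" using loc by blast
  moreover have "\<And>B. B \<in> ?\<U> \<Longrightarrow> open B" by simp
  ultimately obtain \<D> where \<D>: "\<D> \<subseteq> ?\<U>" "finite \<D>" "K \<subseteq> \<Union>\<D>"
    by (rule compactE[OF K])
  have "P (\<Union>\<D>)" using \<D>(2,1)
  proof (induction rule: finite_induct)
    case (insert U \<D>)
    then show ?case using un[of U "\<Union>\<D>"] by auto
  qed (simp add: empty)
  with \<D>(3) show ?thesis by (rule that)
qed

text \<open>The binomial estimate, by induction on \<open>n\<close> for all products \<open>a\<^sup>k b\<^sup>l p\<close> at once, which avoids binomial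
coefficients.\<close>

lemma norm_commuting_binomial:
  fixes a b p :: "'a::complex_banach_algebra"
  assumes ab: "a * b = b * a" and bnd: "\<And>k l. norm (a ^ k * b ^ l * p) \<le> C * e ^ (k + l)"
  shows "norm ((a + b) ^ n * p) \<le> C * (2 * e) ^ n"
proof -
  have "norm ((a + b) ^ n * (a ^ k * b ^ l * p)) \<le> C * (2 * e) ^ n * e ^ (k + l)" for n k l
  proof (induction n arbitrary: k l)
    case 0
    show ?case using bnd by simp
  next
    case (Suc n)
    have "b * a ^ k = a ^ k * b" using commuting_power[OF ab, of k] by simp
    then have "(a + b) * (a ^ k * b ^ l * p) = a ^ Suc k * b ^ l * p + a ^ k * b ^ Suc l * p"
      by (simp add: distrib_right mult.assoc[symmetric])
    moreover have "(a + b) ^ Suc n * x = (a + b) ^ n * ((a + b) * x)" for x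
      by (simp only: power_Suc2 mult.assoc)
    ultimately have "(a + b) ^ Suc n * (a ^ k * b ^ l * p) =
        (a + b) ^ n * (a ^ Suc k * b ^ l * p) + (a + b) ^ n * (a ^ k * b ^ Suc l * p)"
      by (simp only: distrib_left)
    also have "norm \<dots> \<le> C * (2 * e) ^ n * e ^ (Suc k + l) + C * (2 * e) ^ n * e ^ (k + Suc l)"
      by (intro norm_triangle_mono Suc.IH)
    also have "\<dots> = C * (2 * e) ^ Suc n * e ^ (k + l)" by simp
    finally show ?case .
  qed
  from this[of n 0 0] show ?thesis by simp
qed

lemma ex_local_spectral_projection:
  fixes T :: "'a::complex_banach cop"
  assumes D: "spectral_nbhd T \<Omega>" and f: "f holomorphic_on \<Omega>" and nc: "\<forall>U\<in>components \<Omega>. \<not> f constant_on U"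
    and good: "good_discrete (blinfun_of_cop (fcalc \<Omega> f T))"
    and \<zeta>: "\<zeta> \<in> alg_spectrum T" "deriv f \<zeta> \<noteq> 0" and e: "e > 0"
  shows "\<exists>U E C'. open U \<and> \<zeta> \<in> U \<and> U \<subseteq> ball \<zeta> e \<and> inj_on f U \<and>
    root_multiplier T (\<lambda>z. if z \<in> U then 1 else 0) E \<and>
    (\<forall>n. norm ((T - \<zeta> *\<^sub>C 1) ^ n * E) \<le> C' * e ^ n)"
proof -
  let ?A = "fcalc \<Omega> f T"
  have basis: "root_spaces_basis (blinfun_of_cop ?A)" using good by (simp add: good_discrete_def)
  then have dense: "dense_root_spaces ?A" by (simp add: root_spaces_basis_cop)
  obtain C where C: "C > 0" "unconditionality_bound (eigenvalues ?A) (alg_root_space ?A) C"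
    using basis by (auto simp: root_spaces_basis_cop)
  obtain S where S: "root_multiplier ?A (\<lambda>\<mu>. \<mu>) S" using scalar_part_cop[OF basis] by blast
  have N: "alg_spectrum (?A - S) \<subseteq> {0}" using good good_discrete_cop[OF S] by simp
  show ?thesis
    by (rule local_spectral_projection[OF D f nc refl dense C(2) less_imp_le[OF C(1)] S N \<zeta> e])
qed

text \<open>Density: the algebraic root spaces of \<open>f(T)\<close> are contained in the span of those of \<open>T\<close>. Unconditionality:
by compactness of the spectrum it is enough to find, near each point, a set \<open>U\<close> for which the inequality
holds with \<open>F1 \<subseteq> U\<close> and arbitrary \<open>F2\<close>. For the set \<open>U\<close> from \<open>ex_local_spectral_projection\<close>, applying \<open>E\<close> to the
sum over \<open>F2\<close> leaves the sum over \<open>F2 \<inter> U\<close>, whose terms belong to different root spaces of \<open>f(T)\<close>.\<close>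

theorem root_spaces_basis_of_fcalc:
  fixes T :: "'a::complex_banach cop"
  assumes D: "spectral_nbhd T \<Omega>" and f: "f holomorphic_on \<Omega>" and nc: "\<forall>U\<in>components \<Omega>. \<not> f constant_on U"
    and df: "\<And>z. z \<in> alg_spectrum T \<Longrightarrow> deriv f z \<noteq> 0"
    and good: "good_discrete (blinfun_of_cop (fcalc \<Omega> f T))"
  shows "root_spaces_basis (blinfun_of_cop T)"
proof -
  define A where "A = fcalc \<Omega> f T"
  let ?I = "eigenvalues T" and ?E = "alg_root_space T" and ?\<sigma> = "alg_spectrum T"
  have basisA: "root_spaces_basis (blinfun_of_cop A)" using good by (simp add: A_def good_discrete_def)
  then have cA: "countable (eigenvalues A)" and denseA: "dense_root_spaces A" by (auto simp: root_spaces_basis_cop)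
  obtain C where C: "C > 0" "unconditionality_bound (eigenvalues A) (alg_root_space A) C"
    using basisA by (auto simp: root_spaces_basis_cop)
  have \<Omega>: "?\<sigma> \<subseteq> \<Omega>" using D by (simp add: spectral_nbhd_def)
  have I\<sigma>: "?I \<subseteq> ?\<sigma>" by (rule eigenvalues_subset_spectrum)
  have eigA: "eigenvalues A = f ` ?I" unfolding A_def by (rule eigenvalues_fcalc[OF D f nc])
  have sub: "?E z \<subseteq> alg_root_space A (f z)" if "z \<in> ?I" for z
    unfolding A_def using that I\<sigma> \<Omega> by (intro alg_root_space_fcalc[OF D f]) auto
  note local = ex_local_spectral_projection[OF D f nc good _ df]

  have "countable ?I"
  proof -
    have "?I \<subseteq> (\<Union>\<mu>\<in>eigenvalues A. {z \<in> ?\<sigma>. f z = \<mu>})" using I\<sigma> eigA by auto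
    moreover have "countable (\<Union>\<mu>\<in>eigenvalues A. {z \<in> ?\<sigma>. f z = \<mu>})"
      using cA alg_root_space_fcalc_decomposition(1)[OF D f nc] by (auto intro!: countable_UN intro: countable_finite)
    ultimately show ?thesis by (rule countable_subset)
  qed
  moreover have denseT: "dense_root_spaces T"
  proof -
    have "alg_root_space A \<mu> \<subseteq> complex_vector.span (\<Union>z\<in>?I. ?E z)" for \<mu>
    proof
      fix x assume "x \<in> alg_root_space A \<mu>"
      then obtain y where y: "\<forall>z\<in>{z \<in> ?\<sigma>. f z = \<mu>}. y z \<in> ?E z" "x = (\<Sum>z\<in>{z \<in> ?\<sigma>. f z = \<mu>}. y z)"
        using alg_root_space_fcalc_decomposition(2)[OF D f nc] unfolding A_def by blast
      have "y z \<in> complex_vector.span (\<Union>z\<in>?I. ?E z)" if "z \<in> {z \<in> ?\<sigma>. f z = \<mu>}" for z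
      proof (cases "y z = 0")
        case True
        then show ?thesis by (simp add: complex_vector.span_zero)
      next
        case False
        then have "z \<in> ?I" using y(1) that eigenvalue_of_root_vector by blast
        then show ?thesis using y(1) that by (intro complex_vector.span_base) blast
      qed
      then show "x \<in> complex_vector.span (\<Union>z\<in>?I. ?E z)" unfolding y(2) by (rule complex_vector.span_sum)
    qed
    then have "complex_vector.span (\<Union>\<mu>\<in>eigenvalues A. alg_root_space A \<mu>) \<subseteq> complex_vector.span (\<Union>z\<in>?I. ?E z)"
      by (intro complex_vector.span_minimal) auto
    then show ?thesis using denseA closure_mono unfolding dense_root_spaces_def by blast
  qed
  moreover have "\<exists>C'>0. unconditionality_bound ?I ?E C'"
  proof -
    define bound where "bound W K \<longleftrightarrow> (\<forall>F1 F2 x. finite F2 \<and> F1 \<subseteq> F2 \<and> F1 \<subseteq> W \<and> F2 \<subseteq> ?I \<and>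
        (\<forall>z\<in>F2. x z \<in> ?E z) \<longrightarrow> norm (\<Sum>z\<in>F1. x z) \<le> K * norm (\<Sum>z\<in>F2. x z))" for W K
    have boundD: "norm (\<Sum>z\<in>F1. x z) \<le> K * norm (\<Sum>z\<in>F2. x z)"
      if "bound W K" "finite F2 \<and> F1 \<subseteq> F2 \<and> F1 \<subseteq> W \<and> F2 \<subseteq> ?I \<and> (\<forall>z\<in>F2. x z \<in> ?E z)" for W K F1 F2 x
      using that unfolding bound_def by blast
    define bounded_on where "bounded_on W \<longleftrightarrow> (\<exists>K\<ge>0. bound W K)" for W
    obtain W where W: "?\<sigma> \<subseteq> W" "bounded_on W"
    proof (rule compact_local_to_global[OF compact_alg_spectrum[of T], of bounded_on])
      fix \<zeta> assume \<zeta>: "\<zeta> \<in> ?\<sigma>"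
      obtain U E where U: "open U" "\<zeta> \<in> U" "inj_on f U" and E: "root_multiplier T (\<lambda>z. if z \<in> U then 1 else 0) E"
        using local[OF \<zeta> \<zeta>, of 1] by auto
      have "bounded_on U"
        unfolding bounded_on_def bound_def
      proof (intro exI[of _ "C * norm E"] conjI allI impI)
        fix F1 F2 x
        assume F: "finite F2 \<and> F1 \<subseteq> F2 \<and> F1 \<subseteq> U \<and> F2 \<subseteq> ?I \<and> (\<forall>z\<in>F2. x z \<in> ?E z)"
        \<comment> \<open>index the terms by \<open>\<mu> = f z\<close> to view them in the root spaces of \<open>A\<close>\<close>
        define g where "g = the_inv_into U f"
        have g: "g (f z) = z" if "z \<in> U" for z using U(3) that by (simp add: g_def the_inv_into_f_f)
        have conv: "(\<Sum>\<mu>\<in>f ` H. x (g \<mu>)) = (\<Sum>z\<in>H. x z)" if "H \<subseteq> U" for H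
          using that g by (subst sum.reindex[OF inj_on_subset[OF U(3) that]]) (auto intro!: sum.cong)
        have Ux: "x (g \<mu>) \<in> alg_root_space A \<mu>" if m: "\<mu> \<in> f ` (F2 \<inter> U)" for \<mu>
        proof -
          obtain z where z: "z \<in> F2" "z \<in> U" "\<mu> = f z" using m by blast
          then have "x z \<in> alg_root_space A (f z)" using F sub[of z] by blast
          then show ?thesis using z g by simp
        qed
        have "norm (\<Sum>z\<in>F1. x z) = norm (\<Sum>\<mu>\<in>f ` F1. x (g \<mu>))" using conv F by simp
        also have "\<dots> \<le> C * norm (\<Sum>\<mu>\<in>f ` (F2 \<inter> U). x (g \<mu>))"
          using F Ux eigA by (intro unconditionality_boundD[OF C(2)]) auto
        also have "(\<Sum>\<mu>\<in>f ` (F2 \<inter> U). x (g \<mu>)) = (\<Sum>z\<in>F2 \<inter> U. x z)" using conv by simp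
        also have "\<dots> = cop_apply E (\<Sum>z\<in>F2. x z)"
        proof -
          have "cop_apply E (\<Sum>z\<in>F2. x z) = (\<Sum>z\<in>F2. cop_apply E (x z))"
            using bounded_linear_cop_apply[of E] by (simp add: linear_sum bounded_linear.linear)
          also have "\<dots> = (\<Sum>z\<in>F2. if z \<in> U then x z else 0)"
            using F E by (intro sum.cong) (auto simp: root_multiplier_def scaleC_one)
          also have "\<dots> = (\<Sum>z\<in>F2 \<inter> U. x z)" using F by (simp add: sum.inter_restrict)
          finally show ?thesis by simp
        qed
        also have "C * norm (cop_apply E (\<Sum>z\<in>F2. x z)) \<le> C * (norm E * norm (\<Sum>z\<in>F2. x z))"
          using C(1) by (intro mult_left_mono norm_cop_apply) simp
        finally show "norm (\<Sum>z\<in>F1. x z) \<le> C * norm E * norm (\<Sum>z\<in>F2. x z)" by (simp add: mult.assoc)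
      qed (use C(1) in simp)
      then show "\<exists>U. open U \<and> \<zeta> \<in> U \<and> bounded_on U" using U by blast
    next
      show "bounded_on {}" unfolding bounded_on_def bound_def by (intro exI[of _ 0]) auto
    next
      fix U V assume "bounded_on U" "bounded_on V"
      then obtain K L where K: "K \<ge> 0" "bound U K" and L: "L \<ge> 0" "bound V L"
        unfolding bounded_on_def by blast
      show "bounded_on (U \<union> V)"
        unfolding bounded_on_def bound_def
      proof (intro exI[of _ "K + L"] conjI allI impI)
        fix F1 F2 x
        assume F: "finite F2 \<and> F1 \<subseteq> F2 \<and> F1 \<subseteq> U \<union> V \<and> F2 \<subseteq> ?I \<and> (\<forall>z\<in>F2. x z \<in> ?E z)"
        then have "finite F1" by (auto intro: finite_subset)
        then have "(\<Sum>z\<in>F1. x z) = (\<Sum>z\<in>F1 \<inter> U. x z) + (\<Sum>z\<in>F1 - U. x z)" by (rule sum.Int_Diff)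
        also have "norm \<dots> \<le> K * norm (\<Sum>z\<in>F2. x z) + L * norm (\<Sum>z\<in>F2. x z)"
          using F by (intro norm_triangle_mono boundD[OF K(2)] boundD[OF L(2)]) auto
        finally show "norm (\<Sum>z\<in>F1. x z) \<le> (K + L) * norm (\<Sum>z\<in>F2. x z)" by (simp add: distrib_right)
      qed (use K L in simp)
    qed
    then obtain K where K: "K \<ge> 0" "bound W K" unfolding bounded_on_def by blast
    have "norm (\<Sum>z\<in>F1. x z) \<le> (K + 1) * norm (\<Sum>z\<in>F2. x z)"
      if F: "finite F2 \<and> F1 \<subseteq> F2 \<and> F2 \<subseteq> ?I \<and> (\<forall>z\<in>F2. x z \<in> ?E z)" for F1 F2 x
    proof -
      have "F1 \<subseteq> W" using F I\<sigma> W(1) by blast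
      then have "norm (\<Sum>z\<in>F1. x z) \<le> K * norm (\<Sum>z\<in>F2. x z)" using F by (intro boundD[OF K(2)]) simp
      also have "\<dots> \<le> (K + 1) * norm (\<Sum>z\<in>F2. x z)" by (intro mult_right_mono) auto
      finally show ?thesis .
    qed
    then show ?thesis
      unfolding unconditionality_bound_def using K(1) by (intro exI[of _ "K + 1"] conjI allI impI) auto
  qed
  ultimately show ?thesis by (simp add: root_spaces_basis_cop)
qed

text \<open>Near each point \<open>\<zeta>\<close> of the spectrum both \<open>T - \<zeta>\<close> and \<open>\<zeta> - S\<close> have powers of order \<open>e\<^sup>n\<close> on the range of \<open>E\<close>; for
the second one this holds because it is a multiplier there with values of modulus at most \<open>e\<close>. So the
powers of their sum \<open>T - S\<close> are of order \<open>(2e)\<^sup>n\<close>. Such estimates pass to finite unions, hence to a set that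
contains the whole spectrum, where the projection is the identity.\<close>

theorem quasinilpotent_minus_scalar_part:
  fixes T :: "'a::complex_banach cop"
  assumes basis: "root_spaces_basis (blinfun_of_cop T)" and S: "root_multiplier T (\<lambda>\<mu>. \<mu>) S"
    and local: "\<And>\<zeta> e. \<zeta> \<in> alg_spectrum T \<Longrightarrow> e > 0 \<Longrightarrow>
      \<exists>U E C. open U \<and> \<zeta> \<in> U \<and> U \<subseteq> ball \<zeta> e \<and> root_multiplier T (\<lambda>z. if z \<in> U then 1 else 0) E \<and>
        (\<forall>n. norm ((T - \<zeta> *\<^sub>C 1) ^ n * E) \<le> C * e ^ n)"
  shows "alg_spectrum (T - S) \<subseteq> {0}"
proof -
  let ?I = "eigenvalues T" and ?E = "alg_root_space T" and ?\<sigma> = "alg_spectrum T"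
  have I\<sigma>: "?I \<subseteq> ?\<sigma>" by (rule eigenvalues_subset_spectrum)
  have denseT: "dense_root_spaces T" using basis by (simp add: root_spaces_basis_cop)
  obtain CT where CT: "CT > 0" "unconditionality_bound ?I ?E CT" using basis by (auto simp: root_spaces_basis_cop)
  have TS: "T * S = S * T" using root_multiplier_commute[OF denseT S, of T] by simp
  have "alg_spectrum (T - S) \<subseteq> cball 0 (2 * e)" if e: "e > 0" for e
  proof -
    define small_on where "small_on W \<longleftrightarrow> (\<exists>P. root_multiplier T (\<lambda>z. if z \<in> W then 1 else 0) P \<and>
        (\<exists>K. \<forall>n. norm ((T - S) ^ n * P) \<le> K * (2 * e) ^ n))" for W
    obtain W where W: "?\<sigma> \<subseteq> W" "small_on W"
    proof (rule compact_local_to_global[OF compact_alg_spectrum[of T], of small_on])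
      fix \<zeta> assume \<zeta>: "\<zeta> \<in> ?\<sigma>"
      obtain U E C1 where U: "open U" "\<zeta> \<in> U" "U \<subseteq> ball \<zeta> e"
        and E: "root_multiplier T (\<lambda>z. if z \<in> U then 1 else 0) E"
        and C1: "\<And>n. norm ((T - \<zeta> *\<^sub>C 1) ^ n * E) \<le> C1 * e ^ n"
        using local[OF \<zeta> e] by blast
      define a b where "a = T - \<zeta> *\<^sub>C 1" and "b = \<zeta> *\<^sub>C 1 - S"
      have ab: "a * b = b * a" using TS
        by (simp add: a_def b_def algebra_simps complex_vector.scale_right_diff_distrib scaleC_mult_left mult_scaleC_right)
      have bT: "b * T = T * b" using TS
        by (simp add: b_def alg_distribs)
      have bE: "b * E = E * b" by (rule root_multiplier_commute[OF denseT E bT])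
      have EE: "E * E = E" by (rule root_multiplier_unique[OF denseT root_multiplier_mult[OF E E] E]) auto
      have bn: "norm (b ^ n * E) \<le> 4 * CT * e ^ n" for n
      proof -
        define c where "c \<mu> = (\<zeta> - \<mu>) ^ n * (if \<mu> \<in> U then 1 else 0)" for \<mu>
        have m: "root_multiplier T c (b ^ n * E)"
          unfolding b_def c_def
          by (intro root_multiplier_mult root_multiplier_power root_multiplier_diff root_multiplier_const S E)
        have "norm (c \<mu>) \<le> e ^ n" for \<mu>
          using U(3) e by (auto simp: c_def norm_power dist_norm intro!: power_mono)
        then have "\<exists>M. root_multiplier T c M \<and> norm M \<le> 4 * CT * e ^ n"
          using CT(1) e by (intro ex_root_multiplier[OF denseT CT(2)]) simp_all
        then obtain M where M: "root_multiplier T c M" "norm M \<le> 4 * CT * e ^ n" by blast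
        then show ?thesis using root_multiplier_unique[OF denseT m M(1) refl] by simp
      qed
      have C1': "C1 \<ge> 0" using order_trans[OF norm_ge_zero C1[of 0]] by simp
      have "norm (a ^ k * b ^ l * E) \<le> (C1 * (4 * CT)) * e ^ (k + l)" for k l
      proof -
        have "a ^ k * b ^ l * E = (a ^ k * E) * (b ^ l * E)"
          using EE commuting_power[OF bE, of l] by (metis mult.assoc)
        then have "norm (a ^ k * b ^ l * E) \<le> norm (a ^ k * E) * norm (b ^ l * E)" by (simp add: norm_mult_ineq)
        also have "\<dots> \<le> (C1 * e ^ k) * (4 * CT * e ^ l)"
          using C1[of k] bn[of l] C1' e unfolding a_def by (intro mult_mono) auto
        finally show ?thesis by (simp add: power_add mult_ac)
      qed
      from norm_commuting_binomial[OF ab this]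
      have "norm ((T - S) ^ n * E) \<le> (C1 * (4 * CT)) * (2 * e) ^ n" for n by (simp add: a_def b_def)
      then have "small_on U" unfolding small_on_def using E by blast
      then show "\<exists>U. open U \<and> \<zeta> \<in> U \<and> small_on U" using U by blast
    next
      show "small_on {}" unfolding small_on_def
        by (intro exI[of _ 0] conjI) (auto simp: root_multiplier_def)
    next
      fix U V assume "small_on U" "small_on V"
      then obtain P Q K L where P: "root_multiplier T (\<lambda>z. if z \<in> U then 1 else 0) P"
          "\<And>n. norm ((T - S) ^ n * P) \<le> K * (2 * e) ^ n"
        and Q: "root_multiplier T (\<lambda>z. if z \<in> V then 1 else 0) Q"
          "\<And>n. norm ((T - S) ^ n * Q) \<le> L * (2 * e) ^ n"
        unfolding small_on_def by blast
      \<comment> \<open>\<open>Q * (1 - P)\<close> is the projection that belongs to \<open>V - U\<close>\<close>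
      have "root_multiplier T (\<lambda>z. if z \<in> U \<union> V then 1 else 0) (P + Q * (1 - P))"
        using P(1) Q(1) by (auto simp: root_multiplier_def scaleC_one)
      moreover have "norm ((T - S) ^ n * (P + Q * (1 - P))) \<le> (K + L * norm (1 - P)) * (2 * e) ^ n" for n
      proof -
        have "norm ((T - S) ^ n * (P + Q * (1 - P))) \<le> norm ((T - S) ^ n * P) + norm ((T - S) ^ n * Q) * norm (1 - P)"
          unfolding distrib_left mult.assoc[symmetric]
          by (intro order_trans[OF norm_triangle_ineq] add_left_mono norm_mult_ineq)
        also have "\<dots> \<le> K * (2 * e) ^ n + L * (2 * e) ^ n * norm (1 - P)"
          by (intro add_mono mult_right_mono P Q) simp
        finally show ?thesis by (simp add: algebra_simps)
      qed
      ultimately show "small_on (U \<union> V)" unfolding small_on_def by blast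
    qed
    then obtain P K where P: "root_multiplier T (\<lambda>z. if z \<in> W then 1 else 0) P"
      "\<And>n. norm ((T - S) ^ n * P) \<le> K * (2 * e) ^ n" unfolding small_on_def by blast
    have "P = 1"
      using W(1) I\<sigma> by (intro root_multiplier_unique[OF denseT P(1) root_multiplier_one]) auto
    then show ?thesis using P(2) e by (intro spectrum_of_power_bound[of _ K]) auto
  qed
  note small = this
  show ?thesis
  proof
    fix z assume z: "z \<in> alg_spectrum (T - S)"
    show "z \<in> {0}"
    proof (rule ccontr)
      assume "z \<notin> {0}"
      then have "norm z / 4 > 0" by simp
      from small[OF this] z show False using \<open>z \<notin> {0}\<close> by force
    qed
  qed
qed

theorem theorem4p6:
  fixes T :: "'a::complex_banach \<Rightarrow>\<^sub>L 'a"
    and \<Omega> :: "complex set"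
    and f :: "complex \<Rightarrow> complex"
  assumes "separable_space (euclidean :: 'a topology)"
    and "complex_linear T"
    and "bounded \<Omega>" and "open \<Omega>" and "spectrum T \<subseteq> \<Omega>"
    and "f holomorphic_on \<Omega>"
    and "\<forall>U\<in>components \<Omega>. \<not> f constant_on U"
  shows "(root_spaces_basis T \<longrightarrow> root_spaces_basis (riesz_dunford \<Omega> f T)) \<and>
    ((\<forall>z\<in>spectrum T. deriv f z \<noteq> 0) \<longrightarrow> good_discrete (riesz_dunford \<Omega> f T) \<longrightarrow>
       good_discrete T \<and> root_spaces_basis T)"
proof -
  have T: "T = blinfun_of_cop (Cop T)" using assms(2) by (simp add: Cop_inverse)
  have sp: "spectrum T = alg_spectrum (Cop T)" using spectrum_cop[of "Cop T"] T by simp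
  then have D: "spectral_nbhd (Cop T) \<Omega>" using assms(4,5) by (simp add: spectral_nbhd_def)
  have rd: "riesz_dunford \<Omega> f T = blinfun_of_cop (fcalc \<Omega> f (Cop T))"
    using riesz_dunford_cop[OF D assms(6)] T by simp
  have "root_spaces_basis T \<Longrightarrow> root_spaces_basis (riesz_dunford \<Omega> f T)"
    using root_spaces_basis_fcalc[OF D assms(6,7)] T rd by simp
  moreover have "good_discrete T \<and> root_spaces_basis T"
    if df: "\<forall>z\<in>spectrum T. deriv f z \<noteq> 0" and good: "good_discrete (riesz_dunford \<Omega> f T)"
  proof -
    have good': "good_discrete (blinfun_of_cop (fcalc \<Omega> f (Cop T)))" using good rd by simp
    have basis: "root_spaces_basis (blinfun_of_cop (Cop T))"
      using df sp by (intro root_spaces_basis_of_fcalc[OF D assms(6,7) _ good']) simp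
    then obtain S where S: "root_multiplier (Cop T) (\<lambda>\<mu>. \<mu>) S" using scalar_part_cop by blast
    have "alg_spectrum (Cop T - S) \<subseteq> {0}"
    proof (rule quasinilpotent_minus_scalar_part[OF basis S])
      fix \<zeta> and e :: real assume \<zeta>: "\<zeta> \<in> alg_spectrum (Cop T)" and e: "e > 0"
      have "deriv f \<zeta> \<noteq> 0" using df sp \<zeta> by simp
      from ex_local_spectral_projection[OF D assms(6,7) good' \<zeta> this e]
      show "\<exists>U E C. open U \<and> \<zeta> \<in> U \<and> U \<subseteq> ball \<zeta> e \<and>
          root_multiplier (Cop T) (\<lambda>z. if z \<in> U then 1 else 0) E \<and>
          (\<forall>n. norm ((Cop T - \<zeta> *\<^sub>C 1) ^ n * E) \<le> C * e ^ n)" by blast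
    qed
    then show ?thesis using good_discrete_cop[OF S] basis T by simp
  qed
  ultimately show ?thesis by blast
qed

end
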